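(* Let $g_t$ be the hypoelliptic Brownian motion on the Heisenberg group $\mathbb{H}$ and let $g^{\ast}_t:=\max_{0\le s\le t}|g_s|$. Then there exists a deterministic constant $c\in(0,\infty)$ such that \[ \liminf_{t\to\infty}\phi(t)\,g^{\ast}_t=c\quad\text{almost surely},\qquad \phi(t):=\sqrt{\frac{\log\log t}{t}}. \]
   Context: The Heisenberg group $\mathbb{H}$ is $\mathbb{R}^2\times\mathbb{R}$ with multiplication $(\mathbf{v}_1,z_1)\cdot(\mathbf{v}_2,z_2)=(\mathbf{v}_1+\mathbf{v}_2,\ z_1+z_2+\tfrac12\omega(\mathbf{v}_1,\mathbf{v}_2))$, where $\omega((x_1,y_1),(x_2,y_2))=x_1y_2-x_2y_1$; the identity is $e=(0,0,0)$ and $(\mathbf{v},z)^{-1}=(-\mathbf{v},-z)$. The homogeneous norm on $\mathbb{H}$ is $|(\mathbf{x},z)|:=\left(\|\mathbf{x}\|_{\mathbb{R}^2}^4+z^2\right)^{1/4}$. Let $\bm{W}_t=(W_1(t),W_2(t))$ be a standard two-dimensional Brownian motion on a filtered probability space $(\Omega,\mathcal{F},\mathcal{F}_t,\mathbb{P})$. The hypoelliptic Brownian motion on $\mathbb{H}$ is $g_t:=(\bm{W}_t,A_t)$, where $A_t:=\frac12\int_0^t\omega(\bm{W}_s,d\bm{W}_s)=\frac12\int_0^t (W_1(s)\,dW_2(s)-W_2(s)\,dW_1(s))$ is Lévy's stochastic area (Itô integral). *)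

theory Defs
  imports "HOL-Probability.Probability"
begin

definition std_BM2 :: "'a measure \<Rightarrow> (real \<Rightarrow> 'a \<Rightarrow> real) \<Rightarrow> (real \<Rightarrow> 'a \<Rightarrow> real) \<Rightarrow> bool" where
  "std_BM2 M W1 W2 \<longleftrightarrow>
     prob_space M \<and>
     (\<forall>t\<ge>0. W1 t \<in> borel_measurable M \<and> W2 t \<in> borel_measurable M) \<and>
     (\<forall>\<omega>\<in>space M. W1 0 \<omega> = 0 \<and> W2 0 \<omega> = 0) \<and>
     (\<forall>\<omega>\<in>space M. continuous_on {0..} (\<lambda>t. W1 t \<omega>) \<and> continuous_on {0..} (\<lambda>t. W2 t \<omega>)) \<and>
     (\<forall>s t. 0 \<le> s \<and> s < t \<longrightarrow>
        distributed M lborel (\<lambda>\<omega>. W1 t \<omega> - W1 s \<omega>) (normal_density 0 (sqrt (t - s))) \<and>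
        distributed M lborel (\<lambda>\<omega>. W2 t \<omega> - W2 s \<omega>) (normal_density 0 (sqrt (t - s)))) \<and>
     (\<forall>(n::nat) (\<tau>::nat \<Rightarrow> real). 0 \<le> \<tau> 0 \<and> (\<forall>i<n. \<tau> i \<le> \<tau> (Suc i)) \<longrightarrow>
        prob_space.indep_vars M (\<lambda>_. borel)
          (\<lambda>(b, i) \<omega>. (if b then W1 else W2) (\<tau> (Suc i)) \<omega> - (if b then W1 else W2) (\<tau> i) \<omega>)
          (UNIV \<times> {..<n}))"

text \<open>Left-endpoint Riemann sum of (1/2) \<integral>_0^t (W1 dW2 - W2 dW1) along the n-th dyadic partition
  of [0,t].\<close>
definition levy_area_sum ::
  "(real \<Rightarrow> 'a \<Rightarrow> real) \<Rightarrow> (real \<Rightarrow> 'a \<Rightarrow> real) \<Rightarrow> real \<Rightarrow> nat \<Rightarrow> 'a \<Rightarrow> real" where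
  "levy_area_sum W1 W2 t n \<omega> =
     (1/2) * (\<Sum>k<2^n.
        let a = real k * t / 2^n; b = real (Suc k) * t / 2^n in
        W1 a \<omega> * (W2 b \<omega> - W2 a \<omega>) - W2 a \<omega> * (W1 b \<omega> - W1 a \<omega>))"

text \<open>A is (a continuous version of) Levy's stochastic area, the Ito integral
  (1/2) \<integral>_0^t (W1 dW2 - W2 dW1): for each t \<ge> 0, A t is the limit in probability
  of the left-endpoint (Ito) Riemann sums.\<close>
definition is_levy_area :: "'a measure \<Rightarrow> (real \<Rightarrow> 'a \<Rightarrow> real) \<Rightarrow> (real \<Rightarrow> 'a \<Rightarrow> real)
    \<Rightarrow> (real \<Rightarrow> 'a \<Rightarrow> real) \<Rightarrow> bool" where
  "is_levy_area M W1 W2 A \<longleftrightarrow>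
     (\<forall>t\<ge>0. A t \<in> borel_measurable M) \<and>
     (\<forall>\<omega>\<in>space M. continuous_on {0..} (\<lambda>t. A t \<omega>)) \<and>
     (\<forall>t\<ge>0. \<forall>\<epsilon>>0. (\<lambda>n. measure M {\<omega>\<in>space M. \<bar>levy_area_sum W1 W2 t n \<omega> - A t \<omega>\<bar> > \<epsilon>})
                      \<longlonglongrightarrow> 0)"

definition heis_norm :: "(real \<times> real) \<times> real \<Rightarrow> real" where
  "heis_norm g = (let ((x, y), z) = g in ((x^2 + y^2)^2 + z^2) powr (1/4))"

definition hyp_BM :: "(real \<Rightarrow> 'a \<Rightarrow> real) \<Rightarrow> (real \<Rightarrow> 'a \<Rightarrow> real) \<Rightarrow> (real \<Rightarrow> 'a \<Rightarrow> real)
    \<Rightarrow> real \<Rightarrow> 'a \<Rightarrow> (real \<times> real) \<times> real" where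
  "hyp_BM W1 W2 A t \<omega> = ((W1 t \<omega>, W2 t \<omega>), A t \<omega>)"

definition running_max :: "(real \<Rightarrow> 'a \<Rightarrow> real) \<Rightarrow> (real \<Rightarrow> 'a \<Rightarrow> real) \<Rightarrow> (real \<Rightarrow> 'a \<Rightarrow> real)
    \<Rightarrow> real \<Rightarrow> 'a \<Rightarrow> real" where
  "running_max W1 W2 A t \<omega> = (SUP s\<in>{0..t}. heis_norm (hyp_BM W1 W2 A s \<omega>))"

definition chung_rate :: "real \<Rightarrow> real" where
  "chung_rate t = sqrt (ln (ln t) / t)"

end

theory Submission
  imports Defs "HOL-Real_Asymp.Real_Asymp"
begin

text \<open>
  Let \<open>g\<^sup>*\<close> be the running maximum of the norm. The norm satisfies the triangle inequality, so replacing \<open>g\<close>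
  by its increments after a fixed time changes \<open>g\<^sup>*\<close> by a bounded amount; hence the limit inferior is measurable
  with respect to the future of every time and constant by the zero-one law. It remains to bound it away from
  \<open>0\<close> and \<open>\<infinity>\<close>.

  Lower bound: if \<open>g\<^sup>*\<close> is small on \<open>[0,t]\<close>, all increments of the first coordinate over a grid are small, which by
  independence has exponentially small probability; Borel-Cantelli along \<open>t = 2\<^sup>n\<close>.

  Upper bound: it suffices that \<open>g\<close> stays in a fixed ball during \<open>[0,4k]\<close> with probability at least \<open>q\<^sup>k\<close>. In a block
  of four unit time steps, the path is steered around a square loop that recentres the horizontal part and whose
  orientation is opposite to the sign of the vertical coordinate. The area gained inside one step is not
  controlled, but reflecting one coordinate shows that its sign is favourable with probability at least
  one half. The converse half of Borel-Cantelli is then applied at superexponentially growing times.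

  All identities in law are obtained on dyadic times, where the area is an almost sure limit of Riemann sums along
  one nested family of grids, so that shifts and Brownian scalings by powers of \<open>4\<close> act exactly on the sums.
\<close>

section \<open>The Heisenberg group\<close>

text \<open>No exact small-ball asymptotics enter. The zero-one law supplies the constant, so both
  bounds may be crude, as long as the probability of staying within norm r up to time t lies between
  two exponentials in t / r^2. The obstacle is the vertical coordinate. No density is at hand for
  it, so inside a unit step only its sign is prescribed, and its size is merely capped by the
  requirement that the path stay within norm C. This could become circular: C depends on the loop to
  be followed, and the loop has to cope with displacements of order C^2. The circle is avoided
  because the loop only has to beat the cross term between the horizontal parts, which is bounded by
  an absolute constant. A loop of fixed size therefore suffices, C is chosen afterwards, and the
  admissible range of the vertical coordinate is adapted to C at the end.\<close>

definition hmul :: "(real \<times> real) \<times> real \<Rightarrow> (real \<times> real) \<times> real \<Rightarrow> (real \<times> real) \<times> real" where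
  "hmul g h = ((fst (fst g) + fst (fst h), snd (fst g) + snd (fst h)),
     snd g + snd h + (fst (fst g) * snd (fst h) - fst (fst h) * snd (fst g)) / 2)"

text \<open>Attaching the complex number \<open>x^2 + y^2 + i z\<close> to a point makes the squared
  norm a modulus, so that the triangle inequality of the complex plane becomes available.\<close>

lemma heis_norm_eq_cmod: "heis_norm ((x, y), z) = sqrt (cmod (Complex (x\<^sup>2 + y\<^sup>2) z))"
proof -
  have "((x\<^sup>2 + y\<^sup>2)\<^sup>2 + z\<^sup>2) powr (1/4) = ((x\<^sup>2 + y\<^sup>2)\<^sup>2 + z\<^sup>2) powr (1/2 * (1/2))" by simp
  also have "\<dots> = sqrt (sqrt ((x\<^sup>2 + y\<^sup>2)\<^sup>2 + z\<^sup>2))"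
    by (simp only: powr_powr[symmetric]) (simp add: powr_half_sqrt)
  finally show ?thesis by (simp add: heis_norm_def cmod_def)
qed

lemma heis_norm_nonneg [simp]: "0 \<le> heis_norm g"
  by (cases g; cases "fst g") (auto simp: heis_norm_eq_cmod)

lemma heis_norm_square: "(heis_norm ((x, y), z))\<^sup>2 = cmod (Complex (x\<^sup>2 + y\<^sup>2) z)"
  by (simp add: heis_norm_eq_cmod)

lemma heis_norm_ge_horizontal: "x\<^sup>2 + y\<^sup>2 \<le> (heis_norm ((x, y), z))\<^sup>2"
  using complex_Re_le_cmod[of "Complex (x\<^sup>2 + y\<^sup>2) z"] by (simp add: heis_norm_square)

lemma heis_norm_ge_vertical: "\<bar>z\<bar> \<le> (heis_norm ((x, y), z))\<^sup>2"
  using abs_Im_le_cmod[of "Complex (x\<^sup>2 + y\<^sup>2) z"] by (simp add: heis_norm_square)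

lemma heis_norm_ge_fst: "\<bar>x\<bar> \<le> heis_norm ((x, y), z)"
proof -
  have "\<bar>x\<bar>\<^sup>2 \<le> (heis_norm ((x, y), z))\<^sup>2"
    using heis_norm_ge_horizontal[of x y z] by (simp add: add_increasing2 order_trans[rotated])
  then show ?thesis by (rule power2_le_imp_le) simp
qed

lemma heis_norm_le: "heis_norm ((x, y), z) \<le> \<bar>x\<bar> + \<bar>y\<bar> + sqrt \<bar>z\<bar>"
proof (rule power2_le_imp_le)
  have "(heis_norm ((x, y), z))\<^sup>2 \<le> \<bar>x\<^sup>2 + y\<^sup>2\<bar> + \<bar>z\<bar>"
    using cmod_le[of "Complex (x\<^sup>2 + y\<^sup>2) z"] by (simp add: heis_norm_square)
  also have "\<dots> \<le> (\<bar>x\<bar> + \<bar>y\<bar> + sqrt \<bar>z\<bar>)\<^sup>2"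
    by (simp add: power2_eq_square algebra_simps)
  finally show "(heis_norm ((x, y), z))\<^sup>2 \<le> (\<bar>x\<bar> + \<bar>y\<bar> + sqrt \<bar>z\<bar>)\<^sup>2" .
qed simp

text \<open>Cygan's argument: the complex numbers of the two factors add up to that of the product
  except for \<open>r\<close>, built from the scalar product and the symplectic form of the
  horizontal parts. By Lagrange's identity \<open>r\<close> is at most twice the product of the
  norms, which completes the square.\<close>

lemma heis_norm_hmul_le: "heis_norm (hmul g h) \<le> heis_norm g + heis_norm h"
proof -
  obtain x y z where g: "g = ((x, y), z)" by (metis surj_pair)
  obtain x' y' z' where h: "h = ((x', y'), z')" by (metis surj_pair)
  define r where "r = Complex (2 * (x * x' + y * y')) ((x * y' - x' * y) / 2)"
  have "(cmod r)\<^sup>2 = 4 * (x * x' + y * y')\<^sup>2 + (x * y' - x' * y)\<^sup>2 / 4"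
    unfolding r_def cmod_power2 complex.sel
    by (simp only: power_mult_distrib power_divide) simp
  also have "\<dots> \<le> 4 * ((x * x' + y * y')\<^sup>2 + (x * y' - x' * y)\<^sup>2)" by simp
  also have "\<dots> = 4 * ((x\<^sup>2 + y\<^sup>2) * (x'\<^sup>2 + y'\<^sup>2))"
    by (simp add: power2_eq_square algebra_simps)
  also have "\<dots> \<le> 4 * ((heis_norm g)\<^sup>2 * (heis_norm h)\<^sup>2)"
    unfolding g h by (intro mult_left_mono mult_mono heis_norm_ge_horizontal) auto
  also have "\<dots> = (2 * heis_norm g * heis_norm h)\<^sup>2" by (simp add: power2_eq_square)
  finally have r: "cmod r \<le> 2 * heis_norm g * heis_norm h"
    by (rule power2_le_imp_le) simp
  have "(heis_norm (hmul g h))\<^sup>2 = cmod (Complex (x\<^sup>2 + y\<^sup>2) z + Complex (x'\<^sup>2 + y'\<^sup>2) z' + r)"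
    unfolding g h hmul_def fst_conv snd_conv heis_norm_square r_def
    by (rule arg_cong[where f = cmod]) (simp add: complex_eq_iff power2_eq_square algebra_simps)
  also have "\<dots> \<le> cmod (Complex (x\<^sup>2 + y\<^sup>2) z) + cmod (Complex (x'\<^sup>2 + y'\<^sup>2) z') + cmod r"
    by (intro order_trans[OF norm_triangle_ineq] add_right_mono norm_triangle_ineq)
  also have "\<dots> \<le> (heis_norm g)\<^sup>2 + (heis_norm h)\<^sup>2 + 2 * heis_norm g * heis_norm h"
    using r by (simp add: g h heis_norm_square)
  also have "\<dots> = (heis_norm g + heis_norm h)\<^sup>2" by (simp add: power2_sum)
  finally show ?thesis by (rule power2_le_imp_le) simp
qed

lemma heis_norm_le_hmul: "heis_norm h \<le> heis_norm g + heis_norm (hmul g h)"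
proof -
  obtain x y z where g: "g = ((x, y), z)" by (metis surj_pair)
  define g' where "g' = ((- x, - y), - z)"
  have "hmul g' (hmul g h) = h"
    by (cases h; cases "fst h") (auto simp: hmul_def g'_def g field_simps)
  then have "heis_norm h \<le> heis_norm g' + heis_norm (hmul g h)"
    using heis_norm_hmul_le[of g' "hmul g h"] by simp
  also have "heis_norm g' = heis_norm g" by (simp add: g g'_def heis_norm_def)
  finally show ?thesis .
qed

text \<open>Two separate factors of equal modulus cover both uses: dilations (\<open>b = a\<close>)
  and reflections of one coordinate (\<open>b = - a\<close>).\<close>

lemma heis_norm_scale:
  assumes "\<bar>b\<bar> = \<bar>a\<bar>"
  shows "heis_norm ((a * x, b * y), a * b * z) = \<bar>a\<bar> * heis_norm ((x, y), z)"
proof -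
  have b: "b\<^sup>2 = a\<^sup>2" using assms by (metis power2_abs)
  have "(heis_norm ((a * x, b * y), a * b * z))\<^sup>2 = sqrt ((a\<^sup>2)\<^sup>2 * ((x\<^sup>2 + y\<^sup>2)\<^sup>2 + z\<^sup>2))"
  proof -
    have "((a * x)\<^sup>2 + (b * y)\<^sup>2)\<^sup>2 + (a * b * z)\<^sup>2 = (a\<^sup>2 * (x\<^sup>2 + y\<^sup>2))\<^sup>2 + (a\<^sup>2)\<^sup>2 * z\<^sup>2"
      by (simp only: power_mult_distrib b distrib_left) (simp add: power2_eq_square)
    also have "\<dots> = (a\<^sup>2)\<^sup>2 * ((x\<^sup>2 + y\<^sup>2)\<^sup>2 + z\<^sup>2)"
      by (metis power_mult_distrib distrib_left)
    finally have "((a * x)\<^sup>2 + (b * y)\<^sup>2)\<^sup>2 + (a * b * z)\<^sup>2 = (a\<^sup>2)\<^sup>2 * ((x\<^sup>2 + y\<^sup>2)\<^sup>2 + z\<^sup>2)" .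
    then show ?thesis unfolding heis_norm_square cmod_def by simp
  qed
  also have "\<dots> = (\<bar>a\<bar> * heis_norm ((x, y), z))\<^sup>2"
    unfolding power_mult_distrib heis_norm_square cmod_def
    by (simp only: real_sqrt_mult real_sqrt_abs) simp
  finally show ?thesis by (simp add: power2_eq_iff_nonneg)
qed

lemma continuous_on_heis_norm:
  assumes "continuous_on S f" "continuous_on S g" "continuous_on S h"
  shows "continuous_on S (\<lambda>t. heis_norm ((f t, g t), h t))"
  unfolding heis_norm_eq_cmod cmod_def complex.sel
  by (intro continuous_intros assms)

lemma borel_measurable_heis_norm [measurable]: "heis_norm \<in> borel_measurable borel"
proof -
  have "heis_norm = (\<lambda>g. sqrt (sqrt (((fst (fst g))\<^sup>2 + (snd (fst g))\<^sup>2)\<^sup>2 + (snd g)\<^sup>2)))"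
    by (auto simp: fun_eq_iff heis_norm_eq_cmod cmod_def)
  moreover have "continuous_on UNIV (\<lambda>g::(real \<times> real) \<times> real.
      sqrt (sqrt (((fst (fst g))\<^sup>2 + (snd (fst g))\<^sup>2)\<^sup>2 + (snd g)\<^sup>2)))"
    by (intro continuous_intros)
  ultimately show ?thesis
    by (metis borel_measurable_continuous_onI)
qed

section \<open>Dyadic numbers\<close>

definition dyads :: "real set" where
  "dyads = {real k / 2 ^ n | k n. True}"

lemma dyadsI: "real k / 2 ^ n \<in> dyads"
  by (auto simp: dyads_def)

lemma countable_dyads: "countable dyads"
proof -
  have "dyads = (\<lambda>(k, n). real k / 2 ^ n) ` UNIV" by (auto simp: dyads_def image_iff)
  then show ?thesis by (metis countableI_type countable_image)
qed

lemma dyads_nonneg: "t \<in> dyads \<Longrightarrow> 0 \<le> t"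
  by (auto simp: dyads_def)

lemma of_nat_dyads [simp, intro]: "real k \<in> dyads"
  using dyadsI[of k 0] by simp

lemma numeral_dyads [simp]: "0 \<in> dyads" "1 \<in> dyads" "numeral k \<in> dyads"
  using of_nat_dyads[of 0] of_nat_dyads[of 1] of_nat_dyads[of "numeral k"] by simp_all

lemma dyads_level:
  assumes "t \<in> dyads"
  obtains n where "\<And>m. n \<le> m \<Longrightarrow> t * 2 ^ m \<in> \<nat>"
proof -
  obtain k n where t: "t = real k / 2 ^ n" using assms by (auto simp: dyads_def)
  have "t * 2 ^ m = real (k * 2 ^ (m - n))" if "n \<le> m" for m
  proof -
    have "(2::real) ^ m = 2 ^ (m - n) * 2 ^ n" using that by (simp flip: power_add)
    then show ?thesis by (simp add: t)
  qed
  then have "\<And>m. n \<le> m \<Longrightarrow> t * 2 ^ m \<in> \<nat>" by (metis of_nat_in_Nats)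
  then show ?thesis by (rule that)
qed

lemma dyads_levelE:
  assumes "t * 2 ^ m \<in> \<nat>"
  obtains k where "t = real k / 2 ^ m"
  using assms by (auto elim!: Nats_cases simp: field_simps)

lemma dyads_add [intro]:
  assumes "s \<in> dyads" "t \<in> dyads"
  shows "s + t \<in> dyads"
proof -
  obtain a where a: "\<And>m. a \<le> m \<Longrightarrow> s * 2 ^ m \<in> \<nat>" by (rule dyads_level[OF assms(1)]) blast
  obtain b where b: "\<And>m. b \<le> m \<Longrightarrow> t * 2 ^ m \<in> \<nat>" by (rule dyads_level[OF assms(2)]) blast
  have "(s + t) * 2 ^ max a b \<in> \<nat>"
    using a[of "max a b"] b[of "max a b"] by (simp add: distrib_right)
  then show ?thesis by (rule dyads_levelE) (simp add: dyadsI)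
qed

lemma dyads_mult_power4 [intro]: "t \<in> dyads \<Longrightarrow> 4 ^ j * t \<in> dyads"
proof -
  assume "t \<in> dyads"
  then obtain k n where "t = real k / 2 ^ n" by (auto simp: dyads_def)
  then have "4 ^ j * t = real (4 ^ j * k) / 2 ^ n" by simp
  then show ?thesis by (metis dyadsI)
qed

text \<open>Rounding down keeps the dyadic approximations inside the interval, so \<open>T\<close>
  itself may be any real number.\<close>

lemma le_on_dyads_imp_le:
  fixes f :: "real \<Rightarrow> real"
  assumes f: "continuous_on {0..} f"
    and le: "\<And>t. t \<in> dyads \<Longrightarrow> t \<le> T \<Longrightarrow> f t \<le> C"
    and t: "0 \<le> t" "t \<le> T"
  shows "f t \<le> C"
proof -
  define d where "d n = real (nat \<lfloor>t * 2 ^ n\<rfloor>) / 2 ^ n" for n :: nat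
  have d_eq: "d n = of_int \<lfloor>t * 2 ^ n\<rfloor> / 2 ^ n" for n using t by (simp add: d_def)
  have d: "d n \<in> dyads" "0 \<le> d n" "d n \<le> t" "t - 1 / 2 ^ n \<le> d n" for n
  proof -
    show "d n \<in> dyads" by (simp add: d_def dyadsI)
    show "0 \<le> d n" by (simp add: d_def)
    have "of_int \<lfloor>t * 2 ^ n\<rfloor> \<le> t * 2 ^ n" "t * 2 ^ n - 1 \<le> of_int \<lfloor>t * 2 ^ n\<rfloor>" by linarith+
    then show "d n \<le> t" "t - 1 / 2 ^ n \<le> d n" unfolding d_eq by (simp_all add: pos_divide_le_eq pos_le_divide_eq left_diff_distrib)
  qed
  have "(\<lambda>n. t - (1/2) ^ n) \<longlonglongrightarrow> t - 0"
    by (intro tendsto_diff tendsto_const LIMSEQ_realpow_zero) auto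
  then have lim: "(\<lambda>n. t - (1/2) ^ n) \<longlonglongrightarrow> t" by simp
  have ge: "t - (1/2) ^ n \<le> d n" for n using d(4)[of n] by (simp add: power_divide)
  have "d \<longlonglongrightarrow> t"
    by (rule tendsto_sandwich[OF _ _ lim tendsto_const[of t]]) (simp_all add: d(3) ge)
  then have "(\<lambda>n. f (d n)) \<longlonglongrightarrow> f t"
    using t d(2) by (intro continuous_on_tendsto_compose[OF f]) auto
  moreover have "f (d n) \<le> C" for n
    using d(1,3)[of n] t by (intro le) auto
  ultimately show ?thesis by (intro LIMSEQ_le_const2) auto
qed

section \<open>Planar Brownian motion and its symmetries\<close>

text \<open>The two coordinates are \<open>W True\<close> and \<open>W False\<close>.\<close>

locale planar_bm = prob_space M for M :: "'a measure" +
  fixes W :: "bool \<Rightarrow> real \<Rightarrow> 'a \<Rightarrow> real"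
  assumes W_measurable: "0 \<le> t \<Longrightarrow> W b t \<in> borel_measurable M"
    and W_zero: "w \<in> space M \<Longrightarrow> W b 0 w = 0"
    and W_continuous: "w \<in> space M \<Longrightarrow> continuous_on {0..} (\<lambda>t. W b t w)"
    and W_increment: "0 \<le> s \<Longrightarrow> s < t \<Longrightarrow>
      distributed M lborel (\<lambda>w. W b t w - W b s w) (normal_density 0 (sqrt (t - s)))"
    and W_indep: "0 \<le> \<tau> 0 \<Longrightarrow> (\<And>i. i < n \<Longrightarrow> \<tau> i \<le> \<tau> (Suc i)) \<Longrightarrow>
      indep_vars (\<lambda>_. borel) (\<lambda>(b, i) w. W b (\<tau> (Suc i)) w - W b (\<tau> i) w) (UNIV \<times> {..<n::nat})"

lemma std_BM2_imp_planar_bm: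
  assumes "std_BM2 M W1 W2"
  shows "planar_bm M (\<lambda>b. if b then W1 else W2)"
proof -
  interpret prob_space M using assms by (simp add: std_BM2_def)
  show ?thesis
    using assms unfolding std_BM2_def planar_bm_def planar_bm_axioms_def
    by (auto simp: prob_space_axioms)
qed

text \<open>One formula for the three symmetries in use: time shift (\<open>c = 1\<close>,
  \<open>r = 1\<close>), Brownian scaling (\<open>c = 1 / 2 ^ j\<close>, \<open>r = 4 ^ j\<close>)
  and reflection (\<open>c\<close> equal to 1 or -1, \<open>r = 1\<close>).\<close>

definition bm_transform :: "(bool \<Rightarrow> real) \<Rightarrow> real \<Rightarrow> real \<Rightarrow> (bool \<Rightarrow> real \<Rightarrow> 'a \<Rightarrow> real) \<Rightarrow>
    bool \<Rightarrow> real \<Rightarrow> 'a \<Rightarrow> real" where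
  "bm_transform c s r W b t w = c b * (W b (s + r * t) w - W b s w)"

lemma (in planar_bm) planar_bm_transform:
  assumes s: "0 \<le> s" and r: "0 < r" and c: "\<And>b. (c b)\<^sup>2 * r = 1"
  shows "planar_bm M (bm_transform c s r W)"
proof
  fix t :: real and b assume t: "0 \<le> t"
  have [measurable]: "W b (s + r * t) \<in> borel_measurable M" "W b s \<in> borel_measurable M"
    using s r t by (auto intro!: W_measurable)
  show "bm_transform c s r W b t \<in> borel_measurable M"
    unfolding bm_transform_def by measurable
next
  fix w b assume w: "w \<in> space M"
  show "bm_transform c s r W b 0 w = 0" by (simp add: bm_transform_def)
  have "continuous_on {0..} (\<lambda>t. W b (s + r * t) w)"
    using s r by (intro continuous_on_compose2[OF W_continuous[OF w]] continuous_intros) auto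
  then show "continuous_on {0..} (\<lambda>t. bm_transform c s r W b t w)"
    unfolding bm_transform_def by (intro continuous_intros)
next
  fix u t :: real and b assume u: "0 \<le> u" "u < t"
  have lt: "s + r * u < s + r * t" "0 \<le> s + r * u" using u r s by auto
  have c0: "c b \<noteq> 0" using c[of b] by auto
  have "\<bar>c b\<bar> * sqrt (s + r * t - (s + r * u)) = sqrt ((c b)\<^sup>2 * r * (t - u))"
  proof -
    have "s + r * t - (s + r * u) = r * (t - u)" by (simp add: algebra_simps)
    then show ?thesis by (simp only: real_sqrt_mult real_sqrt_abs)
  qed
  then have sd: "\<bar>c b\<bar> * sqrt (s + r * t - (s + r * u)) = sqrt (t - u)" by (simp add: c)
  have "distributed M lborel (\<lambda>w. 0 + c b * (W b (s + r * t) w - W b (s + r * u) w))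
      (normal_density (0 + c b * 0) (\<bar>c b\<bar> * sqrt (s + r * t - (s + r * u))))"
    using lt c0 by (intro normal_density_affine W_increment) auto
  moreover have "(\<lambda>w. 0 + c b * (W b (s + r * t) w - W b (s + r * u) w)) =
      (\<lambda>w. bm_transform c s r W b t w - bm_transform c s r W b u w)"
    by (simp add: bm_transform_def algebra_simps)
  ultimately show "distributed M lborel (\<lambda>w. bm_transform c s r W b t w - bm_transform c s r W b u w)
      (normal_density 0 (sqrt (t - u)))"
    unfolding sd by simp
next
  fix \<tau> :: "nat \<Rightarrow> real" and n :: nat
  assume \<tau>: "0 \<le> \<tau> 0" "\<And>i. i < n \<Longrightarrow> \<tau> i \<le> \<tau> (Suc i)"
  define \<sigma> where "\<sigma> i = s + r * \<tau> i" for i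
  have "indep_vars (\<lambda>_. borel) (\<lambda>(b, i) w. W b (\<sigma> (Suc i)) w - W b (\<sigma> i) w) (UNIV \<times> {..<n})"
    using \<tau> s r by (intro W_indep) (auto simp: \<sigma>_def)
  then have "indep_vars (\<lambda>_. borel)
      (\<lambda>j w. c (fst j) * (case j of (b, i) \<Rightarrow> \<lambda>w. W b (\<sigma> (Suc i)) w - W b (\<sigma> i) w) w) (UNIV \<times> {..<n})"
    by (rule indep_vars_compose2[where Y = "\<lambda>j x. c (fst j) * x"]) simp
  then show "indep_vars (\<lambda>_. borel)
      (\<lambda>(b, i) w. bm_transform c s r W b (\<tau> (Suc i)) w - bm_transform c s r W b (\<tau> i) w) (UNIV \<times> {..<n})"
    by (rule indep_vars_cong[THEN iffD1, rotated -1])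
      (auto simp: bm_transform_def \<sigma>_def algebra_simps fun_eq_iff)
qed

context planar_bm
begin

definition grid_inc :: "real \<Rightarrow> bool \<Rightarrow> nat \<Rightarrow> 'a \<Rightarrow> real" where
  "grid_inc d b i w = W b (real (Suc i) * d) w - W b (real i * d) w"

lemma grid_inc_measurable [measurable]: "0 \<le> d \<Longrightarrow> grid_inc d b i \<in> borel_measurable M"
  unfolding grid_inc_def by (intro borel_measurable_diff W_measurable) auto

lemma W_eq_sum_grid_inc: "w \<in> space M \<Longrightarrow> W b (real k * d) w = (\<Sum>i<k. grid_inc d b i w)"
  unfolding grid_inc_def sum_lessThan_telescope[of "\<lambda>i. W b (real i * d) w"] by (simp add: W_zero)

lemma grid_inc_indep:
  "0 \<le> d \<Longrightarrow> indep_vars (\<lambda>_. borel) (\<lambda>(b, i). grid_inc d b i) (UNIV \<times> {..<n})"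
  using W_indep[of "\<lambda>i. real i * d" n] unfolding grid_inc_def
  by (simp add: mult_right_mono case_prod_beta')

lemma grid_inc_distributed:
  "0 < d \<Longrightarrow> distributed M lborel (grid_inc d b i) (normal_density 0 (sqrt d))"
  using W_increment[of "real i * d" "real (Suc i) * d" b] unfolding grid_inc_def
  by (simp add: algebra_simps)

lemma grid_inc_moments:
  assumes d: "0 < d"
  shows "integrable M (grid_inc d b i)" "expectation (grid_inc d b i) = 0"
    "integrable M (\<lambda>w. grid_inc d b i w * grid_inc d b i w)"
    "expectation (\<lambda>w. grid_inc d b i w * grid_inc d b i w) = d"
proof -
  note D = grid_inc_distributed[OF d, of b i]
  have sd: "0 < sqrt d" using d by simp
  show E: "expectation (grid_inc d b i) = 0" by (rule normal_distributed_expectation[OF sd D])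
  have "variance (grid_inc d b i) = (sqrt d)\<^sup>2" by (rule normal_distributed_variance[OF sd D])
  then show "expectation (\<lambda>w. grid_inc d b i w * grid_inc d b i w) = d"
    using d by (simp add: E power2_eq_square)
  show "integrable M (grid_inc d b i)"
    using integrable_normal_moment[OF sd, of 0 1] distributed_integrable[OF D, of "\<lambda>x. x"]
    by (simp add: normal_density_nonneg)
  show "integrable M (\<lambda>w. grid_inc d b i w * grid_inc d b i w)"
    using integrable_normal_moment[OF sd, of 0 2] distributed_integrable[OF D, of "\<lambda>x. x * x"]
    by (simp add: normal_density_nonneg power2_eq_square)
qed

lemma grid_inc_product:
  assumes d: "0 < d"
  shows "integrable M (\<lambda>w. grid_inc d b i w * grid_inc d b j w)"
    "expectation (\<lambda>w. grid_inc d b i w * grid_inc d b j w) = (if i = j then d else 0)"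
proof -
  have "integrable M (\<lambda>w. grid_inc d b i w * grid_inc d b j w) \<and>
    expectation (\<lambda>w. grid_inc d b i w * grid_inc d b j w) = (if i = j then d else 0)"
  proof (cases "i = j")
    case True
    then show ?thesis using grid_inc_moments[OF d] by simp
  next
    case False
    define X where "X = (\<lambda>(b, i). grid_inc d b i)"
    have ind: "indep_vars (\<lambda>_. borel) X {(b, i), (b, j)}"
      unfolding X_def
      by (rule indep_vars_subset[OF grid_inc_indep[where n = "Suc (max i j)"]]) (use d in auto)
    have int: "\<And>k. k \<in> {(b, i), (b, j)} \<Longrightarrow> integrable M (X k)"
      using grid_inc_moments(1)[OF d] by (auto simp: X_def)
    from indep_vars_lebesgue_integral[OF _ ind int] indep_vars_integrable[OF _ ind int]
    show ?thesis using False grid_inc_moments(2)[OF d] by (simp add: X_def)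
  qed
  then show "integrable M (\<lambda>w. grid_inc d b i w * grid_inc d b j w)"
    "expectation (\<lambda>w. grid_inc d b i w * grid_inc d b j w) = (if i = j then d else 0)" by auto
qed

text \<open>Grouped by coordinate, the four factors form two independent products, each of which is
  a second moment of increments of a single coordinate.\<close>

lemma grid_inc_product4:
  assumes d: "0 < d"
  defines "X \<equiv> grid_inc d"
  shows "integrable M (\<lambda>w. (X True i w * X True i' w) * (X False j w * X False j' w))"
    "expectation (\<lambda>w. (X True i w * X True i' w) * (X False j w * X False j' w)) =
      (if i = i' \<and> j = j' then d\<^sup>2 else 0)"
proof -
  define n where "n = Suc (max (max i i') (max j j'))"
  define p where "p b = (if b then i else j)" for b
  define q where "q b = (if b then i' else j')" for b
  have lt: "p b < n" "q b < n" for b by (auto simp: p_def q_def n_def)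
  have "indep_vars (\<lambda>b. PiM ({b} \<times> {..<n}) (\<lambda>_. borel))
      (\<lambda>b w. restrict (\<lambda>k. (case k of (b, i) \<Rightarrow> X b i) w) ({b} \<times> {..<n})) UNIV"
    unfolding X_def using d
    by (intro indep_vars_restrict[OF grid_inc_indep]) (auto simp: disjoint_family_on_def)
  then have "indep_vars (\<lambda>b. borel) (\<lambda>b w. (\<lambda>y. y (b, p b) * y (b, q b))
      (restrict (\<lambda>k. (case k of (b, i) \<Rightarrow> X b i) w) ({b} \<times> {..<n}))) UNIV"
    by (rule indep_vars_compose2) (use lt in \<open>auto intro!: borel_measurable_times measurable_component_singleton\<close>)
  then have ind: "indep_vars (\<lambda>b. borel) (\<lambda>b w. X b (p b) w * X b (q b) w) (UNIV :: bool set)"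
    using lt by simp
  have int: "integrable M (\<lambda>w. X b (p b) w * X b (q b) w)" for b
    unfolding X_def by (rule grid_inc_product[OF d])
  have *: "(\<Prod>b\<in>UNIV. X b (p b) w * X b (q b) w) =
      (X True i w * X True i' w) * (X False j w * X False j' w)" for w
    by (simp add: UNIV_bool p_def q_def mult_ac)
  show "integrable M (\<lambda>w. (X True i w * X True i' w) * (X False j w * X False j' w))"
    using indep_vars_integrable[OF _ ind] int by (simp only: *) simp
  have "expectation (\<lambda>w. (X True i w * X True i' w) * (X False j w * X False j' w)) =
      (\<Prod>b\<in>UNIV. expectation (\<lambda>w. X b (p b) w * X b (q b) w))"
    using indep_vars_lebesgue_integral[OF _ ind] int by (simp only: *) simp
  also have "\<dots> = (if i = i' \<and> j = j' then d\<^sup>2 else 0)"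
    unfolding X_def by (simp add: UNIV_bool p_def q_def grid_inc_product[OF d] power2_eq_square)
  finally show "expectation (\<lambda>w. (X True i w * X True i' w) * (X False j w * X False j' w)) =
      (if i = i' \<and> j = j' then d\<^sup>2 else 0)" .
qed

text \<open>The products of one increment of each coordinate are orthogonal for distinct index pairs
  and have second moment \<open>d\<^sup>2\<close>, so only the number of pairs matters.\<close>

lemma bilinear_form_second_moment:
  assumes d: "0 < d" and P: "finite P"
  defines "Q \<equiv> (\<lambda>w. \<Sum>(i, j)\<in>P. grid_inc d True i w * grid_inc d False j w)"
  shows "integrable M (\<lambda>w. (Q w)\<^sup>2)" "expectation (\<lambda>w. (Q w)\<^sup>2) = real (card P) * d\<^sup>2"
proof -
  let ?X = "grid_inc d"
  have eq: "(Q w)\<^sup>2 = (\<Sum>p\<in>P. \<Sum>q\<in>P.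
      (?X True (fst p) w * ?X True (fst q) w) * (?X False (snd p) w * ?X False (snd q) w))" for w
    unfolding Q_def power2_eq_square sum_product by (simp add: case_prod_beta mult_ac)
  show "integrable M (\<lambda>w. (Q w)\<^sup>2)"
    unfolding eq by (intro Bochner_Integration.integrable_sum grid_inc_product4 d)
  have "expectation (\<lambda>w. (Q w)\<^sup>2) = (\<Sum>p\<in>P. \<Sum>q\<in>P. if fst p = fst q \<and> snd p = snd q then d\<^sup>2 else 0)"
    unfolding eq
    by (subst Bochner_Integration.integral_sum Bochner_Integration.integral_sum;
        (intro Bochner_Integration.integrable_sum grid_inc_product4 d)?)+
      (simp add: grid_inc_product4[OF d] cong: if_cong)
  also have "\<dots> = real (card P) * d\<^sup>2"
    using P by (simp add: prod_eq_iff[symmetric])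
  finally show "expectation (\<lambda>w. (Q w)\<^sup>2) = real (card P) * d\<^sup>2" .
qed

end

section \<open>The stochastic area as an almost sure limit\<close>

text \<open>The left-endpoint Ito sum after cancellation of the diagonal terms
  \<open>x l * y l\<close>. This is the shoelace formula: the signed area of the sampled polygon,
  closed through the origin.\<close>

definition grid_area :: "(nat \<Rightarrow> real) \<Rightarrow> (nat \<Rightarrow> real) \<Rightarrow> nat \<Rightarrow> real" where
  "grid_area x y n = (1/2) * (\<Sum>l<n. x l * y (Suc l) - y l * x (Suc l))"

text \<open>A coarse sum is a fine sum with frozen integrand: \<open>(l div j) * j\<close> is the
  last coarse grid point not after \<open>l\<close>, and increments telescope inside each
  cell.\<close>

lemma coarse_sum_eq:
  fixes x y :: "nat \<Rightarrow> real"
  assumes "0 < j"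
  shows "(\<Sum>k<K. x (k * j) * (y (Suc k * j) - y (k * j))) =
    (\<Sum>l<K * j. x ((l div j) * j) * (y (Suc l) - y l))"
proof -
  have "(\<Sum>l<K * j. x ((l div j) * j) * (y (Suc l) - y l)) =
      (\<Sum>k<K. \<Sum>l\<in>{k * j..<k * j + j}. x ((l div j) * j) * (y (Suc l) - y l))"
    by (rule sum.nat_group[symmetric])
  also have "\<dots> = (\<Sum>k<K. \<Sum>l\<in>{k * j..<k * j + j}. x (k * j) * (y (Suc l) - y l))"
  proof (intro sum.cong refl)
    fix k l assume "l \<in> {k * j..<k * j + j}"
    then have "l div j = k" using assms by (intro div_nat_eqI) (auto simp: mult.commute)
    then show "x ((l div j) * j) * (y (Suc l) - y l) = x (k * j) * (y (Suc l) - y l)" by simp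
  qed
  also have "\<dots> = (\<Sum>k<K. x (k * j) * (y (Suc k * j) - y (k * j)))"
    by (simp add: sum_distrib_left[symmetric] sum_Suc_diff' add.commute)
  finally show ?thesis by simp
qed

lemma grid_area_refine:
  assumes "0 < j"
  shows "grid_area x y (K * j) - grid_area (\<lambda>k. x (k * j)) (\<lambda>k. y (k * j)) K =
    (1/2) * ((\<Sum>l<K * j. (x l - x ((l div j) * j)) * (y (Suc l) - y l)) -
             (\<Sum>l<K * j. (y l - y ((l div j) * j)) * (x (Suc l) - x l)))"
proof -
  have *: "grid_area x y n = (1/2) * ((\<Sum>l<n. x l * (y (Suc l) - y l)) - (\<Sum>l<n. y l * (x (Suc l) - x l)))"
    for x y n by (simp add: grid_area_def sum_subtractf[symmetric] algebra_simps)
  have **: "(1/2) * (a - b) - (1/2) * (c - d) = (1/2) * ((a - c) - (b - d))" for a b c d :: real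
    by (simp add: field_simps)
  show ?thesis
    unfolding * coarse_sum_eq[OF assms] by (simp only: left_diff_distrib sum_subtractf **)
qed

context planar_bm
begin

text \<open>Refinement changes the sum by a bilinear form in the increments of the two coordinates,
  with both indices in the same coarse cell. There are at most \<open>K * j * j\<close> such pairs,
  and Markov's inequality for the square concludes.\<close>

lemma grid_area_refine_prob:
  assumes d: "0 < d" and j: "0 < j" and e: "0 < e"
  shows "prob {w \<in> space M. \<bar>grid_area (\<lambda>l. W True (real l * d) w) (\<lambda>l. W False (real l * d) w) (K * j) -
     grid_area (\<lambda>k. W True (real (k * j) * d) w) (\<lambda>k. W False (real (k * j) * d) w) K\<bar> \<ge> e}
     \<le> real (K * j * j) * d\<^sup>2 / e\<^sup>2"
proof -
  let ?X = "grid_inc d"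
  \<comment> \<open>Pairs of a fine index \<open>l\<close> and an earlier index in the coarse cell
    of \<open>l\<close>. \<open>Q\<close> uses these pairs, \<open>Q'\<close> the mirrored ones,
    according to which coordinate is being integrated.\<close>
  define P where "P = (SIGMA l:{..<K * j}. {(l div j) * j..<l})"
  have finP: "finite P" by (auto simp: P_def)
  have "card P = (\<Sum>l<K * j. l mod j)"
    unfolding P_def by (subst card_SigmaI) (auto simp: minus_div_mult_eq_mod)
  also have "\<dots> \<le> (\<Sum>l<K * j. j)" using j by (intro sum_mono) (simp add: less_imp_le)
  finally have cardP: "card P \<le> K * j * j" by simp
  define Q where "Q w = (\<Sum>(l, i)\<in>P. ?X True l w * ?X False i w)" for w
  define Q' where "Q' w = (\<Sum>(i, l)\<in>prod.swap ` P. ?X True i w * ?X False l w)" for w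
  note mQ = bilinear_form_second_moment[OF d finP, folded Q_def]
  note mQ' = bilinear_form_second_moment[OF d finite_imageI[OF finP, of prod.swap], folded Q'_def]
  have cardP': "card (prod.swap ` P) = card P" by (simp add: card_image)
  define D where "D w = grid_area (\<lambda>l. W True (real l * d) w) (\<lambda>l. W False (real l * d) w) (K * j) -
     grid_area (\<lambda>k. W True (real (k * j) * d) w) (\<lambda>k. W False (real (k * j) * d) w) K" for w
  have diff: "W b (real l * d) w - W b (real ((l div j) * j) * d) w = (\<Sum>i\<in>{(l div j) * j..<l}. ?X b i w)"
    for b l w
    unfolding grid_inc_def
    by (rule sum_Suc_diff'[symmetric, where f = "\<lambda>i. W b (real i * d) w"]) simp
  have D_eq: "D w = (1/2) * (Q' w - Q w)" for w
  proof -
    have "D w = (1/2) * ((\<Sum>l<K * j. (\<Sum>i\<in>{(l div j) * j..<l}. ?X True i w) * ?X False l w) -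
        (\<Sum>l<K * j. (\<Sum>i\<in>{(l div j) * j..<l}. ?X False i w) * ?X True l w))"
      unfolding D_def
      by (subst grid_area_refine[OF j, where x = "\<lambda>l. W True (real l * d) w" and y = "\<lambda>l. W False (real l * d) w"])
        (simp only: diff grid_inc_def)
    also have "(\<Sum>l<K * j. (\<Sum>i\<in>{(l div j) * j..<l}. ?X True i w) * ?X False l w) =
        (\<Sum>(l, i)\<in>P. ?X True i w * ?X False l w)"
      unfolding P_def sum_distrib_right by (rule sum.Sigma) auto
    also have "\<dots> = Q' w"
      unfolding Q'_def by (simp add: sum.reindex case_prod_beta)
    also have "(\<Sum>l<K * j. (\<Sum>i\<in>{(l div j) * j..<l}. ?X False i w) * ?X True l w) =
        (\<Sum>(l, i)\<in>P. ?X False i w * ?X True l w)"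
      unfolding P_def sum_distrib_right by (rule sum.Sigma) auto
    also have "\<dots> = Q w"
      unfolding Q_def by (simp add: mult.commute)
    finally show ?thesis .
  qed
  \<comment> \<open>Bounding the square of the difference by the sum of squares avoids the mixed
    moment of \<open>Q\<close> and \<open>Q'\<close>.\<close>
  have le: "(D w)\<^sup>2 \<le> (1/2) * ((Q w)\<^sup>2 + (Q' w)\<^sup>2)" for w
    using sum_squares_bound[of "Q w" "Q' w"] zero_le_power2[of "Q w + Q' w"]
    by (simp add: D_eq power2_eq_square algebra_simps)
  have meas: "D \<in> borel_measurable M"
    unfolding D_eq Q_def Q'_def using d by (simp add: case_prod_beta)
  have int: "integrable M (\<lambda>w. (1/2) * ((Q w)\<^sup>2 + (Q' w)\<^sup>2))"
    using mQ mQ' by simp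
  have intD: "integrable M (\<lambda>w. (D w)\<^sup>2)"
    by (rule Bochner_Integration.integrable_bound[OF int]) (use le meas in auto)
  have "expectation (\<lambda>w. (D w)\<^sup>2) \<le> expectation (\<lambda>w. (1/2) * ((Q w)\<^sup>2 + (Q' w)\<^sup>2))"
    by (intro integral_mono intD int le)
  also have "\<dots> = real (card P) * d\<^sup>2"
    using mQ mQ' by (simp add: cardP')
  also have "\<dots> \<le> real (K * j * j) * d\<^sup>2"
    using cardP by (intro mult_right_mono) (simp_all only: of_nat_le_iff zero_le_power2)
  finally have E: "expectation (\<lambda>w. (D w)\<^sup>2) \<le> real (K * j * j) * d\<^sup>2" .
  have "{w \<in> space M. e \<le> \<bar>D w\<bar>} = {w \<in> space M. e\<^sup>2 \<le> (D w)\<^sup>2}"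
    using e abs_le_square_iff[of e] by auto
  also have "prob \<dots> \<le> expectation (\<lambda>w. (D w)\<^sup>2) / e\<^sup>2"
    using e by (intro integral_Markov_inequality_measure[OF intD, of "space M"]) auto
  also have "\<dots> \<le> real (K * j * j) * d\<^sup>2 / e\<^sup>2" using E by (intro divide_right_mono) auto
  finally show ?thesis unfolding D_def by simp
qed

end

text \<open>The mesh is \<open>1 / 2 ^ n\<close> for every \<open>t\<close>, whereas
  \<open>levy_area_sum\<close> uses a mesh proportional to \<open>t\<close>. For dyadic
  \<open>t\<close> the floor is exact once \<open>n\<close> is large.\<close>

definition dyadic_area :: "nat \<Rightarrow> (bool \<Rightarrow> real \<Rightarrow> real) \<Rightarrow> real \<Rightarrow> real" where
  "dyadic_area n w t =
    grid_area (\<lambda>l. w True (real l / 2 ^ n)) (\<lambda>l. w False (real l / 2 ^ n)) (nat \<lfloor>t * 2 ^ n\<rfloor>)"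

text \<open>Convergence in probability is replaced by almost sure convergence at all dyadic times
  simultaneously. In this pathwise form the assumption is inherited by shifted, scaled and reflected
  processes.\<close>

locale heis_bm = planar_bm M W for M :: "'a measure" and W +
  fixes A :: "real \<Rightarrow> 'a \<Rightarrow> real"
  assumes A_measurable: "0 \<le> t \<Longrightarrow> A t \<in> borel_measurable M"
    and A_continuous: "w \<in> space M \<Longrightarrow> continuous_on {0..} (\<lambda>t. A t w)"
    and A_limit: "AE w in M. \<forall>t\<in>dyads. (\<lambda>n. dyadic_area n (\<lambda>b u. W b u w) t) \<longlonglongrightarrow> A t w"

lemma levy_area_sum_eq_grid_area:
  "levy_area_sum W1 W2 t n w =
    grid_area (\<lambda>k. W1 (real k * t / 2 ^ n) w) (\<lambda>k. W2 (real k * t / 2 ^ n) w) (2 ^ n)"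
  unfolding levy_area_sum_def grid_area_def Let_def by (simp add: algebra_simps)

lemma summable_increments_convergent:
  fixes s :: "nat \<Rightarrow> real"
  assumes "summable (\<lambda>n. s (Suc n) - s n)"
  shows "convergent s"
proof -
  have "convergent (\<lambda>n. s n - s 0)"
    using assms unfolding summable_iff_convergent by (simp add: sum_lessThan_telescope)
  then have "convergent (\<lambda>n. (s n - s 0) + s 0)" by (intro convergent_add convergent_const)
  then show ?thesis by simp
qed

context planar_bm
begin

lemma grid_area_measurable [measurable]:
  "0 \<le> d \<Longrightarrow> (\<lambda>w. grid_area (\<lambda>l. W True (real l * d) w) (\<lambda>l. W False (real l * d) w) n) \<in> borel_measurable M"
  unfolding grid_area_def
  by (intro borel_measurable_times borel_measurable_const borel_measurable_sum borel_measurable_diff W_measurable) auto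

lemma dyadic_area_eq:
  "dyadic_area n (\<lambda>b u. W b u w) t =
    grid_area (\<lambda>l. W True (real l * (1 / 2 ^ n)) w) (\<lambda>l. W False (real l * (1 / 2 ^ n)) w) (nat \<lfloor>t * 2 ^ n\<rfloor>)"
  by (simp add: dyadic_area_def)

lemma dyadic_area_measurable [measurable]:
  "(\<lambda>w. dyadic_area n (\<lambda>b u. W b u w) t) \<in> borel_measurable M"
  unfolding dyadic_area_eq by measurable

text \<open>Halving the mesh changes the sum by an error of second moment of order t / 2^n. The
  threshold (3/4)^n suits Borel-Cantelli: it is summable, and its square (9/16)^n still dominates
  (1/2)^n.\<close>

lemma dyadic_area_convergent:
  assumes t: "t \<in> dyads"
  shows "AE w in M. convergent (\<lambda>n. dyadic_area n (\<lambda>b u. W b u w) t)"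
proof -
  define S where "S n w = dyadic_area n (\<lambda>b u. W b u w) t" for n w
  have [measurable]: "S n \<in> borel_measurable M" for n unfolding S_def by measurable
  obtain m where m: "\<And>n. m \<le> n \<Longrightarrow> t * 2 ^ n \<in> \<nat>" by (rule dyads_level[OF t]) blast
  define B where "B n = {w \<in> space M. \<bar>S (Suc n) w - S n w\<bar> \<ge> (3/4) ^ n}" for n
  have [measurable]: "B n \<in> sets M" for n unfolding B_def by measurable
  have bound: "prob (B n) \<le> t * (8/9) ^ n" if n: "m \<le> n" for n
  proof -
    obtain K where K: "t = real K / 2 ^ n" by (rule dyads_levelE[OF m[OF n]])
    have "t * 2 ^ Suc n = real (K * 2)" by (simp add: K)
    then have f: "nat \<lfloor>t * 2 ^ n\<rfloor> = K" "nat \<lfloor>t * 2 ^ Suc n\<rfloor> = K * 2"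
      by (simp add: K) (metis \<open>t * 2 ^ Suc n = real (K * 2)\<close> floor_of_nat nat_int)
    have S1: "S (Suc n) w = grid_area (\<lambda>l. W True (real l * (1 / 2 ^ Suc n)) w)
        (\<lambda>l. W False (real l * (1 / 2 ^ Suc n)) w) (K * 2)" for w
      unfolding S_def dyadic_area_eq f ..
    have S2: "S n w = grid_area (\<lambda>k. W True (real (k * 2) * (1 / 2 ^ Suc n)) w)
        (\<lambda>k. W False (real (k * 2) * (1 / 2 ^ Suc n)) w) K" for w
      unfolding S_def dyadic_area_def f by (simp add: field_simps)
    have "prob (B n) \<le> real (K * 2 * 2) * (1 / 2 ^ Suc n)\<^sup>2 / ((3/4) ^ n)\<^sup>2"
      unfolding B_def S1 S2 by (rule grid_area_refine_prob) auto
    also have "\<dots> = t * ((1/2) ^ n / ((9/16) ^ n))"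
      by (simp add: K power2_eq_square power_mult_distrib[symmetric] power_divide field_simps)
    also have "(1/2) ^ n / ((9/16) ^ n) = (8/9 :: real) ^ n"
      by (simp add: power_divide[symmetric])
    finally show ?thesis .
  qed
  have "summable (\<lambda>n. prob (B n))"
  proof (rule summable_comparison_test')
    show "summable (\<lambda>n. t * (8/9) ^ n)" by (intro summable_mult summable_geometric) auto
    show "norm (prob (B n)) \<le> t * (8/9) ^ n" if "m \<le> n" for n using bound[OF that] by simp
  qed
  then have "AE w in M. eventually (\<lambda>n. w \<in> space M - B n) sequentially"
    by (intro borel_cantelli_AE1) (auto simp: emeasure_eq_measure)
  then show ?thesis
  proof (rule AE_mp, intro AE_I2 impI)
    fix w assume "w \<in> space M" and ev: "eventually (\<lambda>n. w \<in> space M - B n) sequentially"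
    have "eventually (\<lambda>n. norm (S (Suc n) w - S n w) \<le> (3/4) ^ n) sequentially"
      using ev by eventually_elim (auto simp: B_def)
    then have "summable (\<lambda>n. S (Suc n) w - S n w)"
      by (rule summable_comparison_test_ev) (simp add: summable_geometric)
    then show "convergent (\<lambda>n. dyadic_area n (\<lambda>b u. W b u w) t)"
      unfolding S_def by (rule summable_increments_convergent)
  qed
qed

text \<open>The almost sure limit exists already; it is identified with \<open>At\<close> along a
  subsequence. The two kinds of sums are compared by refinement: for \<open>t = p / 2 ^ m\<close>
  the grid of mesh t / 2^n is coarser than the dyadic grid of level \<open>m + n\<close> by the
  integer factor \<open>p\<close>.\<close>

lemma dyadic_area_tendsto:
  assumes t: "t \<in> dyads" and Am [measurable]: "At \<in> borel_measurable M"
    and lim: "\<And>e. 0 < e \<Longrightarrow> (\<lambda>n. prob {w \<in> space M. \<bar>levy_area_sum (W True) (W False) t n w - At w\<bar> > e}) \<longlonglongrightarrow> 0"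
  shows "AE w in M. (\<lambda>n. dyadic_area n (\<lambda>b u. W b u w) t) \<longlonglongrightarrow> At w"
proof -
  define S where "S n w = dyadic_area n (\<lambda>b u. W b u w) t" for n w
  define L where "L n w = levy_area_sum (W True) (W False) t n w" for n w
  have [measurable]: "S n \<in> borel_measurable M" for n unfolding S_def by measurable
  have L_eq: "L n w = grid_area (\<lambda>k. W True (real k * (t / 2 ^ n)) w) (\<lambda>k. W False (real k * (t / 2 ^ n)) w) (2 ^ n)"
    for n w unfolding L_def levy_area_sum_eq_grid_area by simp
  have [measurable]: "L n \<in> borel_measurable M" for n
    unfolding L_eq using dyads_nonneg[OF t] by (intro grid_area_measurable) simp
  obtain p m where t_eq: "t = real p / 2 ^ m" using t by (auto simp: dyads_def)
  have diff: "prob {w \<in> space M. \<bar>S (m + n) w - L n w\<bar> \<ge> e} \<le> (real p)\<^sup>2 / e\<^sup>2 * (1/2) ^ n" if e: "0 < e" for e n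
  \<comment> \<open>Refinement requires a positive factor, so the time 0 is treated apart; there
    both sums vanish.\<close>
  proof (cases "p = 0")
    case True
    have "S (m + n) w - L n w = 0" if "w \<in> space M" for w
      using that by (simp add: S_def L_eq dyadic_area_def grid_area_def t_eq True W_zero)
    then have "{w \<in> space M. \<bar>S (m + n) w - L n w\<bar> \<ge> e} = {}" using e by auto
    then show ?thesis by (simp only: measure_empty) simp
  next
    case False
    have "t * 2 ^ (m + n) = real (2 ^ n * p)" by (simp add: t_eq power_add)
    then have f: "nat \<lfloor>t * 2 ^ (m + n)\<rfloor> = 2 ^ n * p" by (metis floor_of_nat nat_int)
    have S1: "S (m + n) w = grid_area (\<lambda>l. W True (real l * (1 / 2 ^ (m + n))) w)
        (\<lambda>l. W False (real l * (1 / 2 ^ (m + n))) w) (2 ^ n * p)" for w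
      unfolding S_def dyadic_area_eq f ..
    have S2: "L n w = grid_area (\<lambda>k. W True (real (k * p) * (1 / 2 ^ (m + n))) w)
        (\<lambda>k. W False (real (k * p) * (1 / 2 ^ (m + n))) w) (2 ^ n)" for w
      unfolding L_eq t_eq by (simp add: power_add)
    have "prob {w \<in> space M. \<bar>S (m + n) w - L n w\<bar> \<ge> e} \<le> real (2 ^ n * p * p) * (1 / 2 ^ (m + n))\<^sup>2 / e\<^sup>2"
      unfolding S1 S2 using e False by (intro grid_area_refine_prob) auto
    also have "\<dots> = (real p)\<^sup>2 / e\<^sup>2 * (1/2) ^ n * (1 / (2 ^ m)\<^sup>2)"
      by (simp add: power_add power2_eq_square power_divide)
    also have "\<dots> \<le> (real p)\<^sup>2 / e\<^sup>2 * (1/2) ^ n * 1"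
      by (intro mult_left_mono) (auto simp: divide_le_eq_1 one_le_power)
    finally show ?thesis by simp
  qed
  have lim2: "(\<lambda>n. (real p)\<^sup>2 / e\<^sup>2 * (1/2) ^ n + prob {w \<in> space M. \<bar>L n w - At w\<bar> > e}) \<longlonglongrightarrow> 0"
    if "0 < e" for e
  proof -
    have "(\<lambda>n. (real p)\<^sup>2 / e\<^sup>2 * (1/2) ^ n + prob {w \<in> space M. \<bar>L n w - At w\<bar> > e})
      \<longlonglongrightarrow> (real p)\<^sup>2 / e\<^sup>2 * 0 + 0"
      unfolding L_def by (intro tendsto_add tendsto_mult tendsto_const lim that LIMSEQ_realpow_zero) auto
    then show ?thesis by simp
  qed
  \<comment> \<open>Selects a subsequence whose deviations from \<open>At\<close> are summable in
    probability, for a second use of Borel-Cantelli.\<close>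
  have "\<exists>n\<ge>k. prob {w \<in> space M. \<bar>S n w - At w\<bar> > 2 * (1/2) ^ k} \<le> (1/2) ^ k" for k :: nat
  proof -
    define e :: real where "e = (1/2) ^ k"
    have e: "0 < e" by (simp add: e_def)
    have "eventually (\<lambda>n. (real p)\<^sup>2 / e\<^sup>2 * (1/2) ^ n + prob {w \<in> space M. \<bar>L n w - At w\<bar> > e} < e) sequentially"
      using order_tendstoD(2)[OF lim2[OF e] e] .
    from eventually_happens'[OF sequentially_bot eventually_conj[OF eventually_ge_at_top[of k] this]]
    obtain n where n: "n \<ge> k" "(real p)\<^sup>2 / e\<^sup>2 * (1/2) ^ n + prob {w \<in> space M. \<bar>L n w - At w\<bar> > e} < e"
      by blast
    have "prob {w \<in> space M. \<bar>S (m + n) w - At w\<bar> > 2 * e} \<le>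
        prob ({w \<in> space M. \<bar>S (m + n) w - L n w\<bar> \<ge> e} \<union> {w \<in> space M. \<bar>L n w - At w\<bar> > e})"
      by (intro finite_measure_mono) auto
    also have "\<dots> \<le> prob {w \<in> space M. \<bar>S (m + n) w - L n w\<bar> \<ge> e} + prob {w \<in> space M. \<bar>L n w - At w\<bar> > e}"
      by (intro measure_Un_le) auto
    also have "\<dots> \<le> e" using diff[OF e, of n] n(2) by linarith
    finally show ?thesis unfolding e_def using n(1) by (intro exI[of _ "m + n"]) auto
  qed
  then obtain n where n: "\<And>k. n k \<ge> k"
      "\<And>k. prob {w \<in> space M. \<bar>S (n k) w - At w\<bar> > 2 * (1/2) ^ k} \<le> (1/2) ^ k"
    by metis
  have n_top: "filterlim n at_top sequentially"
    by (rule filterlim_at_top_mono[OF filterlim_ident]) (simp add: n(1))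
  have "summable (\<lambda>k. prob {w \<in> space M. \<bar>S (n k) w - At w\<bar> > 2 * (1/2) ^ k})"
    by (rule summable_comparison_test'[of "\<lambda>k. (1/2) ^ k" 0]) (use n(2) in \<open>auto simp: summable_geometric\<close>)
  then have "AE w in M. eventually (\<lambda>k. w \<in> space M - {w \<in> space M. \<bar>S (n k) w - At w\<bar> > 2 * (1/2) ^ k}) sequentially"
    by (intro borel_cantelli_AE1) (auto simp: emeasure_eq_measure)
  with dyadic_area_convergent[OF t] show ?thesis
  proof (rule AE_mp[OF _ AE_mp], intro AE_I2 impI)
    fix w assume "w \<in> space M"
      and ev: "eventually (\<lambda>k. w \<in> space M - {w \<in> space M. \<bar>S (n k) w - At w\<bar> > 2 * (1/2) ^ k}) sequentially"
      and conv: "convergent (\<lambda>n. dyadic_area n (\<lambda>b u. W b u w) t)"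
    obtain l where l: "(\<lambda>n. S n w) \<longlonglongrightarrow> l" using conv unfolding S_def convergent_def by blast
    have lk: "(\<lambda>k. S (n k) w) \<longlonglongrightarrow> l" by (rule filterlim_compose[OF l n_top])
    have "(\<lambda>k. S (n k) w - At w) \<longlonglongrightarrow> 0"
    proof (rule Lim_null_comparison)
      show "eventually (\<lambda>k. norm (S (n k) w - At w) \<le> 2 * (1/2) ^ k) sequentially"
        using ev by eventually_elim auto
      show "(\<lambda>k. 2 * (1/2 :: real) ^ k) \<longlonglongrightarrow> 0"
        by (rule tendsto_mult_right_zero) (simp add: LIMSEQ_realpow_zero)
    qed
    then have "(\<lambda>k. S (n k) w) \<longlonglongrightarrow> At w" by (simp add: LIM_zero_iff)
    with lk have "l = At w" by (rule LIMSEQ_unique)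
    with l show "(\<lambda>n. dyadic_area n (\<lambda>b u. W b u w) t) \<longlonglongrightarrow> At w" by (simp add: S_def)
  qed
qed

end

lemma levy_area_imp_heis_bm:
  assumes "std_BM2 M W1 W2" "is_levy_area M W1 W2 A"
  shows "heis_bm M (\<lambda>b. if b then W1 else W2) A"
proof -
  interpret planar_bm M "\<lambda>b. if b then W1 else W2" by (rule std_BM2_imp_planar_bm[OF assms(1)])
  show ?thesis
  proof
    show A_m: "0 \<le> t \<Longrightarrow> A t \<in> borel_measurable M" for t
      using assms(2) by (simp add: is_levy_area_def)
    show "w \<in> space M \<Longrightarrow> continuous_on {0..} (\<lambda>t. A t w)" for w
      using assms(2) by (simp add: is_levy_area_def)
    show "AE w in M. \<forall>t\<in>dyads. (\<lambda>n. dyadic_area n (\<lambda>b u. (if b then W1 else W2) u w) t) \<longlonglongrightarrow> A t w"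
      unfolding AE_ball_countable[OF countable_dyads]
    proof
      fix t assume t: "t \<in> dyads"
      show "AE w in M. (\<lambda>n. dyadic_area n (\<lambda>b u. (if b then W1 else W2) u w) t) \<longlonglongrightarrow> A t w"
        using assms(2) dyads_nonneg[OF t]
        by (intro dyadic_area_tendsto t A_m) (auto simp: is_levy_area_def)
    qed
  qed
qed

text \<open>For \<open>c = 1\<close> this is the vertical coordinate of the group increment from
  time \<open>s\<close> to time \<open>s + r * t\<close>, that is, of the inverse of the first point
  times the second; the last term comes from the symplectic form.\<close>

definition area_transform :: "(bool \<Rightarrow> real) \<Rightarrow> real \<Rightarrow> real \<Rightarrow> (bool \<Rightarrow> real \<Rightarrow> 'a \<Rightarrow> real) \<Rightarrow>
    (real \<Rightarrow> 'a \<Rightarrow> real) \<Rightarrow> real \<Rightarrow> 'a \<Rightarrow> real" where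
  "area_transform c s r W A t w = c True * c False * (A (s + r * t) w - A s w -
     (W True s w * W False (s + r * t) w - W False s w * W True (s + r * t) w) / 2)"

lemma grid_area_transform:
  "grid_area (\<lambda>l. p * (x (a + l) - x a)) (\<lambda>l. q * (y (a + l) - y a)) b =
    p * q * (grid_area x y (a + b) - grid_area x y a - (x a * y (a + b) - y a * x (a + b)) / 2)"
proof (induction b)
  case 0
  show ?case by (simp add: grid_area_def)
next
  case (Suc b)
  have step: "grid_area u v (Suc n) = grid_area u v n + (u n * v (Suc n) - v n * u (Suc n)) / 2" for u v n
    by (simp add: grid_area_def distrib_left)
  show ?case
    unfolding step Suc.IH add_Suc_right step[of x y "a + b"] by (simp add: field_simps)
qed

text \<open>Time scaling by \<open>4 ^ j\<close> maps the grid of level \<open>i + 2 * j\<close>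
  onto the grid of level \<open>i\<close>, and \<open>s\<close> is a point of the latter. The
  formula of \<open>area_transform\<close> is thus already exact for the polygonal areas, before any
  limit.\<close>

lemma dyadic_area_transform:
  assumes s: "s = real a / 2 ^ i" and t: "t = real b / 2 ^ (i + 2 * j)"
  shows "dyadic_area (i + 2 * j) (\<lambda>b u. bm_transform c s (4 ^ j) W b u w) t =
    c True * c False * (dyadic_area i (\<lambda>b u. W b u w) (s + 4 ^ j * t) - dyadic_area i (\<lambda>b u. W b u w) s -
     (W True s w * W False (s + 4 ^ j * t) w - W False s w * W True (s + 4 ^ j * t) w) / 2)"
proof -
  have four: "(4::real) ^ j = 2 ^ (2 * j)" by (simp add: power_mult)
  have pt: "s + 4 ^ j * (real l / 2 ^ (i + 2 * j)) = real (a + l) / 2 ^ i" for l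
    by (simp add: s four power_add add_divide_distrib)
  have f: "nat \<lfloor>t * 2 ^ (i + 2 * j)\<rfloor> = b" "nat \<lfloor>s * 2 ^ i\<rfloor> = a" by (simp_all add: s t)
  have "(s + 4 ^ j * t) * 2 ^ i = real (a + b)" unfolding t pt by simp
  then have f2: "nat \<lfloor>(s + 4 ^ j * t) * 2 ^ i\<rfloor> = a + b" by (metis floor_of_nat nat_int)
  show ?thesis
    unfolding dyadic_area_def f f2 bm_transform_def pt unfolding s t
    unfolding pt[unfolded s]
    by (rule grid_area_transform[where x = "\<lambda>l. W True (real l / 2 ^ i) w" and y = "\<lambda>l. W False (real l / 2 ^ i) w"])
qed

text \<open>From some level on, the grids contain both \<open>s\<close> and \<open>t\<close>, so the
  exact identity passes to the limit on the set where all dyadic limits exist; the shift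
  \<open>2 * j\<close> of the level is harmless.\<close>

lemma (in heis_bm) heis_bm_transform:
  assumes s: "s \<in> dyads" and c: "\<And>b. (c b)\<^sup>2 * 4 ^ j = 1"
  shows "heis_bm M (bm_transform c s (4 ^ j) W) (area_transform c s (4 ^ j) W A)"
proof -
  have s0: "0 \<le> s" using s by (rule dyads_nonneg)
  interpret T: planar_bm M "bm_transform c s (4 ^ j) W"
    using s0 c by (intro planar_bm_transform) auto
  show ?thesis
  proof
    fix t :: real assume t: "0 \<le> t"
    have [measurable]: "A (s + 4 ^ j * t) \<in> borel_measurable M" "A s \<in> borel_measurable M"
      "W b (s + 4 ^ j * t) \<in> borel_measurable M" "W b s \<in> borel_measurable M" for b
      using s0 t by (auto intro!: A_measurable W_measurable)
    show "area_transform c s (4 ^ j) W A t \<in> borel_measurable M"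
      unfolding area_transform_def by measurable
  next
    fix w assume w: "w \<in> space M"
    have "continuous_on {0..} (\<lambda>t. A (s + 4 ^ j * t) w)" "continuous_on {0..} (\<lambda>t. W b (s + 4 ^ j * t) w)" for b
      using s0 by (auto intro!: continuous_on_compose2[OF A_continuous[OF w]]
        continuous_on_compose2[OF W_continuous[OF w]] continuous_intros)
    then show "continuous_on {0..} (\<lambda>t. area_transform c s (4 ^ j) W A t w)"
      unfolding area_transform_def by (intro continuous_intros) auto
  next
    show "AE w in M. \<forall>t\<in>dyads. (\<lambda>n. dyadic_area n (\<lambda>b u. bm_transform c s (4 ^ j) W b u w) t)
        \<longlonglongrightarrow> area_transform c s (4 ^ j) W A t w"
      using A_limit
    proof (rule AE_mp, intro AE_I2 impI ballI)
      fix w t assume w: "w \<in> space M" and t: "t \<in> dyads"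
        and lim: "\<forall>t\<in>dyads. (\<lambda>n. dyadic_area n (\<lambda>b u. W b u w) t) \<longlonglongrightarrow> A t w"
      obtain m where m: "\<And>n. m \<le> n \<Longrightarrow> s * 2 ^ n \<in> \<nat>" by (rule dyads_level[OF s]) blast
      obtain m' where m': "\<And>n. m' \<le> n \<Longrightarrow> t * 2 ^ n \<in> \<nat>" by (rule dyads_level[OF t]) blast
      have "(\<lambda>i. c True * c False * (dyadic_area i (\<lambda>b u. W b u w) (s + 4 ^ j * t) - dyadic_area i (\<lambda>b u. W b u w) s -
         (W True s w * W False (s + 4 ^ j * t) w - W False s w * W True (s + 4 ^ j * t) w) / 2))
         \<longlonglongrightarrow> area_transform c s (4 ^ j) W A t w"
        unfolding area_transform_def using lim s t
        by (intro tendsto_intros) (auto intro!: dyads_add)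
      moreover have "eventually (\<lambda>i. c True * c False * (dyadic_area i (\<lambda>b u. W b u w) (s + 4 ^ j * t) - dyadic_area i (\<lambda>b u. W b u w) s -
         (W True s w * W False (s + 4 ^ j * t) w - W False s w * W True (s + 4 ^ j * t) w) / 2) =
         dyadic_area (i + 2 * j) (\<lambda>b u. bm_transform c s (4 ^ j) W b u w) t) sequentially"
        using eventually_ge_at_top[of "max m m'"]
      proof eventually_elim
        case (elim i)
        obtain a where a: "s = real a / 2 ^ i" by (rule dyads_levelE[of s i]) (use elim m in auto)
        obtain b where b: "t = real b / 2 ^ (i + 2 * j)" by (rule dyads_levelE[of t "i + 2 * j"]) (use elim m' in auto)
        show ?case by (rule dyadic_area_transform[OF a b, symmetric])
      qed
      ultimately have "(\<lambda>i. dyadic_area (i + 2 * j) (\<lambda>b u. bm_transform c s (4 ^ j) W b u w) t)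
          \<longlonglongrightarrow> area_transform c s (4 ^ j) W A t w"
        by (rule Lim_transform_eventually)
      then show "(\<lambda>n. dyadic_area n (\<lambda>b u. bm_transform c s (4 ^ j) W b u w) t)
          \<longlonglongrightarrow> area_transform c s (4 ^ j) W A t w"
        by (rule LIMSEQ_offset)
    qed
  qed
qed

section \<open>Uniqueness in law\<close>

lemma pred_countable_Ball:
  assumes "countable I" "\<And>i. i \<in> I \<Longrightarrow> Measurable.pred N (P i)"
  shows "Measurable.pred N (\<lambda>x. \<forall>i\<in>I. P i x)"
proof -
  have "{x \<in> space N. \<forall>i\<in>I. P i x} = space N - (\<Union>i\<in>I. {x \<in> space N. \<not> P i x})" by auto
  also have "\<dots> \<in> sets N"
    using assms by (intro sets.Diff sets.top sets.countable_UN') (auto simp: pred_def)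
  finally show ?thesis by (simp add: pred_def)
qed

abbreviation path_space :: "(bool \<times> real \<Rightarrow> real) measure" where
  "path_space \<equiv> PiM (UNIV \<times> dyads) (\<lambda>_. borel)"

definition bm_path :: "(bool \<Rightarrow> real \<Rightarrow> 'a \<Rightarrow> real) \<Rightarrow> 'a \<Rightarrow> bool \<times> real \<Rightarrow> real" where
  "bm_path W w = (\<lambda>(b, t)\<in>UNIV \<times> dyads. W b t w)"

lemma finite_dyads_level:
  assumes "finite J" "J \<subseteq> dyads"
  obtains n where "\<And>t. t \<in> J \<Longrightarrow> t * 2 ^ n \<in> \<nat>"
proof -
  have "\<forall>t\<in>J. \<exists>n. \<forall>m\<ge>n. t * 2 ^ m \<in> \<nat>" using assms(2) dyads_level by (metis subsetD)
  then obtain f where f: "\<And>t m. t \<in> J \<Longrightarrow> f t \<le> m \<Longrightarrow> t * 2 ^ m \<in> \<nat>" by metis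
  show ?thesis
    by (rule that[of "\<Sum>t\<in>J. f t"]) (use f assms(1) in \<open>auto intro: member_le_sum\<close>)
qed

context planar_bm
begin

lemma bm_path_measurable [measurable]: "bm_path W \<in> measurable M path_space"
  unfolding bm_path_def
  by (rule measurable_restrict) (auto intro!: W_measurable dyads_nonneg)

lemma grid_inc_law:
  assumes "0 < d" "0 < n"
  shows "distr M (PiM (UNIV \<times> {..<n}) (\<lambda>_. borel)) (\<lambda>w. \<lambda>(b, i)\<in>UNIV \<times> {..<n}. grid_inc d b i w) =
    PiM (UNIV \<times> {..<n}) (\<lambda>_. density lborel (normal_density 0 (sqrt d)))"
proof -
  define X where "X = (\<lambda>(b, i). grid_inc d b i)"
  have "distr M (PiM (UNIV \<times> {..<n}) (\<lambda>_. borel)) (\<lambda>w. \<lambda>k\<in>UNIV \<times> {..<n}. X k w) =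
      PiM (UNIV \<times> {..<n}) (\<lambda>k. distr M borel (X k))"
    using grid_inc_indep[of d n] assms
    by (subst indep_vars_iff_distr_eq_PiM'[symmetric]) (auto simp: X_def)
  also have "\<dots> = PiM (UNIV \<times> {..<n}) (\<lambda>_. density lborel (normal_density 0 (sqrt d)))"
  proof (intro PiM_cong refl)
    fix k :: "bool \<times> nat"
    have "distr M borel (X k) = distr M lborel (X k)" by (rule distr_cong) auto
    also have "\<dots> = density lborel (normal_density 0 (sqrt d))"
      using grid_inc_distributed[OF assms(1)] by (auto simp: X_def distributed_def split: prod.splits)
    finally show "distr M borel (X k) = density lborel (normal_density 0 (sqrt d))" .
  qed
  finally show ?thesis by (simp add: X_def case_prod_beta')
qed

text \<open>The right-hand side mentions neither \<open>M\<close> nor \<open>W\<close>: a cylinder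
  over dyadic times is a condition on partial sums of independent Gaussian increments on one common
  grid. This is how two processes are compared.\<close>

lemma path_cylinder_emeasure:
  assumes J: "finite J" "J \<subseteq> UNIV \<times> dyads" and A: "\<And>k. k \<in> J \<Longrightarrow> A k \<in> sets borel"
    and level: "\<And>b t. (b, t) \<in> J \<Longrightarrow> t * 2 ^ n \<in> \<nat>" "\<And>b t. (b, t) \<in> J \<Longrightarrow> nat \<lfloor>t * 2 ^ n\<rfloor> \<le> N"
  shows "emeasure (distr M path_space (bm_path W)) (prod_emb (UNIV \<times> dyads) (\<lambda>_. borel) J (Pi\<^sub>E J A)) =
    emeasure (PiM (UNIV \<times> {..<Suc N}) (\<lambda>_. density lborel (normal_density 0 (sqrt (1 / 2 ^ n)))))
      {y \<in> space (PiM (UNIV \<times> {..<Suc N}) (\<lambda>_. borel)). \<forall>k\<in>J. (\<Sum>i<nat \<lfloor>snd k * 2 ^ n\<rfloor>. y (fst k, i)) \<in> A k}"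
    (is "_ = emeasure _ ?Z")
proof -
  let ?d = "1 / 2 ^ n :: real"
  let ?K = "UNIV \<times> {..<Suc N} :: (bool \<times> nat) set"
  define Y where "Y w = (\<lambda>(b, i)\<in>?K. grid_inc ?d b i w)" for w
  have Y [measurable]: "Y \<in> measurable M (PiM ?K (\<lambda>_. borel))"
    unfolding Y_def by (rule measurable_restrict) auto
  have Z: "?Z \<in> sets (PiM ?K (\<lambda>_. borel))"
  proof -
    have "(\<lambda>y. \<Sum>i<nat \<lfloor>snd k * 2 ^ n\<rfloor>. y (fst k, i) :: real) \<in> borel_measurable (PiM ?K (\<lambda>_. borel))" if "k \<in> J" for k
    proof (rule borel_measurable_sum)
      fix i assume "i \<in> {..<nat \<lfloor>snd k * 2 ^ n\<rfloor>}"
      then have "(fst k, i) \<in> ?K" using that level(2)[of "fst k" "snd k"] by auto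
      then show "(\<lambda>y. y (fst k, i)) \<in> borel_measurable (PiM ?K (\<lambda>_. borel))"
        by (rule measurable_component_singleton[where M = "\<lambda>_. borel"])
    qed
    then have "{y \<in> space (PiM ?K (\<lambda>_. borel)). (\<Sum>i<nat \<lfloor>snd k * 2 ^ n\<rfloor>. y (fst k, i)) \<in> A k} \<in> sets (PiM ?K (\<lambda>_. borel))"
      if "k \<in> J" for k using that A[OF that] by measurable
    then show ?thesis using J(1) by (intro sets.sets_Collect_finite_All) auto
  qed
  have eq: "bm_path W -` prod_emb (UNIV \<times> dyads) (\<lambda>_. borel) J (Pi\<^sub>E J A) \<inter> space M = Y -` ?Z \<inter> space M"
  proof -
    have W: "W b t w = (\<Sum>i<nat \<lfloor>t * 2 ^ n\<rfloor>. Y w (b, i))" if bt: "(b, t) \<in> J" and w: "w \<in> space M" for b t w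
    proof -
      obtain k where k: "t = real k / 2 ^ n" by (rule dyads_levelE[OF level(1)[OF bt]])
      then have f: "nat \<lfloor>t * 2 ^ n\<rfloor> = k" by simp
      have "W b t w = (\<Sum>i<k. grid_inc ?d b i w)"
        using W_eq_sum_grid_inc[OF w, of b k ?d] by (simp add: k)
      also have "\<dots> = (\<Sum>i<nat \<lfloor>t * 2 ^ n\<rfloor>. Y w (b, i))"
        unfolding f using level(2)[OF bt] f by (intro sum.cong) (auto simp: Y_def)
      finally show ?thesis .
    qed
    have P: "(bm_path W w \<in> prod_emb (UNIV \<times> dyads) (\<lambda>_. borel) J (Pi\<^sub>E J A)) =
        (\<forall>k\<in>J. W (fst k) (snd k) w \<in> A k)" for w
      using J(2) by (auto simp: prod_emb_iff bm_path_def PiE_iff split: prod.splits)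
    have Z': "(Y w \<in> ?Z) = (\<forall>k\<in>J. (\<Sum>i<nat \<lfloor>snd k * 2 ^ n\<rfloor>. Y w (fst k, i)) \<in> A k)" if "w \<in> space M" for w
      using measurable_space[OF Y that] by simp
    show ?thesis
    proof (intro set_eqI)
      fix w
      have "(\<forall>k\<in>J. W (fst k) (snd k) w \<in> A k) = (\<forall>k\<in>J. (\<Sum>i<nat \<lfloor>snd k * 2 ^ n\<rfloor>. Y w (fst k, i)) \<in> A k)"
        if "w \<in> space M" using W[OF _ that] by (intro ball_cong refl) simp
      then show "w \<in> bm_path W -` prod_emb (UNIV \<times> dyads) (\<lambda>_. borel) J (Pi\<^sub>E J A) \<inter> space M \<longleftrightarrow> w \<in> Y -` ?Z \<inter> space M"
        unfolding Int_iff vimage_eq P using Z' by (cases "w \<in> space M") simp_all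
    qed
  qed
  have "emeasure (distr M path_space (bm_path W)) (prod_emb (UNIV \<times> dyads) (\<lambda>_. borel) J (Pi\<^sub>E J A)) =
      emeasure M (Y -` ?Z \<inter> space M)"
    unfolding eq[symmetric] using J A by (intro emeasure_distr bm_path_measurable sets_PiM_I) auto
  also have "\<dots> = emeasure (distr M (PiM ?K (\<lambda>_. borel)) Y) ?Z"
    by (rule emeasure_distr[OF Y Z, symmetric])
  also have "distr M (PiM ?K (\<lambda>_. borel)) Y = PiM ?K (\<lambda>_. density lborel (normal_density 0 (sqrt ?d)))"
    unfolding Y_def by (rule grid_inc_law) auto
  finally show ?thesis .
qed

end

lemma planar_bm_path_law:
  assumes "planar_bm M W" "planar_bm M' W'"
  shows "distr M path_space (bm_path W) = distr M' path_space (bm_path W')"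
proof (rule measure_eqI_PiM_infinite[where I = "UNIV \<times> dyads" and M = "\<lambda>_. borel"])
  interpret A: planar_bm M W by fact
  interpret B: planar_bm M' W' by fact
  interpret prob_space "distr M path_space (bm_path W)" by (rule A.prob_space_distr) simp
  show "finite_measure (distr M path_space (bm_path W))" by unfold_locales
  fix J :: "(bool \<times> real) set" and A
  assume J: "finite J" "J \<subseteq> UNIV \<times> dyads" and A: "\<And>k. k \<in> J \<Longrightarrow> A k \<in> sets (borel :: real measure)"
  obtain n where n: "\<And>t. t \<in> snd ` J \<Longrightarrow> t * 2 ^ n \<in> \<nat>"
    by (rule finite_dyads_level[of "snd ` J"]) (use J in auto)
  define N where "N = (\<Sum>k\<in>J. nat \<lfloor>snd k * 2 ^ n\<rfloor>)"
  have lv: "t * 2 ^ n \<in> \<nat>" "nat \<lfloor>t * 2 ^ n\<rfloor> \<le> N" if "(b, t) \<in> J" for b t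
  proof -
    have "t \<in> snd ` J" using that by force
    then show "t * 2 ^ n \<in> \<nat>" by (rule n)
    show "nat \<lfloor>t * 2 ^ n\<rfloor> \<le> N"
      using member_le_sum[OF that, of "\<lambda>k. nat \<lfloor>snd k * 2 ^ n\<rfloor>"] J(1) by (simp add: N_def)
  qed
  show "emeasure (distr M path_space (bm_path W)) (prod_emb (UNIV \<times> dyads) (\<lambda>_. borel) J (Pi\<^sub>E J A)) =
      emeasure (distr M' path_space (bm_path W')) (prod_emb (UNIV \<times> dyads) (\<lambda>_. borel) J (Pi\<^sub>E J A))"
    using A.path_cylinder_emeasure[OF J A lv] B.path_cylinder_emeasure[OF J A lv] by simp
qed simp_all

context heis_bm
begin

abbreviation g :: "real \<Rightarrow> 'a \<Rightarrow> (real \<times> real) \<times> real" where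
  "g t w \<equiv> hyp_BM (W True) (W False) A t w"

text \<open>The only kind of event whose law is transferred between processes.
  \<open>S = UNIV\<close> leaves pure confinement, as used for Brownian scaling.\<close>

definition move_event :: "((real \<times> real) \<times> real) set \<Rightarrow> real \<Rightarrow> 'a set" where
  "move_event S C = {w \<in> space M. g 1 w \<in> S \<and> (\<forall>t\<in>{0..1}. heis_norm (g t w) \<le> C)}"

lemma norm_g_continuous: "w \<in> space M \<Longrightarrow> continuous_on {0..} (\<lambda>t. heis_norm (g t w))"
  unfolding hyp_BM_def by (intro continuous_on_heis_norm W_continuous A_continuous)

lemma norm_g_le_iff_dyads:
  assumes "w \<in> space M"
  shows "(\<forall>t\<in>{0..T}. heis_norm (g t w) \<le> C) \<longleftrightarrow> (\<forall>t\<in>dyads \<inter> {..T}. heis_norm (g t w) \<le> C)"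
  using le_on_dyads_imp_le[OF norm_g_continuous[OF assms], of T C] by (auto simp: dyads_nonneg)

end

text \<open>Makes the area a measurable function of the dyadic path. Where the sums diverge,
  \<open>lim\<close> has an unspecified value, which only concerns a null set.\<close>

definition area_functional :: "(bool \<times> real \<Rightarrow> real) \<Rightarrow> real \<Rightarrow> real" where
  "area_functional w t = lim (\<lambda>n. dyadic_area n (\<lambda>b u. w (b, u)) t)"

lemma area_functional_measurable [measurable]:
  "(\<lambda>w. area_functional w t) \<in> borel_measurable path_space"
  unfolding area_functional_def dyadic_area_def grid_area_def
  by (intro borel_measurable_lim_metric borel_measurable_times borel_measurable_const borel_measurable_sum
      borel_measurable_diff measurable_component_singleton) (auto simp: dyadsI simp del: of_nat_Suc)

definition move_functional :: "((real \<times> real) \<times> real) set \<Rightarrow> real \<Rightarrow> (bool \<times> real \<Rightarrow> real) set" where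
  "move_functional S C = {w \<in> space path_space.
     ((w (True, 1), w (False, 1)), area_functional w 1) \<in> S \<and>
     (\<forall>t\<in>dyads \<inter> {..1}. heis_norm ((w (True, t), w (False, t)), area_functional w t) \<le> C)}"

lemma move_functional_measurable:
  assumes [measurable]: "S \<in> sets borel"
  shows "move_functional S C \<in> sets path_space"
proof -
  have pm: "(\<lambda>w. ((w (True, t), w (False, t)), area_functional w t)) \<in> borel_measurable path_space" if "t \<in> dyads" for t
    using that by (intro borel_measurable_Pair measurable_component_singleton area_functional_measurable) auto
  have c: "countable (dyads \<inter> {..1})" by (rule countable_subset[OF _ countable_dyads]) auto
  have "Measurable.pred path_space (\<lambda>w. heis_norm ((w (True, t), w (False, t)), area_functional w t) \<le> C)" if "t \<in> dyads \<inter> {..1}" for t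
  proof -
    have [measurable]: "(\<lambda>w. heis_norm ((w (True, t), w (False, t)), area_functional w t)) \<in> borel_measurable path_space"
      using that by (intro measurable_compose[OF pm borel_measurable_heis_norm]) auto
    show ?thesis by measurable
  qed
  then have "Measurable.pred path_space (\<lambda>w. \<forall>t\<in>dyads \<inter> {..1}. heis_norm ((w (True, t), w (False, t)), area_functional w t) \<le> C)"
    by (rule pred_countable_Ball[OF c])
  moreover have "Measurable.pred path_space (\<lambda>w. ((w (True, 1), w (False, 1)), area_functional w 1) \<in> S)"
    by (rule pred_sets2[OF assms pm]) simp
  ultimately show ?thesis unfolding move_functional_def by measurable
qed

context heis_bm
begin

lemma g_measurable: "0 \<le> t \<Longrightarrow> g t \<in> borel_measurable M"
  unfolding hyp_BM_def by (intro borel_measurable_Pair W_measurable A_measurable)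

lemma norm_g_le_event:
  assumes N: "space N = space M" and g: "\<And>t. t \<in> dyads \<Longrightarrow> t \<le> T \<Longrightarrow> g t \<in> borel_measurable N"
  shows "{w \<in> space M. \<forall>t\<in>{0..T}. heis_norm (g t w) \<le> C} \<in> sets N"
proof -
  have c: "countable (dyads \<inter> {..T})" by (rule countable_subset[OF _ countable_dyads]) auto
  have "Measurable.pred N (\<lambda>w. heis_norm (g t w) \<le> C)" if "t \<in> dyads \<inter> {..T}" for t
  proof -
    have [measurable]: "(\<lambda>w. heis_norm (g t w)) \<in> borel_measurable N"
      using that by (intro measurable_compose[OF g borel_measurable_heis_norm]) auto
    show ?thesis by measurable
  qed
  then have "Measurable.pred N (\<lambda>w. \<forall>t\<in>dyads \<inter> {..T}. heis_norm (g t w) \<le> C)"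
    by (rule pred_countable_Ball[OF c])
  then have "{w \<in> space N. \<forall>t\<in>dyads \<inter> {..T}. heis_norm (g t w) \<le> C} \<in> sets N" by measurable
  also have "{w \<in> space N. \<forall>t\<in>dyads \<inter> {..T}. heis_norm (g t w) \<le> C} =
      {w \<in> space M. \<forall>t\<in>{0..T}. heis_norm (g t w) \<le> C}"
    using norm_g_le_iff_dyads unfolding N by blast
  finally show ?thesis .
qed

lemma move_event_in_sets:
  assumes N: "space N = space M" and g: "\<And>t. t \<in> dyads \<Longrightarrow> t \<le> 1 \<Longrightarrow> g t \<in> borel_measurable N"
    and S: "S \<in> sets borel"
  shows "move_event S C \<in> sets N"
proof -
  have "move_event S C = (g 1 -` S \<inter> space N) \<inter> {w \<in> space M. \<forall>t\<in>{0..1}. heis_norm (g t w) \<le> C}"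
    by (auto simp: move_event_def N)
  then show ?thesis
    using measurable_sets[OF g[of 1] S] norm_g_le_event[OF N g, where C = C] by auto
qed

text \<open>Up to a null set the event is the preimage of a set of dyadic paths: the area is
  replaced by its functional, and continuity reduces all times to dyadic ones. The law of the planar
  path therefore determines the probability.\<close>

lemma move_event_measure:
  assumes S: "S \<in> sets borel"
  shows "prob (move_event S C) = measure (distr M path_space (bm_path W)) (move_functional S C)"
proof -
  have "measure (distr M path_space (bm_path W)) (move_functional S C) =
      prob (bm_path W -` move_functional S C \<inter> space M)"
    by (rule measure_distr[OF bm_path_measurable move_functional_measurable[OF S]])
  also have "\<dots> = prob (move_event S C)"
  proof (rule finite_measure_eq_AE)
    show "bm_path W -` move_functional S C \<inter> space M \<in> sets M"
      by (rule measurable_sets[OF bm_path_measurable move_functional_measurable[OF S]])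
    show "move_event S C \<in> sets M"
      by (rule move_event_in_sets[OF refl _ S]) (simp add: g_measurable dyads_nonneg)
    show "AE w in M. (w \<in> bm_path W -` move_functional S C \<inter> space M) = (w \<in> move_event S C)"
      using A_limit
    proof (rule AE_mp, intro AE_I2 impI)
      fix w assume w: "w \<in> space M" and lim: "\<forall>t\<in>dyads. (\<lambda>n. dyadic_area n (\<lambda>b u. W b u w) t) \<longlonglongrightarrow> A t w"
      have "dyadic_area n (\<lambda>b u. bm_path W w (b, u)) t = dyadic_area n (\<lambda>b u. W b u w) t" for n t
        unfolding dyadic_area_def grid_area_def
        by (intro arg_cong2[where f = "(*)"] refl sum.cong) (simp_all add: bm_path_def dyadsI del: of_nat_Suc)
      then have area: "area_functional (bm_path W w) t = A t w" if "t \<in> dyads" for t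
        using lim that by (simp add: area_functional_def limI)
      have "((bm_path W w (True, t), bm_path W w (False, t)), area_functional (bm_path W w) t) = g t w" if "t \<in> dyads" for t
        unfolding area[OF that] using that by (simp add: hyp_BM_def bm_path_def)
      then have "bm_path W w \<in> move_functional S C \<longleftrightarrow> g 1 w \<in> S \<and> (\<forall>t\<in>dyads \<inter> {..1}. heis_norm (g t w) \<le> C)"
        using measurable_space[OF bm_path_measurable w] by (auto simp: move_functional_def)
      then show "(w \<in> bm_path W -` move_functional S C \<inter> space M) = (w \<in> move_event S C)"
        using w norm_g_le_iff_dyads[OF w] by (auto simp: move_event_def)
    qed
  qed
  finally show ?thesis by simp
qed

end

lemma move_event_law:
  assumes "heis_bm M W A" "heis_bm M' W' A'" "S \<in> sets borel"
  shows "measure M (heis_bm.move_event M W A S C) = measure M' (heis_bm.move_event M' W' A' S C)"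
proof -
  interpret A: heis_bm M W A by fact
  interpret B: heis_bm M' W' A' by fact
  show ?thesis
    unfolding A.move_event_measure[OF assms(3)] B.move_event_measure[OF assms(3)]
      planar_bm_path_law[OF A.planar_bm_axioms B.planar_bm_axioms] ..
qed

section \<open>Independence of past and future\<close>

definition bm_gens :: "'a measure \<Rightarrow> (bool \<Rightarrow> real \<Rightarrow> 'a \<Rightarrow> real) \<Rightarrow> real set \<Rightarrow> 'a set set" where
  "bm_gens M W U = {W b u -` X \<inter> space M | b u X. u \<in> U \<inter> dyads \<and> X \<in> sets borel}"

text \<open>Null sets are added so that the area process, which is only an almost sure limit of path functionals,
  is adapted.\<close>

definition bm_sigma :: "'a measure \<Rightarrow> (bool \<Rightarrow> real \<Rightarrow> 'a \<Rightarrow> real) \<Rightarrow> real set \<Rightarrow> 'a measure" where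
  "bm_sigma M W U = sigma (space M) (bm_gens M W U \<union> null_sets M)"

abbreviation bm_shift :: "real \<Rightarrow> (bool \<Rightarrow> real \<Rightarrow> 'a \<Rightarrow> real) \<Rightarrow> bool \<Rightarrow> real \<Rightarrow> 'a \<Rightarrow> real" where
  "bm_shift s W \<equiv> bm_transform (\<lambda>_. 1) s 1 W"

lemma bm_gens_Pow: "bm_gens M W U \<subseteq> Pow (space M)"
  by (auto simp: bm_gens_def)

lemma space_bm_sigma [simp]: "space (bm_sigma M W U) = space M"
  by (simp add: bm_sigma_def space_measure_of_conv)

lemma sets_bm_sigma: "sets (bm_sigma M W U) = sigma_sets (space M) (bm_gens M W U \<union> null_sets M)"
  unfolding bm_sigma_def
  by (rule sets_measure_of) (use bm_gens_Pow[of M W U] sets.sets_into_space in \<open>auto simp: null_sets_def\<close>)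

lemma null_sets_bm_sigma: "N \<in> null_sets M \<Longrightarrow> N \<in> sets (bm_sigma M W U)"
  unfolding sets_bm_sigma by auto

lemma W_bm_sigma: "u \<in> U \<Longrightarrow> u \<in> dyads \<Longrightarrow> W b u \<in> borel_measurable (bm_sigma M W U)"
  by (rule measurableI) (auto simp: sets_bm_sigma bm_gens_def intro!: sigma_sets.Basic)

lemma bm_sigma_subset:
  assumes "\<And>b u. u \<in> U \<Longrightarrow> u \<in> dyads \<Longrightarrow> W' b u \<in> borel_measurable (bm_sigma M W V)"
  shows "sets (bm_sigma M W' U) \<subseteq> sets (bm_sigma M W V)"
proof -
  have "sigma_sets (space (bm_sigma M W V)) (bm_gens M W' U \<union> null_sets M) \<subseteq> sets (bm_sigma M W V)"
  proof (rule sets.sigma_sets_subset, safe)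
    fix a assume "a \<in> bm_gens M W' U"
    then obtain b u X where a: "a = W' b u -` X \<inter> space M" "u \<in> U" "u \<in> dyads" "X \<in> sets borel"
      by (auto simp: bm_gens_def)
    then show "a \<in> sets (bm_sigma M W V)"
      using measurable_sets[OF assms a(4), of u b] by simp
  qed (rule null_sets_bm_sigma)
  then show ?thesis by (simp add: sets_bm_sigma[of M W'])
qed

lemma bm_sigma_mono: "U \<subseteq> V \<Longrightarrow> sets (bm_sigma M W U) \<subseteq> sets (bm_sigma M W V)"
  by (intro bm_sigma_subset W_bm_sigma) auto

text \<open>\<open>M\<close> need not be complete, so measurability of \<open>f\<close> with respect
  to \<open>M\<close> is what makes the part of a preimage inside the exceptional set a null set,
  hence a member of the augmented sigma-algebra.\<close>

lemma bm_sigma_AE_cong: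
  assumes f: "f \<in> borel_measurable M" and h: "h \<in> borel_measurable (bm_sigma M W U)"
    and sub: "sets (bm_sigma M W U) \<subseteq> sets M" and ae: "AE x in M. f x = h x"
  shows "f \<in> borel_measurable (bm_sigma M W U)"
proof (rule measurableI)
  fix X :: "'b set" assume X: "X \<in> sets borel"
  have fX: "f -` X \<inter> space M \<in> sets M" using measurable_sets[OF f X] .
  have hX: "h -` X \<inter> space M \<in> sets (bm_sigma M W U)" using measurable_sets[OF h X] by simp
  then have hM: "h -` X \<inter> space M \<in> sets M" using sub by blast
  obtain N where N: "N \<in> null_sets M" "{x \<in> space M. f x \<noteq> h x} \<subseteq> N"
    using ae unfolding eventually_ae_filter by blast
  have NM: "N \<in> sets M" using N(1) by auto
  have "f -` X \<inter> space M = ((h -` X \<inter> space M) - N) \<union> (f -` X \<inter> space M \<inter> N)"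
    using N(2) by auto
  moreover have "f -` X \<inter> space M \<inter> N \<in> null_sets M"
    by (rule null_set_Int1[OF N(1) fX])
  ultimately have "f -` X \<inter> space M \<in> sets (bm_sigma M W U)"
    by (metis hX N(1) null_sets_bm_sigma sets.Un sets.Diff)
  then show "f -` X \<inter> space (bm_sigma M W U) \<in> sets (bm_sigma M W U)" by simp
qed simp

context planar_bm
begin

lemma bm_sigma_subset_M: "sets (bm_sigma M W U) \<subseteq> sets M"
proof -
  have "sigma_sets (space M) (bm_gens M W U \<union> null_sets M) \<subseteq> sets M"
    by (rule sets.sigma_sets_subset)
      (use W_measurable dyads_nonneg in \<open>auto simp: bm_gens_def intro!: measurable_sets\<close>)
  then show ?thesis by (simp add: sets_bm_sigma)
qed

lemma planar_bm_shift: "0 \<le> s \<Longrightarrow> planar_bm M (bm_shift s W)"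
  by (rule planar_bm_transform) auto

text \<open>On a grid containing \<open>s\<close>, the past is a function of the first
  \<open>a\<close> increments and the future of the following ones: disjoint groups of independent
  variables.\<close>

lemma level_indep:
  assumes s: "s = real a / 2 ^ n"
    and x: "x \<in> sigma_sets (space M) (bm_gens M W {real i / 2 ^ n | i. i \<le> a})"
    and y: "y \<in> sigma_sets (space M) (bm_gens M (bm_shift s W) {real i / 2 ^ n | i. i \<le> N})"
  shows "prob (x \<inter> y) = prob x * prob y"
proof -
  let ?d = "1 / 2 ^ n :: real"
  define E where "E k = {grid_inc ?d (fst k) (snd k) -` X \<inter> space M | X. X \<in> sets borel}" for k :: "bool \<times> nat"
  define I where "I j = (UNIV :: bool set) \<times> (if j then {..<a} else {a..<a + N})" for j :: bool
  have EM: "E k \<subseteq> sets M" for k unfolding E_def by (auto intro!: measurable_sets[OF grid_inc_measurable])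
  have UnI: "(\<Union>j\<in>UNIV. I j) = UNIV \<times> {..<a + N}" by (auto simp: I_def UNIV_bool)
  have "indep_sets E (\<Union>j\<in>UNIV. I j)"
    unfolding UnI using grid_inc_indep[of ?d "a + N"] unfolding indep_vars_def2 E_def
    by (simp add: case_prod_beta')
  moreover have "Int_stable (E k)" for k
  proof (rule Int_stableI)
    fix p q assume "p \<in> E k" "q \<in> E k"
    then obtain X Y where "p = grid_inc ?d (fst k) (snd k) -` X \<inter> space M" "q = grid_inc ?d (fst k) (snd k) -` Y \<inter> space M"
      "X \<in> sets borel" "Y \<in> sets borel" by (auto simp: E_def)
    then show "p \<inter> q \<in> E k" unfolding E_def by (intro CollectI exI[of _ "X \<inter> Y"]) auto
  qed
  ultimately have "indep_sets (\<lambda>j. sigma_sets (space M) (\<Union>k\<in>I j. E k)) UNIV"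
    by (rule indep_sets_collect_sigma) (auto simp: disjoint_family_on_def I_def)
  then have ind: "prob (x \<inter> y) = prob x * prob y"
    if "x \<in> sigma_sets (space M) (\<Union>k\<in>I True. E k)" "y \<in> sigma_sets (space M) (\<Union>k\<in>I False. E k)" for x y
    using indep_setsD[of _ UNIV UNIV "\<lambda>j. if j then x else y"] that by (simp add: UNIV_bool Int_commute mult.commute)
  define S where "S j = sigma (space M) (\<Union>k\<in>I j. E k)" for j
  have Pow: "(\<Union>k\<in>I j. E k) \<subseteq> Pow (space M)" for j using EM sets.sets_into_space by blast
  have sS: "sets (S j) = sigma_sets (space M) (\<Union>k\<in>I j. E k)" "space (S j) = space M" for j
    using Pow unfolding S_def by (auto simp: sets_measure_of)
  have inc: "grid_inc ?d b i \<in> borel_measurable (S j)" if "(b, i) \<in> I j" for b i j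
  proof (rule measurableI)
    fix X :: "real set" assume X: "X \<in> sets borel"
    then have "grid_inc ?d b i -` X \<inter> space M \<in> E (b, i)" by (auto simp: E_def)
    then show "grid_inc ?d b i -` X \<inter> space (S j) \<in> sets (S j)"
      using that unfolding sS by (intro sigma_sets.Basic) auto
  qed simp
  have "W b (real i / 2 ^ n) \<in> borel_measurable (S True)" if "i \<le> a" for b i
  proof -
    have "(\<lambda>w. \<Sum>l<i. grid_inc ?d b l w) \<in> borel_measurable (S True)"
      using that by (intro borel_measurable_sum inc) (auto simp: I_def)
    then show ?thesis
      by (rule measurable_cong[THEN iffD1, rotated]) (use W_eq_sum_grid_inc[of _ b i ?d] in \<open>simp add: sS\<close>)
  qed
  then have "sigma_sets (space (S True)) (bm_gens M W {real i / 2 ^ n | i. i \<le> a}) \<subseteq> sets (S True)"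
    by (intro sets.sigma_sets_subset) (auto simp: bm_gens_def sS(2)[of True, symmetric] intro!: measurable_sets)
  moreover have "bm_shift s W b (real i / 2 ^ n) \<in> borel_measurable (S False)" if "i \<le> N" for b i
  proof -
    have "(\<lambda>w. \<Sum>l\<in>{a..<a + i}. grid_inc ?d b l w) \<in> borel_measurable (S False)"
      using that by (intro borel_measurable_sum inc) (auto simp: I_def)
    moreover have "(\<Sum>l\<in>{a..<a + i}. grid_inc ?d b l w) = bm_shift s W b (real i / 2 ^ n) w" for w
      unfolding grid_inc_def by (subst sum_Suc_diff'[where f = "\<lambda>l. W b (real l * ?d) w"])
        (auto simp: bm_transform_def s add_divide_distrib)
    ultimately show ?thesis by simp
  qed
  then have "sigma_sets (space (S False)) (bm_gens M (bm_shift s W) {real i / 2 ^ n | i. i \<le> N}) \<subseteq> sets (S False)"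
    by (intro sets.sigma_sets_subset) (auto simp: bm_gens_def sS(2)[of False, symmetric] intro!: measurable_sets)
  ultimately show ?thesis using x y unfolding sS by (intro ind) auto
qed

text \<open>Independence extends to generated sigma-algebras only from intersection-stable families.
  Counting starts at \<open>m\<close> because coarser grids may miss the splitting time.\<close>

lemma Int_stable_increasing_sigma:
  fixes G :: "nat \<Rightarrow> 'a set set"
  assumes G: "\<And>n. G n \<subseteq> sets M" and mono: "\<And>n k. m \<le> n \<Longrightarrow> n \<le> k \<Longrightarrow> G n \<subseteq> G k"
  shows "Int_stable ((\<Union>n\<in>{m..}. sigma_sets (space M) (G n)) \<union> null_sets M)" (is "Int_stable (?E \<union> _)")
proof (rule Int_stableI)
  have EM: "?E \<subseteq> sets M" using sets.sigma_sets_subset[OF G] by auto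
  fix x y assume xy: "x \<in> ?E \<union> null_sets M" "y \<in> ?E \<union> null_sets M"
  show "x \<inter> y \<in> ?E \<union> null_sets M"
  proof (cases "x \<in> null_sets M \<or> y \<in> null_sets M")
    case True
    have "x \<in> sets M" "y \<in> sets M" using xy EM by auto
    then have "x \<inter> y \<in> null_sets M" using True by (auto intro: null_set_Int1 null_set_Int2)
    then show ?thesis by simp
  next
    case False
    then obtain n k where n: "m \<le> n" "x \<in> sigma_sets (space M) (G n)" and k: "m \<le> k" "y \<in> sigma_sets (space M) (G k)"
      using xy by auto
    interpret sigma_algebra "space M" "sigma_sets (space M) (G (max n k))"
      by (rule sigma_algebra_sigma_sets) (use G sets.sets_into_space in blast)
    have "x \<in> sigma_sets (space M) (G (max n k))" "y \<in> sigma_sets (space M) (G (max n k))"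
      using n k mono sigma_sets_mono'[OF mono] by (meson max.cobounded1 max.cobounded2 subsetD)+
    then have "x \<inter> y \<in> sigma_sets (space M) (G (max n k))" by (rule Int)
    moreover have "max n k \<in> {m..}" using n(1) by simp
    ultimately show ?thesis by blast
  qed
qed

text \<open>Independence on finite grids extends along an increasing sequence of grids by the
  pi-lambda theorem; the added null sets satisfy the product formula trivially.\<close>

lemma past_future_indep:
  assumes s: "s \<in> dyads" and x: "x \<in> sets (bm_sigma M W {..s})" and y: "y \<in> sets (bm_sigma M (bm_shift s W) UNIV)"
  shows "prob (x \<inter> y) = prob x * prob y"
proof -
  interpret S: planar_bm M "bm_shift s W" by (rule planar_bm_shift[OF dyads_nonneg[OF s]])
  obtain m where m: "\<And>n. m \<le> n \<Longrightarrow> s * 2 ^ n \<in> \<nat>" by (rule dyads_level[OF s]) blast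
  \<comment> \<open>Mesh and horizon grow together, so these finite grids increase to the set of all
    dyadic times.\<close>
  define U where "U n = {real i / 2 ^ n | i. i \<le> n * 2 ^ n}" for n :: nat
  have U_Suc: "U n \<subseteq> U (Suc n)" for n
  proof
    fix t assume "t \<in> U n"
    then obtain i where "t = real i / 2 ^ n" "i \<le> n * 2 ^ n" by (auto simp: U_def)
    then have "t = real (2 * i) / 2 ^ Suc n" "2 * i \<le> Suc n * 2 ^ Suc n" by auto
    then show "t \<in> U (Suc n)" unfolding U_def by blast
  qed
  have U_mono: "U n \<subseteq> U k" if "n \<le> k" for n k using lift_Suc_mono_le[of U, OF U_Suc that] .
  have U_all: "\<exists>n\<ge>m. t \<in> U n" if tD: "t \<in> dyads" for t
  proof -
    obtain k l where t: "t = real k / 2 ^ l" using tD by (auto simp: dyads_def)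
    define n where "n = max m (max k l)"
    have "(2::real) ^ n = 2 ^ (n - l) * 2 ^ l" by (simp add: n_def flip: power_add)
    then have "t = real (k * 2 ^ (n - l)) / 2 ^ n" by (simp add: t)
    moreover have "k * 2 ^ (n - l) \<le> n * 2 ^ n" by (intro mult_mono power_increasing) (auto simp: n_def)
    ultimately show ?thesis by (intro exI[of _ n]) (auto simp: U_def n_def simp del: of_nat_mult)
  qed
  define P where "P n = bm_gens M W (U n \<inter> {..s})" for n
  define F where "F n = bm_gens M (bm_shift s W) (U n)" for n
  define EP where "EP = (\<Union>n\<in>{m..}. sigma_sets (space M) (P n))"
  define EF where "EF = (\<Union>n\<in>{m..}. sigma_sets (space M) (F n))"
  have PM: "P n \<subseteq> sets M" for n
    using W_measurable dyads_nonneg by (auto simp: P_def bm_gens_def intro!: measurable_sets)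
  have FM: "F n \<subseteq> sets M" for n
    using S.W_measurable dyads_nonneg by (auto simp: F_def bm_gens_def intro!: measurable_sets)
  have Pmono: "P n \<subseteq> P k" and Fmono: "F n \<subseteq> F k" if "n \<le> k" for n k
    using U_mono[OF that] unfolding P_def F_def bm_gens_def by blast+
  have EPM: "EP \<subseteq> sets M" and EFM: "EF \<subseteq> sets M"
    using sets.sigma_sets_subset[OF PM] sets.sigma_sets_subset[OF FM] by (auto simp: EP_def EF_def)
  have ind: "indep_set (EP \<union> null_sets M) (EF \<union> null_sets M)"
  proof (rule indep_setI)
    show "EP \<union> null_sets M \<subseteq> events" "EF \<union> null_sets M \<subseteq> events" using EPM EFM by auto
    fix x y assume xy: "x \<in> EP \<union> null_sets M" "y \<in> EF \<union> null_sets M"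
    show "prob (x \<inter> y) = prob x * prob y"
    proof (cases "x \<in> null_sets M \<or> y \<in> null_sets M")
      case True
      have "x \<in> sets M" "y \<in> sets M" using xy EPM EFM by auto
      then have "x \<inter> y \<in> null_sets M" using True by (auto intro: null_set_Int1 null_set_Int2)
      then show ?thesis using True by (auto simp: measure_eq_0_null_sets)
    next
      case False
      then obtain n k where n: "m \<le> n" "x \<in> sigma_sets (space M) (P n)" and k: "m \<le> k" "y \<in> sigma_sets (space M) (F k)"
        using xy by (auto simp: EP_def EF_def)
      define l where "l = max n k"
      have l: "m \<le> l" "n \<le> l" "k \<le> l" using n(1) by (auto simp: l_def)
      obtain a where a: "s = real a / 2 ^ l" by (rule dyads_levelE[OF m[OF l(1)]])
      have "U l \<inter> {..s} \<subseteq> {real i / 2 ^ l | i. i \<le> a}"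
        by (auto simp: U_def a divide_le_cancel)
      then have "P l \<subseteq> bm_gens M W {real i / 2 ^ l | i. i \<le> a}"
        unfolding P_def bm_gens_def by blast
      then have "P n \<subseteq> bm_gens M W {real i / 2 ^ l | i. i \<le> a}" using Pmono[OF l(2)] by blast
      then have x: "x \<in> sigma_sets (space M) (bm_gens M W {real i / 2 ^ l | i. i \<le> a})"
        using n(2) sigma_sets_mono' by blast
      have y: "y \<in> sigma_sets (space M) (bm_gens M (bm_shift s W) {real i / 2 ^ l | i. i \<le> l * 2 ^ l})"
        using k(2) sigma_sets_mono'[OF Fmono[OF l(3)]] by (auto simp: F_def U_def)
      show ?thesis by (rule level_indep[OF a x y])
    qed
  qed
  have "indep_set (sigma_sets (space M) (EP \<union> null_sets M)) (sigma_sets (space M) (EF \<union> null_sets M))"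
    using ind unfolding EP_def EF_def
    by (rule indep_set_sigma_sets) (auto intro!: Int_stable_increasing_sigma PM FM Pmono Fmono simp del: Int_stable_def)
  moreover have "sets (bm_sigma M W {..s}) \<subseteq> sigma_sets (space M) (EP \<union> null_sets M)"
    unfolding sets_bm_sigma
  proof (rule sigma_sets_mono', safe)
    fix x assume "x \<in> bm_gens M W {..s}" and "x \<notin> null_sets M"
    then obtain b u X where x: "x = W b u -` X \<inter> space M" "u \<le> s" "u \<in> dyads" "X \<in> sets borel"
      by (auto simp: bm_gens_def)
    obtain n where "n \<ge> m" "u \<in> U n" using U_all[OF x(3)] by blast
    then have "x \<in> P n" using x unfolding P_def bm_gens_def by blast
    then show "x \<in> EP" using \<open>n \<ge> m\<close> unfolding EP_def by (auto intro: sigma_sets.Basic)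
  qed
  moreover have "sets (bm_sigma M (bm_shift s W) UNIV) \<subseteq> sigma_sets (space M) (EF \<union> null_sets M)"
    unfolding sets_bm_sigma
  proof (rule sigma_sets_mono', safe)
    fix x assume "x \<in> bm_gens M (bm_shift s W) UNIV" and "x \<notin> null_sets M"
    then obtain b u X where x: "x = bm_shift s W b u -` X \<inter> space M" "u \<in> dyads" "X \<in> sets borel"
      by (auto simp: bm_gens_def)
    obtain n where "n \<ge> m" "u \<in> U n" using U_all[OF x(2)] by blast
    then have "x \<in> F n" using x unfolding F_def bm_gens_def by blast
    then show "x \<in> EF" using \<open>n \<ge> m\<close> unfolding EF_def by (auto intro: sigma_sets.Basic)
  qed
  ultimately show ?thesis using x y by (meson indep_setD subsetD)
qed

lemma shift_bm_sigma:
  assumes "s \<in> dyads"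
  shows "sets (bm_sigma M (bm_shift s W) {..t}) \<subseteq> sets (bm_sigma M W {..s + t})"
proof (rule bm_sigma_subset)
  fix b u assume u: "u \<in> {..t}" "u \<in> dyads"
  have [measurable]: "W b (s + 1 * u) \<in> borel_measurable (bm_sigma M W {..s + t})" "W b s \<in> borel_measurable (bm_sigma M W {..s + t})"
    using assms u dyads_nonneg[OF u(2)] by (auto intro!: W_bm_sigma)
  show "bm_shift s W b u \<in> borel_measurable (bm_sigma M W {..s + t})"
    unfolding bm_transform_def by measurable
qed

text \<open>Kolmogorov's argument: \<open>B\<close> is independent of the past up to every integer
  time. These pasts generate a sigma-algebra containing \<open>B\<close>, so \<open>B\<close> is
  independent of itself.\<close>

lemma zero_one_law:
  assumes B: "B \<in> sets (bm_sigma M W UNIV)"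
    and tail: "\<And>k::nat. B \<in> sets (bm_sigma M (bm_shift (real k) W) UNIV)"
  shows "prob B = 0 \<or> prob B = 1"
proof -
  define E where "E = (\<Union>k::nat. sets (bm_sigma M W {..real k}))"
  have BM: "B \<in> sets M" using B bm_sigma_subset_M by blast
  have "indep_set E {B}"
    using past_future_indep[OF of_nat_dyads _ tail] bm_sigma_subset_M BM
    by (intro indep_setI) (auto simp: E_def)
  moreover have "Int_stable E"
  proof (rule Int_stableI)
    fix x y assume "x \<in> E" "y \<in> E"
    then obtain k l where "x \<in> sets (bm_sigma M W {..real k})" "y \<in> sets (bm_sigma M W {..real l})" by (auto simp: E_def)
    moreover have "sets (bm_sigma M W {..real k}) \<subseteq> sets (bm_sigma M W {..real (max k l)})"
      "sets (bm_sigma M W {..real l}) \<subseteq> sets (bm_sigma M W {..real (max k l)})"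
      by (intro bm_sigma_mono; simp)+
    ultimately have "x \<in> sets (bm_sigma M W {..real (max k l)})" "y \<in> sets (bm_sigma M W {..real (max k l)})"
      by blast+
    then have "x \<inter> y \<in> sets (bm_sigma M W {..real (max k l)})" by (rule sets.Int)
    then show "x \<inter> y \<in> E" unfolding E_def by blast
  qed
  moreover have "Int_stable {B}" by (simp add: Int_stable_def)
  ultimately have ind: "indep_set (sigma_sets (space M) E) (sigma_sets (space M) {B})"
    by (rule indep_set_sigma_sets)
  have "bm_gens M W UNIV \<union> null_sets M \<subseteq> E"
  proof safe
    fix x assume "x \<in> bm_gens M W UNIV"
    then obtain b u X where x: "x = W b u -` X \<inter> space M" "u \<in> dyads" "X \<in> sets borel" by (auto simp: bm_gens_def)
    obtain k :: nat where "u \<le> real k" using real_arch_simple by blast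
    then show "x \<in> E" using measurable_sets[OF W_bm_sigma[of u "{..real k}" W b M] x(3)] x unfolding E_def by auto
  next
    fix x assume "x \<in> null_sets M"
    then show "x \<in> E" using null_sets_bm_sigma unfolding E_def by blast
  qed
  then have "B \<in> sigma_sets (space M) E"
    using B unfolding sets_bm_sigma using sigma_sets_mono' by blast
  moreover have "B \<in> sigma_sets (space M) {B}" by (rule sigma_sets.Basic) simp
  ultimately have "prob (B \<inter> B) = prob B * prob B" by (rule indep_setD[OF ind])
  then show ?thesis by simp
qed

end

context heis_bm
begin

text \<open>For dyadic \<open>t\<close> the area is almost surely the limit of sums that look at
  times up to \<open>t\<close> only, and the added null sets absorb the exceptional set.\<close>

lemma A_bm_sigma:
  assumes t: "t \<in> dyads" and U: "\<And>u. u \<in> dyads \<Longrightarrow> u \<le> t \<Longrightarrow> u \<in> U"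
  shows "A t \<in> borel_measurable (bm_sigma M W U)"
proof (rule bm_sigma_AE_cong)
  have "(\<lambda>w. dyadic_area n (\<lambda>b u. W b u w) t) \<in> borel_measurable (bm_sigma M W U)" for n
  proof -
    have "real l / 2 ^ n \<le> t" if "l \<le> nat \<lfloor>t * 2 ^ n\<rfloor>" for l
    proof -
      have "real l \<le> of_int \<lfloor>t * 2 ^ n\<rfloor>" using that dyads_nonneg[OF t] by (simp add: le_nat_iff)
      also have "\<dots> \<le> t * 2 ^ n" by (rule of_int_floor_le)
      finally show ?thesis by (simp add: field_simps)
    qed
    then have "W b (real l / 2 ^ n) \<in> borel_measurable (bm_sigma M W U)" if "l \<le> nat \<lfloor>t * 2 ^ n\<rfloor>" for b l
      using that by (intro W_bm_sigma U dyadsI) auto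
    then show ?thesis unfolding dyadic_area_def grid_area_def
      by (intro borel_measurable_times borel_measurable_const borel_measurable_sum borel_measurable_diff)
        (auto simp del: of_nat_Suc)
  qed
  then show "(\<lambda>w. lim (\<lambda>n. dyadic_area n (\<lambda>b u. W b u w) t)) \<in> borel_measurable (bm_sigma M W U)"
    by (rule borel_measurable_lim_metric)
  show "AE w in M. A t w = lim (\<lambda>n. dyadic_area n (\<lambda>b u. W b u w) t)"
    using A_limit
  proof eventually_elim
    case (elim w)
    then show ?case using t by (metis limI)
  qed
qed (use t dyads_nonneg bm_sigma_subset_M in \<open>auto intro: A_measurable\<close>)

lemma g_bm_sigma:
  assumes "t \<in> dyads" "\<And>u. u \<in> dyads \<Longrightarrow> u \<le> t \<Longrightarrow> u \<in> U"
  shows "g t \<in> borel_measurable (bm_sigma M W U)"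
  unfolding hyp_BM_def using assms
  by (intro borel_measurable_Pair W_bm_sigma A_bm_sigma) auto

end

section \<open>Small balls: the lower bound\<close>

abbreviation area_shift :: "real \<Rightarrow> (bool \<Rightarrow> real \<Rightarrow> 'a \<Rightarrow> real) \<Rightarrow> (real \<Rightarrow> 'a \<Rightarrow> real) \<Rightarrow> real \<Rightarrow> 'a \<Rightarrow> real" where
  "area_shift s W A \<equiv> area_transform (\<lambda>_. 1) s 1 W A"

abbreviation heis_path :: "(bool \<Rightarrow> real \<Rightarrow> 'a \<Rightarrow> real) \<Rightarrow> (real \<Rightarrow> 'a \<Rightarrow> real) \<Rightarrow> real \<Rightarrow> 'a \<Rightarrow> (real \<times> real) \<times> real" where
  "heis_path W A \<equiv> hyp_BM (W True) (W False) A"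

abbreviation shift_path :: "real \<Rightarrow> (bool \<Rightarrow> real \<Rightarrow> 'a \<Rightarrow> real) \<Rightarrow> (real \<Rightarrow> 'a \<Rightarrow> real) \<Rightarrow> real \<Rightarrow> 'a \<Rightarrow> (real \<times> real) \<times> real" where
  "shift_path s W A \<equiv> heis_path (bm_shift s W) (area_shift s W A)"

text \<open>The shifted process is the left group increment after time \<open>s\<close>; the
  correction term in \<open>area_transform\<close> is exactly the one demanded by the group
  law.\<close>

lemma heis_path_shift:
  "heis_path W A (s + t) w = hmul (heis_path W A s w) (shift_path s W A t w)"
  by (simp add: hyp_BM_def hmul_def bm_transform_def area_transform_def field_simps)

lemma hmul_assoc: "hmul (hmul a b) c = hmul a (hmul b c)"
  by (simp add: hmul_def field_simps)

section \<open>Geometry of a four-step block\<close>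

definition move_set :: "real \<times> real \<times> real \<Rightarrow> ((real \<times> real) \<times> real) set" where
  "move_set m = (case m of (x, y, \<sigma>) \<Rightarrow>
     {h. \<bar>fst (fst h) - x\<bar> \<le> 1 \<and> \<bar>snd (fst h) - y\<bar> \<le> 1 \<and> 0 \<le> \<sigma> * snd h})"

lemma move_set_borel [measurable]: "move_set m \<in> sets borel"
  unfolding move_set_def
  by (cases m) (auto intro!: borel_closed closed_Collect_conj closed_Collect_le continuous_intros)

text \<open>Twice the vertical displacement consists of the areas gained inside the steps, which
  have the favourable sign, and of the products \<open>p1\<close> to \<open>p6\<close>. Two of these
  are large with the sign of \<sigma>: \<open>p4\<close> contributes at least 19 * 14 and
  \<open>p5\<close> at least 15 * 15. The others cost at most 147 + 27 + 26 + 1, which leaves 290,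
  more than the required 128.\<close>

lemma four_moves:
  assumes \<sigma>: "\<sigma> = 1 \<or> \<sigma> = -1" and s: "\<bar>s1\<bar> \<le> 4" "\<bar>s2\<bar> \<le> 4"
    and h: "h1 \<in> move_set (20, 0, \<sigma>)" "h2 \<in> move_set (0, 20 * \<sigma>, \<sigma>)"
      "h3 \<in> move_set (- 20 + s1, 0, \<sigma>)" "h4 \<in> move_set (0, - 20 * \<sigma> + s2, \<sigma>)"
    and H: "hmul h1 (hmul h2 (hmul h3 h4)) = ((p, q), w)"
  shows "\<bar>p - s1\<bar> \<le> 4" "\<bar>q - s2\<bar> \<le> 4" "64 \<le> \<sigma> * w"
proof -
  obtain x1 y1 a1 where h1: "h1 = ((x1, y1), a1)" by (metis surj_pair)
  obtain x2 y2 a2 where h2: "h2 = ((x2, y2), a2)" by (metis surj_pair)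
  obtain x3 y3 a3 where h3: "h3 = ((x3, y3), a3)" by (metis surj_pair)
  obtain x4 y4 a4 where h4: "h4 = ((x4, y4), a4)" by (metis surj_pair)
  note h_eq = h1 h2 h3 h4
  have b1: "\<bar>x1 - 20\<bar> \<le> 1" "\<bar>y1\<bar> \<le> 1" "0 \<le> \<sigma> * a1"
    and b2: "\<bar>x2\<bar> \<le> 1" "\<bar>y2 - 20 * \<sigma>\<bar> \<le> 1" "0 \<le> \<sigma> * a2"
    and b3: "\<bar>x3 - (- 20 + s1)\<bar> \<le> 1" "\<bar>y3\<bar> \<le> 1" "0 \<le> \<sigma> * a3"
    and b4: "\<bar>x4\<bar> \<le> 1" "\<bar>y4 - (- 20 * \<sigma> + s2)\<bar> \<le> 1" "0 \<le> \<sigma> * a4"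
    using h by (auto simp: move_set_def h_eq)
  have p: "p = x1 + x2 + x3 + x4" and q: "q = y1 + y2 + y3 + y4"
    using H by (auto simp: hmul_def h_eq)
  note bb = b1(1,2)[unfolded abs_le_iff] b2(1,2)[unfolded abs_le_iff] b3(1,2)[unfolded abs_le_iff]
    b4(1,2)[unfolded abs_le_iff] s[unfolded abs_le_iff]
  show "\<bar>p - s1\<bar> \<le> 4" unfolding p abs_le_iff using bb by linarith
  show "\<bar>q - s2\<bar> \<le> 4" unfolding q abs_le_iff using bb by linarith
  define p1 where "p1 = x1 * (y2 + y3 + y4)"
  define p2 where "p2 = y1 * (x2 + x3 + x4)"
  define p3 where "p3 = x2 * (y3 + y4)"
  define p4 where "p4 = y2 * (x3 + x4)"
  define p5 where "p5 = x3 * y4"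
  define p6 where "p6 = y3 * x4"
  have w: "2 * w = 2 * (a1 + a2 + a3 + a4) + p1 - p2 + p3 - p4 + p5 - p6"
    using H by (auto simp: hmul_def h_eq field_simps p1_def p2_def p3_def p4_def p5_def p6_def)
  have prod: "u * v \<le> a * b \<and> - (u * v) \<le> a * b"
    if "u \<le> a" "- u \<le> a" "v \<le> b" "- v \<le> b" for u v a b :: real
  proof -
    have "\<bar>u * v\<bar> \<le> a * b"
      unfolding abs_mult using that by (intro mult_mono) auto
    then show ?thesis by linarith
  qed
  have \<sigma>1: "\<sigma> \<le> 1" "- 1 \<le> \<sigma>" using \<sigma> by auto
  \<comment> \<open>The second factor is small because the vertical sides of the square nearly
    cancel: three errors of 1 and a correction of 4.\<close>
  have P1: "p1 \<le> 21 * 7 \<and> - p1 \<le> 21 * 7"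
    unfolding p1_def by (rule prod) (use bb in linarith)+
  have P2: "p2 \<le> 1 * 27 \<and> - p2 \<le> 1 * 27"
    unfolding p2_def by (rule prod) (use bb in linarith)+
  have P3: "p3 \<le> 1 * 26 \<and> - p3 \<le> 1 * 26"
    unfolding p3_def by (rule prod) (use bb \<sigma>1 in linarith)+
  have P6: "p6 \<le> 1 * 1 \<and> - p6 \<le> 1 * 1"
    unfolding p6_def by (rule prod) (use bb in linarith)+
  from \<sigma> show "64 \<le> \<sigma> * w"
  proof
    assume \<sigma>: "\<sigma> = 1"
    have "19 * 14 \<le> y2 * (- (x3 + x4))" by (rule mult_mono) (use bb \<sigma> in linarith)+
    then have P4: "19 * 14 \<le> - p4" by (simp only: mult_minus_right p4_def)
    have "15 * 15 \<le> (- x3) * (- y4)" by (rule mult_mono) (use bb \<sigma> in linarith)+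
    then have P5: "15 * 15 \<le> p5" by (simp only: minus_mult_minus p5_def)
    show ?thesis
      using w P1[THEN conjunct2] P2[THEN conjunct1] P3[THEN conjunct2] P4 P5 P6[THEN conjunct1] b1(3) b2(3) b3(3) b4(3)
      unfolding \<sigma> by simp
  next
    assume \<sigma>: "\<sigma> = -1"
    have "19 * 14 \<le> (- y2) * (- (x3 + x4))" by (rule mult_mono) (use bb \<sigma> in linarith)+
    then have P4: "19 * 14 \<le> p4" by (simp only: minus_mult_minus p4_def)
    have "15 * 15 \<le> (- x3) * y4" by (rule mult_mono) (use bb \<sigma> in linarith)+
    then have P5: "15 * 15 \<le> - p5" by (simp only: mult_minus_left p5_def)
    show ?thesis
      using w P1[THEN conjunct1] P2[THEN conjunct2] P3[THEN conjunct1] P4 P5 P6[THEN conjunct2] b1(3) b2(3) b3(3) b4(3)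
      unfolding \<sigma> by simp
  qed
qed

text \<open>The value 0 is excluded on purpose: a nonzero correction is always applied, and eight
  sign patterns describe every position.\<close>

definition sgn_opp :: "real \<Rightarrow> real" where
  "sgn_opp r = (if 0 \<le> r then - 1 else 1)"

text \<open>Target points and area signs of the four steps of a block: a square loop of side \<open>20\<close> with orientation \<open>\<sigma>\<close>
  whose last two sides are adjusted by \<open>4 * s1\<close> and \<open>4 * s2\<close> to recentre the horizontal part.\<close>

definition block_moves :: "real \<times> real \<times> real \<Rightarrow> nat \<Rightarrow> real \<times> real \<times> real" where
  "block_moves s i = (case s of (s1, s2, \<sigma>) \<Rightarrow>
     [(20, 0, \<sigma>), (0, 20 * \<sigma>, \<sigma>), (- 20 + 4 * s1, 0, \<sigma>), (0, - 20 * \<sigma> + 4 * s2, \<sigma>)] ! i)"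

text \<open>Region of admissible positions at block ends. The horizontal width 8 is a correction of
  4 plus an error of 4. Vertically, \<open>16 * C\<^sup>2\<close> bounds the gain of one block and
  64 bounds the cross term.\<close>

definition core :: "real \<Rightarrow> ((real \<times> real) \<times> real) set" where
  "core C = {h. \<bar>fst (fst h)\<bar> \<le> 8 \<and> \<bar>snd (fst h)\<bar> \<le> 8 \<and> \<bar>snd h\<bar> \<le> 16 * C\<^sup>2 + 64}"

lemma core_borel [measurable]: "core C \<in> sets borel"
  unfolding core_def
  by (auto intro!: borel_closed closed_Collect_conj closed_Collect_le continuous_intros)

lemma core_norm: "h \<in> core C \<Longrightarrow> heis_norm h \<le> 16 + sqrt (16 * C\<^sup>2 + 64)"
proof -
  assume h: "h \<in> core C"
  obtain x y z where eq: "h = ((x, y), z)" by (metis surj_pair)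
  have "heis_norm h \<le> \<bar>x\<bar> + \<bar>y\<bar> + sqrt \<bar>z\<bar>" unfolding eq by (rule heis_norm_le)
  also have "\<dots> \<le> 8 + 8 + sqrt (16 * C\<^sup>2 + 64)"
    using h by (intro add_mono real_sqrt_le_mono) (auto simp: core_def eq)
  finally show ?thesis by simp
qed

text \<open>Each coordinate is pushed towards 0 and may overshoot by at most its admissible range.
  Vertically the block contributes at least 64 against the sign of \<open>z\<close>, which outweighs
  the cross term of the group law, so the sum of both never increases the modulus on the side of
  \<open>z\<close>.\<close>

lemma block_stays_in_core:
  assumes g: "g \<in> core C"
    and s: "s = (sgn_opp (fst (fst g)), sgn_opp (snd (fst g)), sgn_opp (snd g))"
    and h: "\<And>i. i < 4 \<Longrightarrow> h i \<in> move_set (block_moves s i)" "\<And>i. i < 4 \<Longrightarrow> heis_norm (h i) \<le> C"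
  shows "hmul (hmul (hmul (hmul g (h 0)) (h 1)) (h 2)) (h 3) \<in> core C"
proof -
  define H where "H = hmul (h 0) (hmul (h 1) (hmul (h 2) (h 3)))"
  obtain p q w where H: "H = ((p, q), w)" by (metis surj_pair)
  obtain x y z where g_eq: "g = ((x, y), z)" by (metis surj_pair)
  define \<sigma> where "\<sigma> = sgn_opp z"
  define s1 where "s1 = sgn_opp x"
  define s2 where "s2 = sgn_opp y"
  have s_eq: "s = (s1, s2, \<sigma>)" by (simp add: s g_eq \<sigma>_def s1_def s2_def)
  have xyz: "\<bar>x\<bar> \<le> 8" "\<bar>y\<bar> \<le> 8" "\<bar>z\<bar> \<le> 16 * C\<^sup>2 + 64" using g by (auto simp: core_def g_eq)
  have mv: "h 0 \<in> move_set (20, 0, \<sigma>)" "h 1 \<in> move_set (0, 20 * \<sigma>, \<sigma>)"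
      "h 2 \<in> move_set (- 20 + 4 * s1, 0, \<sigma>)" "h 3 \<in> move_set (0, - 20 * \<sigma> + 4 * s2, \<sigma>)"
    using h(1)[of 0] h(1)[of 1] h(1)[of 2] h(1)[of 3]
    by (simp_all add: block_moves_def s_eq numeral_2_eq_2 numeral_3_eq_3)
  have *: "\<bar>p - 4 * s1\<bar> \<le> 4" "\<bar>q - 4 * s2\<bar> \<le> 4" "64 \<le> \<sigma> * w"
    by (rule four_moves[OF _ _ _ mv H[unfolded H_def]]; simp add: \<sigma>_def s1_def s2_def sgn_opp_def)+
  have C: "0 \<le> C" using h(2)[of 0] heis_norm_nonneg[of "h 0"] by linarith
  have "heis_norm H \<le> C + (C + (C + C))"
    \<comment> \<open>Four steps of norm at most \<open>C\<close> give a displacement of norm at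
      most \<open>4 * C\<close>, whence the bound \<open>16 * C\<^sup>2\<close> for its vertical
      part.\<close>
    unfolding H_def using h(2)[of 0] h(2)[of 1] h(2)[of 2] h(2)[of 3]
    by (intro order_trans[OF heis_norm_hmul_le] add_mono) auto
  then have "(heis_norm H)\<^sup>2 \<le> (4 * C)\<^sup>2" by (intro power_mono) auto
  then have w: "\<bar>w\<bar> \<le> 16 * C\<^sup>2"
    using heis_norm_ge_vertical[of w p q] by (simp add: H power_mult_distrib)
  have recentre: "\<bar>u\<bar> \<le> 8 \<and> \<bar>v + u\<bar> \<le> 8" if "\<bar>u - 4 * sgn_opp v\<bar> \<le> 4" "\<bar>v\<bar> \<le> 8" for u v :: real
    using that unfolding sgn_opp_def abs_le_iff by (cases "0 \<le> v") (simp_all only: if_True if_False, linarith+)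
  have p: "\<bar>p\<bar> \<le> 8" and xp: "\<bar>x + p\<bar> \<le> 8"
    using recentre[OF *(1)[unfolded s1_def] xyz(1)] by auto
  have q: "\<bar>q\<bar> \<le> 8" and yq: "\<bar>y + q\<bar> \<le> 8"
    using recentre[OF *(2)[unfolded s2_def] xyz(2)] by auto
  \<comment> \<open>Cross term of the group law between the starting position and the block; both
    horizontal parts are bounded by 8.\<close>
  define r where "r = (x * q - p * y) / 2"
  have "\<bar>x * q\<bar> \<le> 8 * 8" "\<bar>p * y\<bar> \<le> 8 * 8"
    unfolding abs_mult using xyz p q by (intro mult_mono; simp)+
  then have "\<bar>x * q - p * y\<bar> \<le> 64 + 64" by (intro order_trans[OF abs_triangle_ineq4] add_mono) simp_all
  then have r: "\<bar>r\<bar> \<le> 64" by (simp add: r_def)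
  have "\<bar>z + w + r\<bar> \<le> 16 * C\<^sup>2 + 64"
  proof (cases "0 \<le> z")
    case True
    then have "64 \<le> - w" using *(3) by (simp add: \<sigma>_def sgn_opp_def)
    then show ?thesis using True xyz(3) w r unfolding abs_le_iff by linarith
  next
    case False
    then have "64 \<le> w" using *(3) by (simp add: \<sigma>_def sgn_opp_def)
    then show ?thesis using False xyz(3) w r unfolding abs_le_iff by linarith
  qed
  moreover have "hmul g H = ((x + p, y + q), z + w + r)"
    by (simp add: g_eq H hmul_def r_def)
  ultimately have "hmul g H \<in> core C" using xp yq by (simp only: core_def mem_Collect_eq fst_conv snd_conv)
  moreover have "hmul (hmul (hmul (hmul g (h 0)) (h 1)) (h 2)) (h 3) = hmul g H"
    by (simp only: hmul_assoc H_def)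
  ultimately show ?thesis by simp
qed


section \<open>Positive probability of a single prescribed step\<close>

lemma (in prob_space) normal_interval_pos:
  assumes "distributed M lborel X (normal_density 0 \<sigma>)" "0 < \<sigma>"
  shows "0 < prob {w \<in> space M. \<bar>X w - x\<bar> \<le> 1}"
proof -
  have X [measurable]: "X \<in> borel_measurable M" using assms(1) by (auto simp: distributed_def)
  have D: "distr M lborel X = density lborel (normal_density 0 \<sigma>)" using assms(1) by (simp add: distributed_def)
  have eq: "{w \<in> space M. \<bar>X w - x\<bar> \<le> 1} = X -` {x - 1..x + 1} \<inter> space M" by auto
  have "{x - 1..x + 1} \<notin> null_sets (density lborel (normal_density 0 \<sigma>))"
  proof
    assume "{x - 1..x + 1} \<in> null_sets (density lborel (normal_density 0 \<sigma>))"
    then have "AE y in lborel. y \<in> {x - 1..x + 1} \<longrightarrow> ennreal (normal_density 0 \<sigma> y) = 0"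
      by (subst (asm) null_sets_density_iff) auto
    then have "AE y in lborel. y \<notin> {x - 1..x + 1}"
    proof eventually_elim
      case (elim y)
      then show ?case using normal_density_pos[OF assms(2), of 0 y] by (auto simp: ennreal_eq_0_iff)
    qed
    then have "{x - 1..x + 1} \<in> null_sets lborel"
      by (subst (asm) AE_iff_null_sets[symmetric]) auto
    then show False by (simp add: null_sets_def)
  qed
  moreover have "emeasure (density lborel (normal_density 0 \<sigma>)) {x - 1..x + 1} = emeasure M (X -` {x - 1..x + 1} \<inter> space M)"
    unfolding D[symmetric] by (rule emeasure_distr) auto
  ultimately have "emeasure M (X -` {x - 1..x + 1} \<inter> space M) \<noteq> 0" by (auto simp: null_sets_def)
  then show ?thesis unfolding eq by (simp add: emeasure_eq_measure zero_less_measure_iff)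
qed

lemma (in planar_bm) box_prob_pos:
  "0 < prob {w \<in> space M. \<bar>W True 1 w - x\<bar> \<le> 1 \<and> \<bar>W False 1 w - y\<bar> \<le> 1}"
proof -
  define X where "X = (\<lambda>(b, i). grid_inc 1 b i)"
  define S where "S k = {z :: real. \<bar>z - (if fst k then x else y)\<bar> \<le> 1}" for k :: "bool \<times> nat"
  let ?J = "{(True, 0), (False, 0)} :: (bool \<times> nat) set"
  have S: "S k \<in> sets borel" for k unfolding S_def by measurable
  have "indep_vars (\<lambda>_. borel) X ?J"
    unfolding X_def by (rule indep_vars_subset[OF grid_inc_indep[of 1 1]]) auto
  then have "prob (\<Inter>k\<in>?J. X k -` S k \<inter> space M) = (\<Prod>k\<in>?J. prob (X k -` S k \<inter> space M))"
    by (rule indep_varsD) (auto simp: S)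
  also have "(\<Inter>k\<in>?J. X k -` S k \<inter> space M) =
      {w \<in> space M. \<bar>W True 1 w - x\<bar> \<le> 1 \<and> \<bar>W False 1 w - y\<bar> \<le> 1}"
  proof -
    have "(\<Inter>k\<in>?J. X k -` S k \<inter> space M) = {w \<in> space M. X (True, 0) w \<in> S (True, 0) \<and> X (False, 0) w \<in> S (False, 0)}"
      by auto
    also have "\<dots> = {w \<in> space M. \<bar>W True 1 w - x\<bar> \<le> 1 \<and> \<bar>W False 1 w - y\<bar> \<le> 1}"
    proof (rule Collect_cong, rule conj_cong[OF refl])
      fix w assume "w \<in> space M"
      then show "(X (True, 0) w \<in> S (True, 0) \<and> X (False, 0) w \<in> S (False, 0)) =
          (\<bar>W True 1 w - x\<bar> \<le> 1 \<and> \<bar>W False 1 w - y\<bar> \<le> 1)"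
        by (simp add: X_def S_def grid_inc_def W_zero)
    qed
    finally show ?thesis .
  qed
  finally have eq: "prob {w \<in> space M. \<bar>W True 1 w - x\<bar> \<le> 1 \<and> \<bar>W False 1 w - y\<bar> \<le> 1} =
      (\<Prod>k\<in>?J. prob (X k -` S k \<inter> space M))" .
  have "0 < prob (X k -` S k \<inter> space M)" for k
  proof -
    have "0 < prob {w \<in> space M. \<bar>grid_inc 1 (fst k) (snd k) w - (if fst k then x else y)\<bar> \<le> 1}"
      by (rule normal_interval_pos[OF grid_inc_distributed]) auto
    also have "{w \<in> space M. \<bar>grid_inc 1 (fst k) (snd k) w - (if fst k then x else y)\<bar> \<le> 1} = X k -` S k \<inter> space M"
      by (auto simp: X_def S_def split: prod.splits)
    finally show ?thesis .
  qed
  then show ?thesis unfolding eq by (intro prod_pos) auto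
qed

context heis_bm
begin

lemma A_zero_AE: "AE w in M. A 0 w = 0"
  using A_limit
proof eventually_elim
  case (elim w)
  then have "(\<lambda>n. dyadic_area n (\<lambda>b u. W b u w) 0) \<longlonglongrightarrow> A 0 w" by simp
  moreover have "dyadic_area n (\<lambda>b u. W b u w) 0 = 0" for n by (simp add: dyadic_area_def grid_area_def)
  ultimately show ?case by (simp add: LIMSEQ_const_iff)
qed

text \<open>Every path is bounded on the compact unit interval, so the confinement events with
  integer radius increase to the whole space.\<close>

lemma norm_g_bounded_prob:
  assumes "0 < e"
  shows "\<exists>C0. \<forall>C\<ge>C0. 1 - e < prob {w \<in> space M. \<forall>t\<in>{0..1}. heis_norm (g t w) \<le> C}"
proof -
  define E where "E C = {w \<in> space M. \<forall>t\<in>{0..1}. heis_norm (g t w) \<le> C}" for C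
  have EM: "E C \<in> sets M" for C
    unfolding E_def by (rule norm_g_le_event) (auto intro: g_measurable dyads_nonneg)
  have "(\<Union>n::nat. E (real n)) = space M"
  proof (safe)
    fix w assume w: "w \<in> space M"
    have "compact ((\<lambda>t. heis_norm (g t w)) ` {0..1})"
      by (intro compact_continuous_image continuous_on_subset[OF norm_g_continuous[OF w]]) auto
    then obtain B where B: "\<And>t. t \<in> {0..1} \<Longrightarrow> heis_norm (g t w) \<le> B"
      using bounded_imp_bdd_above[OF compact_imp_bounded] unfolding bdd_above_def by (metis imageI)
    obtain n :: nat where "B \<le> real n" using real_arch_simple by blast
    then have "heis_norm (g t w) \<le> real n" if "t \<in> {0..1}" for t using B[OF that] by linarith
    then have "w \<in> E (real n)" using w by (simp add: E_def)
    then show "w \<in> (\<Union>n::nat. E (real n))" by blast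
  qed (auto simp: E_def)
  moreover have "(\<lambda>n::nat. prob (E (real n))) \<longlonglongrightarrow> prob (\<Union>n::nat. E (real n))"
    using EM by (intro finite_Lim_measure_incseq) (auto simp: incseq_def E_def intro: order_trans)
  ultimately have "(\<lambda>n::nat. prob (E (real n))) \<longlonglongrightarrow> 1" by (simp add: prob_space)
  then have "eventually (\<lambda>n. 1 - e < prob (E (real n))) sequentially"
    using assms by (intro order_tendstoD(1)) auto
  then obtain n where n: "1 - e < prob (E (real n))" by (auto dest: eventually_happens)
  have "prob (E (real n)) \<le> prob (E C)" if "real n \<le> C" for C
    using that EM by (intro finite_measure_mono) (auto simp: E_def intro: order_trans)
  then show ?thesis using n unfolding E_def by (intro exI[of _ "real n"]) (auto intro: less_le_trans)
qed

text \<open>Reflecting one coordinate flips the sign of the area but preserves boxes centred on the other axis.\<close>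

lemma move_prob_reflect:
  assumes "x = 0 \<or> y = 0"
  shows "prob (move_event (move_set (x, y, \<sigma>)) C) = prob (move_event (move_set (x, y, - \<sigma>)) C)"
proof -
  define c :: "bool \<Rightarrow> real" where "c b = (if b then (if x = 0 then -1 else 1) else (if x = 0 then 1 else -1))" for b
  have c: "c True * x = x" "c False * y = y" "c True * c False = -1" "\<bar>c b\<bar> = 1" "(c b)\<^sup>2 = 1" for b
    using assms by (auto simp: c_def)
  let ?W = "bm_transform c 0 1 W" and ?A = "area_transform c 0 1 W A"
  interpret T: heis_bm M ?W ?A using heis_bm_transform[of 0 c 0] by (simp add: c)
  have "prob (move_event (move_set (x, y, \<sigma>)) C) = prob (T.move_event (move_set (x, y, \<sigma>)) C)"
    by (rule move_event_law[OF heis_bm_axioms T.heis_bm_axioms move_set_borel])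
  also have "\<dots> = prob (move_event (move_set (x, y, - \<sigma>)) C)"
  proof (rule finite_measure_eq_AE)
    show "T.move_event (move_set (x, y, \<sigma>)) C \<in> sets M"
      by (rule T.move_event_in_sets[OF refl T.g_measurable move_set_borel]) (rule dyads_nonneg)
    show "move_event (move_set (x, y, - \<sigma>)) C \<in> sets M"
      by (rule move_event_in_sets[OF refl g_measurable move_set_borel]) (rule dyads_nonneg)
    show "AE w in M. (w \<in> T.move_event (move_set (x, y, \<sigma>)) C) = (w \<in> move_event (move_set (x, y, - \<sigma>)) C)"
      using A_zero_AE
    proof (rule AE_mp, intro AE_I2 impI)
      fix w assume w: "w \<in> space M" and A0: "A 0 w = 0"
      have W0: "W b 0 w = 0" for b by (rule W_zero[OF w])
      have T_g: "T.g t w = ((c True * W True t w, c False * W False t w), c True * c False * A t w)" for t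
        by (simp add: hyp_BM_def bm_transform_def area_transform_def W0 A0)
      have norm: "heis_norm (T.g t w) = heis_norm (g t w)" for t
        unfolding T_g by (subst heis_norm_scale) (simp_all add: c hyp_BM_def)
      have "\<bar>c True * u - x\<bar> = \<bar>u - x\<bar>" "\<bar>c False * u - y\<bar> = \<bar>u - y\<bar>" for u
        using abs_mult[of "c True" "u - x"] abs_mult[of "c False" "u - y"] by (simp_all add: right_diff_distrib c)
      then have "T.g 1 w \<in> move_set (x, y, \<sigma>) \<longleftrightarrow> g 1 w \<in> move_set (x, y, - \<sigma>)"
        unfolding T_g by (simp add: move_set_def hyp_BM_def c)
      then show "(w \<in> T.move_event (move_set (x, y, \<sigma>)) C) = (w \<in> move_event (move_set (x, y, - \<sigma>)) C)"
        using norm by (simp add: T.move_event_def move_event_def)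
    qed
  qed
  finally show ?thesis .
qed

text \<open>Confinement loses less than half of the probability of the box, and what remains is
  covered by the two sign events, equally likely by reflection. This gives a quarter of
  \<open>prob B\<close>, a bound that does not depend on \<open>C\<close>.\<close>

lemma move_prob_pos:
  assumes "x = 0 \<or> y = 0"
  shows "\<exists>C0 p. 0 < p \<and> (\<forall>C\<ge>C0. p \<le> prob (move_event (move_set (x, y, \<sigma>)) C))"
proof -
  define B where "B = {w \<in> space M. \<bar>W True 1 w - x\<bar> \<le> 1 \<and> \<bar>W False 1 w - y\<bar> \<le> 1}"
  have [measurable]: "W b 1 \<in> borel_measurable M" for b by (rule W_measurable) simp
  have BM: "B \<in> sets M" unfolding B_def by measurable
  have B: "0 < prob B" unfolding B_def by (rule box_prob_pos)
  define E where "E C = {w \<in> space M. \<forall>t\<in>{0..1}. heis_norm (g t w) \<le> C}" for C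
  have EM: "E C \<in> sets M" for C
    unfolding E_def by (rule norm_g_le_event) (auto intro: g_measurable dyads_nonneg)
  obtain C0 where C0: "\<And>C. C \<ge> C0 \<Longrightarrow> 1 - prob B / 2 < prob (E C)"
    using norm_g_bounded_prob[of "prob B / 2"] B unfolding E_def by auto
  have "prob B / 4 \<le> prob (move_event (move_set (x, y, \<sigma>)) C)" if "C \<ge> C0" for C
  proof -
    have mvM: "move_event (move_set m) C \<in> sets M" for m
      by (rule move_event_in_sets[OF refl g_measurable move_set_borel]) (rule dyads_nonneg)
    have "prob B \<le> prob (B \<inter> E C) + prob (space M - E C)"
      using BM EM sets.sets_into_space[OF BM] by (intro order_trans[OF finite_measure_mono measure_Un_le]) auto
    moreover have "prob (space M - E C) < prob B / 2" using C0[OF that] by (simp add: prob_compl[OF EM])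
    moreover have "prob (B \<inter> E C) \<le> prob (move_event (move_set (x, y, \<sigma>)) C \<union> move_event (move_set (x, y, - \<sigma>)) C)"
    proof (rule finite_measure_mono)
      show "B \<inter> E C \<subseteq> move_event (move_set (x, y, \<sigma>)) C \<union> move_event (move_set (x, y, - \<sigma>)) C"
      proof
        fix w assume w: "w \<in> B \<inter> E C"
        have "0 \<le> \<sigma> * A 1 w \<or> 0 \<le> - \<sigma> * A 1 w" by simp linarith
        then have "g 1 w \<in> move_set (x, y, \<sigma>) \<or> g 1 w \<in> move_set (x, y, - \<sigma>)"
          using w unfolding B_def move_set_def hyp_BM_def by fastforce
        then show "w \<in> move_event (move_set (x, y, \<sigma>)) C \<union> move_event (move_set (x, y, - \<sigma>)) C"
          using w unfolding E_def move_event_def by blast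
      qed
    qed (use mvM in blast)
    moreover have "\<dots> \<le> prob (move_event (move_set (x, y, \<sigma>)) C) + prob (move_event (move_set (x, y, - \<sigma>)) C)"
      using mvM by (intro measure_Un_le)
    ultimately show ?thesis using move_prob_reflect[OF assms, of \<sigma> C] by linarith
  qed
  then show ?thesis using B by (intro exI[of _ C0] exI[of _ "prob B / 4"]) auto
qed

lemma finite_moves_prob_pos:
  assumes "finite T" "\<And>x y \<sigma>. (x, y, \<sigma>) \<in> T \<Longrightarrow> x = 0 \<or> y = 0"
  shows "\<exists>C0 p. 0 < p \<and> (\<forall>C\<ge>C0. \<forall>m\<in>T. p \<le> prob (move_event (move_set m) C))"
  using assms
proof (induction T rule: finite_induct)
  case empty
  show ?case by (auto intro: exI[of _ 1])
next
  case (insert m T)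
  obtain C1 p1 where 1: "0 < p1" "\<And>C. C \<ge> C1 \<Longrightarrow> p1 \<le> prob (move_event (move_set m) C)"
  proof -
    obtain x y \<sigma> where m: "m = (x, y, \<sigma>)" by (metis surj_pair)
    have "x = 0 \<or> y = 0" using insert.prems[of x y \<sigma>] m by simp
    from move_prob_pos[OF this, of \<sigma>] show ?thesis using that m by blast
  qed
  obtain C2 p2 where 2: "0 < p2" "\<And>C m. C \<ge> C2 \<Longrightarrow> m \<in> T \<Longrightarrow> p2 \<le> prob (move_event (move_set m) C)"
  proof -
    have "\<exists>C0 p. 0 < p \<and> (\<forall>C\<ge>C0. \<forall>m\<in>T. p \<le> prob (move_event (move_set m) C))"
      by (rule insert.IH) (use insert.prems in blast)
    then show ?thesis using that by blast
  qed
  show ?case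
    by (rule exI[of _ "max C1 C2"], rule exI[of _ "min p1 p2"]) (use 1 2 in \<open>auto simp: min_le_iff_disj\<close>)
qed

end

section \<open>Concatenation of steps and blocks\<close>

definition sgn_triple :: "(real \<times> real) \<times> real \<Rightarrow> real \<times> real \<times> real" where
  "sgn_triple h = (sgn_opp (fst (fst h)), sgn_opp (snd (fst h)), sgn_opp (snd h))"

lemma sgn_opp_measurable [measurable]: "sgn_opp \<in> borel_measurable borel"
  unfolding sgn_opp_def by measurable

lemma sgn_triple_measurable: "sgn_triple \<in> borel_measurable borel"
proof -
  have "(\<lambda>h::(real \<times> real) \<times> real. fst (fst h)) \<in> borel_measurable borel"
    "(\<lambda>h::(real \<times> real) \<times> real. snd (fst h)) \<in> borel_measurable borel"
    "(\<lambda>h::(real \<times> real) \<times> real. snd h) \<in> borel_measurable borel"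
    by (intro borel_measurable_continuous_onI continuous_intros)+
  then show ?thesis unfolding sgn_triple_def
    by (intro borel_measurable_Pair measurable_compose[OF _ sgn_opp_measurable])
qed

definition signs :: "(real \<times> real \<times> real) set" where
  "signs = {-1, 1} \<times> {-1, 1} \<times> {-1, 1}"

lemma sgn_triple_signs: "sgn_triple h \<in> signs"
  by (simp add: sgn_triple_def signs_def sgn_opp_def)

context heis_bm
begin

lemma heis_bm_shift: "s \<in> dyads \<Longrightarrow> heis_bm M (bm_shift s W) (area_shift s W A)"
  using heis_bm_transform[of s "\<lambda>_. 1" 0] by simp

definition shift_move :: "real \<Rightarrow> real \<Rightarrow> real \<times> real \<times> real \<Rightarrow> 'a set" where
  "shift_move C s m = heis_bm.move_event M (bm_shift s W) (area_shift s W A) (move_set m) C"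

lemma shift_move_iff:
  assumes "s \<in> dyads"
  shows "w \<in> shift_move C s m \<longleftrightarrow> w \<in> space M \<and>
    shift_path s W A 1 w \<in> move_set m \<and>
    (\<forall>t\<in>{0..1}. heis_norm (shift_path s W A t w) \<le> C)"
proof -
  interpret S: heis_bm M "bm_shift s W" "area_shift s W A" by (rule heis_bm_shift[OF assms])
  show ?thesis by (simp add: shift_move_def S.move_event_def)
qed

text \<open>Markov property for one step: the event belongs to the future of \<open>s\<close>, is
  decided by time \<open>s + 1\<close>, and has the law of a step started at time 0.\<close>

lemma shift_move_step:
  assumes s: "s \<in> dyads" and a: "a \<in> sets (bm_sigma M W {..s})"
  shows "a \<inter> shift_move C s m \<in> sets (bm_sigma M W {..s + 1})"
    "prob (a \<inter> shift_move C s m) = prob a * prob (move_event (move_set m) C)"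
proof -
  interpret S: heis_bm M "bm_shift s W" "area_shift s W A" by (rule heis_bm_shift[OF s])
  have mv: "shift_move C s m \<in> sets (bm_sigma M (bm_shift s W) {..1})"
    unfolding shift_move_def
    by (rule S.move_event_in_sets[OF _ S.g_bm_sigma move_set_borel]) auto
  then have "shift_move C s m \<in> sets (bm_sigma M W {..s + 1})"
    using shift_bm_sigma[OF s, of 1] by blast
  moreover have "a \<in> sets (bm_sigma M W {..s + 1})"
    using a bm_sigma_mono[of "{..s}" "{..s + 1}"] by auto
  ultimately show "a \<inter> shift_move C s m \<in> sets (bm_sigma M W {..s + 1})" by (rule sets.Int[rotated])
  have "shift_move C s m \<in> sets (bm_sigma M (bm_shift s W) UNIV)"
    using mv bm_sigma_mono[of "{..1}" UNIV] by auto
  then have "prob (a \<inter> shift_move C s m) = prob a * prob (shift_move C s m)"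
    by (rule past_future_indep[OF s a])
  also have "prob (shift_move C s m) = prob (move_event (move_set m) C)"
    unfolding shift_move_def by (rule move_event_law[OF S.heis_bm_axioms heis_bm_axioms move_set_borel])
  finally show "prob (a \<inter> shift_move C s m) = prob a * prob (move_event (move_set m) C)" .
qed

text \<open>The sequence \<open>m\<close> of moves is deterministic here. Its dependence on the
  current position is dealt with later by splitting according to the sign pattern.\<close>

lemma moves_step:
  assumes s: "s \<in> dyads" and a: "a \<in> sets (bm_sigma M W {..s})" and p: "0 \<le> p"
    and m: "\<And>i. i < n \<Longrightarrow> p \<le> prob (move_event (move_set (m i)) C)"
  shows "a \<inter> {w. \<forall>i<n. w \<in> shift_move C (s + real i) (m i)} \<in> sets (bm_sigma M W {..s + real n})"
    "p ^ n * prob a \<le> prob (a \<inter> {w. \<forall>i<n. w \<in> shift_move C (s + real i) (m i)})"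
proof -
  have "a \<inter> {w. \<forall>i<n. w \<in> shift_move C (s + real i) (m i)} \<in> sets (bm_sigma M W {..s + real n}) \<and>
    p ^ n * prob a \<le> prob (a \<inter> {w. \<forall>i<n. w \<in> shift_move C (s + real i) (m i)})"
    using m
  proof (induction n)
    case 0
    show ?case using a by simp
  next
    case (Suc n)
    let ?B = "a \<inter> {w. \<forall>i<n. w \<in> shift_move C (s + real i) (m i)}"
    have B: "?B \<in> sets (bm_sigma M W {..s + real n})" "p ^ n * prob a \<le> prob ?B"
      using Suc by auto
    have eq: "a \<inter> {w. \<forall>i<Suc n. w \<in> shift_move C (s + real i) (m i)} = ?B \<inter> shift_move C (s + real n) (m n)"
      by (auto simp: less_Suc_eq)
    have sn: "s + real n \<in> dyads" using s by auto
    have "p ^ Suc n * prob a = (p ^ n * prob a) * p" by simp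
    also have "\<dots> \<le> prob ?B * prob (move_event (move_set (m n)) C)"
      using B(2) Suc.prems p by (intro mult_mono) auto
    also have "\<dots> = prob (?B \<inter> shift_move C (s + real n) (m n))"
      by (rule shift_move_step(2)[OF sn B(1), symmetric])
    finally show ?case
      unfolding eq using shift_move_step(1)[OF sn B(1)] by (simp add: add.assoc add.commute[of 1])
  qed
  then show "a \<inter> {w. \<forall>i<n. w \<in> shift_move C (s + real i) (m i)} \<in> sets (bm_sigma M W {..s + real n})"
    "p ^ n * prob a \<le> prob (a \<inter> {w. \<forall>i<n. w \<in> shift_move C (s + real i) (m i)})" by auto
qed

lemma block_path_bound:
  assumes s: "s \<in> dyads" and core: "g s w \<in> core C"
    and mv: "\<And>i. i < 4 \<Longrightarrow> w \<in> shift_move C (s + real i) (block_moves (sgn_triple (g s w)) i)"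
  shows "g (s + 4) w \<in> core C"
    "\<And>t. s \<le> t \<Longrightarrow> t \<le> s + 4 \<Longrightarrow> heis_norm (g t w) \<le> 16 + sqrt (16 * C\<^sup>2 + 64) + 4 * C"
proof -
  define h where "h i = shift_path (s + real i) W A 1 w" for i
  have D: "s + real i \<in> dyads" for i using s by auto
  have mvh: "h i \<in> move_set (block_moves (sgn_triple (g s w)) i)" if "i < 4" for i
    using mv[OF that] unfolding shift_move_iff[OF D] h_def by blast
  have bd: "heis_norm (shift_path (s + real i) W A t w) \<le> C"
    if "i < 4" "0 \<le> t" "t \<le> 1" for i t
    using mv[OF that(1)] that(2,3) unfolding shift_move_iff[OF D] by auto
  have hC: "heis_norm (h i) \<le> C" if "i < 4" for i unfolding h_def by (rule bd[OF that]) auto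
  have C: "0 \<le> C" using hC[of 0] heis_norm_nonneg[of "h 0"] by linarith
  have step: "g (s + real (Suc i)) w = hmul (g (s + real i) w) (h i)" for i
    using heis_path_shift[of W A "s + real i" 1 w] by (simp add: h_def add.assoc add.commute[of 1])
  have "g (s + 4) w = hmul (hmul (hmul (hmul (g s w) (h 0)) (h 1)) (h 2)) (h 3)"
    using step[of 0] step[of 1] step[of 2] step[of 3] by simp
  also have "\<dots> \<in> core C"
    by (rule block_stays_in_core[OF core refl]) (use mvh hC in \<open>auto simp: sgn_triple_def\<close>)
  finally show "g (s + 4) w \<in> core C" .
  let ?R = "16 + sqrt (16 * C\<^sup>2 + 64)"
  have N: "heis_norm (g (s + real i) w) \<le> ?R + real i * C" if "i \<le> 4" for i
    using that
  proof (induction i)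
    case 0
    show ?case using core_norm[OF core] by simp
  next
    case (Suc i)
    have "heis_norm (g (s + real (Suc i)) w) \<le> heis_norm (g (s + real i) w) + heis_norm (h i)"
      unfolding step by (rule heis_norm_hmul_le)
    also have "\<dots> \<le> (?R + real i * C) + C" using Suc hC[of i] by (intro add_mono) auto
    finally show ?case by (simp add: algebra_simps)
  qed
  fix t assume t: "s \<le> t" "t \<le> s + 4"
  \<comment> \<open>At \<open>t = s + 4\<close> the integer part would be 4, so the final instant is
    assigned to the last step, \<open>i = 3\<close>.\<close>
  obtain i where i: "i < 4" "s + real i \<le> t" "t \<le> s + real i + 1"
  proof (cases "t = s + 4")
    case True
    then show ?thesis using that[of 3] by simp
  next
    case False
    define i where "i = nat \<lfloor>t - s\<rfloor>"
    have "real i \<le> t - s" "t - s < real i + 1" using t unfolding i_def by linarith+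
    moreover from this have "i < 4" using t False by linarith
    ultimately show ?thesis using that[of i] by linarith
  qed
  have "g t w = hmul (g (s + real i) w)
      (shift_path (s + real i) W A (t - (s + real i)) w)"
    using heis_path_shift[of W A "s + real i" "t - (s + real i)" w] by simp
  then have "heis_norm (g t w) \<le> heis_norm (g (s + real i) w) +
      heis_norm (shift_path (s + real i) W A (t - (s + real i)) w)"
    using heis_norm_hmul_le by metis
  also have "\<dots> \<le> (?R + real i * C) + C"
    using i N[of i] bd[of i "t - (s + real i)"] by (intro add_mono) auto
  also have "\<dots> \<le> ?R + 4 * C"
  proof -
    have "(real i + 1) * C \<le> 4 * C" using i C by (intro mult_right_mono) auto
    then show ?thesis by (simp add: algebra_simps)
  qed
  finally show "heis_norm (g t w) \<le> ?R + 4 * C" .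
qed

text \<open>Confinement alone would not allow a restart, so \<open>E k\<close> also records that the
  path is in the core at time \<open>4 * k\<close>. On each sign pattern at that time the next four
  moves are fixed, at a cost of at most a factor \<open>p ^ 4\<close>.\<close>

lemma small_ball_induction:
  assumes p: "0 \<le> p" and C: "0 \<le> C"
    and m: "\<And>\<sigma> i. \<sigma> \<in> signs \<Longrightarrow> i < 4 \<Longrightarrow> p \<le> prob (move_event (move_set (block_moves \<sigma> i)) C)"
  defines "E \<equiv> (\<lambda>k. {w \<in> space M. \<forall>t\<in>{0..4 * real k}. heis_norm (g t w) \<le> 16 + sqrt (16 * C\<^sup>2 + 64) + 4 * C} \<inter>
      (g (4 * real k) -` core C \<inter> space M))"
  shows "(p ^ 4) ^ k \<le> prob (E k)"
proof (induction k)
  case 0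
  \<comment> \<open>The area is specified only almost surely at each fixed time, so the path starts
    at the identity only almost surely.\<close>
  have "AE w in M. w \<in> E 0"
    using A_zero_AE
  proof (rule AE_mp, intro AE_I2 impI)
    fix w assume w: "w \<in> space M" and "A 0 w = 0"
    then have "g 0 w = ((0, 0), 0)" by (simp add: hyp_BM_def W_zero)
    then show "w \<in> E 0" using w C by (auto simp: E_def core_def heis_norm_def)
  qed
  moreover have "E 0 \<in> sets M"
    unfolding E_def
    by (intro sets.Int measurable_sets[OF g_measurable core_borel] norm_g_le_event) (auto intro: g_measurable dyads_nonneg)
  ultimately have "prob (E 0) = 1" using prob_eq_1[of "E 0"] by blast
  then show ?case by simp
next
  case (Suc k)
  define s where "s = 4 * real k"
  have s: "s \<in> dyads" using of_nat_dyads[of "4 * k"] by (simp add: s_def)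
  have EM: "E j \<in> sets (bm_sigma M W {..4 * real j})" for j
  proof -
    have d: "4 * real j \<in> dyads" using of_nat_dyads[of "4 * j"] by simp
    have "g (4 * real j) -` core C \<inter> space (bm_sigma M W {..4 * real j}) \<in> sets (bm_sigma M W {..4 * real j})"
      using d by (intro measurable_sets[OF g_bm_sigma core_borel]) auto
    moreover have "{w \<in> space M. \<forall>t\<in>{0..4 * real j}. heis_norm (g t w) \<le> 16 + sqrt (16 * C\<^sup>2 + 64) + 4 * C}
        \<in> sets (bm_sigma M W {..4 * real j})"
      by (rule norm_g_le_event) (auto intro!: g_bm_sigma)
    ultimately show ?thesis unfolding E_def space_bm_sigma by (rule sets.Int[rotated])
  qed
  \<comment> \<open>Partition of \<open>E k\<close> by sign pattern at time \<open>s\<close>;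
    \<open>b\<close> adds the four moves prescribed by that pattern.\<close>
  define a where "a \<sigma> = E k \<inter> (g s -` (sgn_triple -` {\<sigma>} \<inter> space borel) \<inter> space M)" for \<sigma>
  define b where "b \<sigma> = a \<sigma> \<inter> {w. \<forall>i<4. w \<in> shift_move C (s + real i) (block_moves \<sigma> i)}" for \<sigma>
  have aM: "a \<sigma> \<in> sets (bm_sigma M W {..s})" for \<sigma>
  proof -
    have "g s -` (sgn_triple -` {\<sigma>} \<inter> space borel) \<inter> space (bm_sigma M W {..s}) \<in> sets (bm_sigma M W {..s})"
      using s by (intro measurable_sets[OF g_bm_sigma] measurable_sets[OF sgn_triple_measurable]) auto
    then show ?thesis unfolding a_def using EM[of k] by (simp add: s_def sets.Int)
  qed
  have b: "b \<sigma> \<in> sets (bm_sigma M W {..s + real 4})" "p ^ 4 * prob (a \<sigma>) \<le> prob (b \<sigma>)" if "\<sigma> \<in> signs" for \<sigma>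
    unfolding b_def by (rule moves_step[OF s aM p m[OF that]]; assumption)+
  have fin: "finite signs" by (simp add: signs_def)
  have disj: "disjoint_family_on a signs" by (auto simp: disjoint_family_on_def a_def)
  have disj': "disjoint_family_on b signs" using disj unfolding disjoint_family_on_def b_def by blast
  have Ek: "E k = (\<Union>\<sigma>\<in>signs. a \<sigma>)"
  proof (intro equalityI subsetI)
    fix w assume "w \<in> E k"
    moreover from this have "w \<in> space M" by (simp add: E_def)
    ultimately have "w \<in> a (sgn_triple (g s w))" by (simp add: a_def)
    then show "w \<in> (\<Union>\<sigma>\<in>signs. a \<sigma>)" using sgn_triple_signs by blast
  qed (auto simp: a_def)
  have "(p ^ 4) ^ Suc k \<le> p ^ 4 * prob (E k)" using Suc.IH p by (simp add: mult_left_mono)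
  also have "prob (E k) = (\<Sum>\<sigma>\<in>signs. prob (a \<sigma>))"
    unfolding Ek using aM bm_sigma_subset_M by (intro finite_measure_finite_Union fin disj) blast
  also have "p ^ 4 * \<dots> \<le> (\<Sum>\<sigma>\<in>signs. prob (b \<sigma>))"
    unfolding sum_distrib_left by (intro sum_mono b)
  also have "\<dots> = prob (\<Union>\<sigma>\<in>signs. b \<sigma>)"
    using b(1) bm_sigma_subset_M by (intro finite_measure_finite_Union[symmetric] fin disj') blast
  also have "\<dots> \<le> prob (E (Suc k))"
  proof (rule finite_measure_mono)
    show "E (Suc k) \<in> sets M" using EM bm_sigma_subset_M by blast
    show "(\<Union>\<sigma>\<in>signs. b \<sigma>) \<subseteq> E (Suc k)"
    proof
      fix w assume "w \<in> (\<Union>\<sigma>\<in>signs. b \<sigma>)"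
      then obtain \<sigma> where "w \<in> b \<sigma>" by blast
      then have w: "w \<in> E k" "sgn_triple (g s w) = \<sigma>" "\<And>i. i < 4 \<Longrightarrow> w \<in> shift_move C (s + real i) (block_moves \<sigma> i)"
        unfolding b_def a_def by auto
      have core: "g s w \<in> core C" "w \<in> space M" using w(1) by (auto simp: E_def s_def)
      have old: "heis_norm (g t w) \<le> 16 + sqrt (16 * C\<^sup>2 + 64) + 4 * C" if "0 \<le> t" "t \<le> s" for t
        using w(1) that by (auto simp: E_def s_def)
      note new = block_path_bound[OF s core(1) w(3)[folded w(2)]]
      have eq: "4 * real (Suc k) = s + 4" by (simp add: s_def)
      have "heis_norm (g t w) \<le> 16 + sqrt (16 * C\<^sup>2 + 64) + 4 * C" if "0 \<le> t" "t \<le> s + 4" for t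
        using old[of t] new(2)[of t] that by linarith
      then show "w \<in> E (Suc k)" using new(1) core(2) unfolding E_def eq by auto
    qed
  qed
  finally show ?case .
qed

end

text \<open>The constants do not depend on the process since its law does not.\<close>

lemma small_ball_lower_bound:
  assumes "heis_bm M W A"
  shows "\<exists>R q. 0 < R \<and> 0 < q \<and> q < 1 \<and> (\<forall>W' A' k. heis_bm M W' A' \<longrightarrow>
    q ^ k \<le> measure M {w \<in> space M. \<forall>t\<in>{0..4 * real k}. heis_norm (heis_path W' A' t w) \<le> R})"
proof -
  interpret heis_bm M W A by fact
  define T where "T = (\<lambda>(\<sigma>, i). block_moves \<sigma> i) ` (signs \<times> {..<4})"
  have "finite T" by (simp add: T_def signs_def)
  moreover have "x = 0 \<or> y = 0" if "(x, y, \<sigma>) \<in> T" for x y \<sigma>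
    using that by (auto simp: T_def block_moves_def less_Suc_eq numeral_eq_Suc)
  ultimately obtain C0 p where p: "0 < p" "\<And>C m. C \<ge> C0 \<Longrightarrow> m \<in> T \<Longrightarrow> p \<le> prob (move_event (move_set m) C)"
    using finite_moves_prob_pos[of T] by blast
  define C where "C = max 0 C0"
  \<comment> \<open>The cap 1/2 ensures \<open>q < 1\<close>, so that \<open>ln (1 / q)\<close> is
    positive where the number of blocks is chosen.\<close>
  define p' where "p' = min p (1/2)"
  define R where "R = 16 + sqrt (16 * C\<^sup>2 + 64) + 4 * C"
  have C: "0 \<le> C" "C0 \<le> C" by (auto simp: C_def)
  have p': "0 < p'" "p' \<le> p" "p' < 1" using p(1) by (auto simp: p'_def)
  have "(p' ^ 4) ^ k \<le> measure M {w \<in> space M. \<forall>t\<in>{0..4 * real k}. heis_norm (heis_path W' A' t w) \<le> R}"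
    if "heis_bm M W' A'" for W' A' k
  proof -
    interpret B: heis_bm M W' A' by fact
    have "p' \<le> prob (B.move_event (move_set (block_moves \<sigma> i)) C)" if "\<sigma> \<in> signs" "i < 4" for \<sigma> i
    proof -
      have "block_moves \<sigma> i \<in> T" using that unfolding T_def by force
      then have "p \<le> prob (move_event (move_set (block_moves \<sigma> i)) C)" using p(2) C by blast
      also have "\<dots> = prob (B.move_event (move_set (block_moves \<sigma> i)) C)"
        by (rule move_event_law[OF heis_bm_axioms B.heis_bm_axioms move_set_borel])
      finally show ?thesis using p'(2) by linarith
    qed
    then have "(p' ^ 4) ^ k \<le> prob ({w \<in> space M. \<forall>t\<in>{0..4 * real k}. heis_norm (B.g t w) \<le> R} \<inter>
        (B.g (4 * real k) -` core C \<inter> space M))"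
      unfolding R_def using p'(1) C(1) by (intro B.small_ball_induction) auto
    also have "\<dots> \<le> prob {w \<in> space M. \<forall>t\<in>{0..4 * real k}. heis_norm (B.g t w) \<le> R}"
      by (intro finite_measure_mono B.norm_g_le_event) (auto intro: B.g_measurable dyads_nonneg)
    finally show ?thesis .
  qed
  moreover have "0 < R" using C(1) by (simp add: R_def add_pos_nonneg)
  moreover have "0 < p' ^ 4" "p' ^ 4 < 1" using p' by (auto simp: power_less_one_iff)
  ultimately show ?thesis by blast
qed

section \<open>The running maximum and the zero-one law\<close>

context heis_bm
begin

abbreviation S :: "real \<Rightarrow> 'a \<Rightarrow> real" where
  "S t w \<equiv> running_max (W True) (W False) A t w"

lemma running_max_bdd:
  assumes "w \<in> space M"
  shows "bdd_above ((\<lambda>s. heis_norm (g s w)) ` {0..t})"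
  by (intro bounded_imp_bdd_above compact_imp_bounded compact_continuous_image
      continuous_on_subset[OF norm_g_continuous[OF assms]]) auto

lemma running_max_le_iff:
  assumes "w \<in> space M" "0 \<le> t"
  shows "S t w \<le> C \<longleftrightarrow> (\<forall>s\<in>{0..t}. heis_norm (g s w) \<le> C)"
  unfolding running_max_def using assms by (intro cSUP_le_iff running_max_bdd) auto

lemma norm_le_running_max:
  "w \<in> space M \<Longrightarrow> 0 \<le> s \<Longrightarrow> s \<le> t \<Longrightarrow> heis_norm (g s w) \<le> S t w"
  using running_max_le_iff[of w t "S t w"] by auto

lemma running_max_nonneg: "w \<in> space M \<Longrightarrow> 0 \<le> t \<Longrightarrow> 0 \<le> S t w"
  using norm_le_running_max[of w 0 t] heis_norm_nonneg[of "g 0 w"] by linarith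

lemma running_max_mono: "w \<in> space M \<Longrightarrow> 0 \<le> s \<Longrightarrow> s \<le> t \<Longrightarrow> S s w \<le> S t w"
  by (subst running_max_le_iff) (auto intro: norm_le_running_max)

lemma running_max_measurable:
  assumes t: "0 \<le> t" and N: "space N = space M" and g: "\<And>u. u \<in> dyads \<Longrightarrow> u \<le> t \<Longrightarrow> g u \<in> borel_measurable N"
  shows "S t \<in> borel_measurable N"
proof (rule borel_measurableI_le)
  fix C
  have "{w \<in> space N. S t w \<le> C} = {w \<in> space M. \<forall>s\<in>{0..t}. heis_norm (g s w) \<le> C}"
    unfolding N using running_max_le_iff[OF _ t] by blast
  then show "{w \<in> space N. S t w \<le> C} \<in> sets N" using norm_g_le_event[OF N g] by simp
qed

text \<open>Both directions are triangle inequalities for the product of the position at time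
  \<open>m\<close> with the shifted path; times before \<open>m\<close> are covered by
  \<open>S m w\<close> itself.\<close>

lemma running_max_shift:
  assumes m: "m \<in> dyads" and w: "w \<in> space M" and t: "0 \<le> t"
  defines "H \<equiv> running_max (bm_shift m W True) (bm_shift m W False) (area_shift m W A) t w"
  shows "\<bar>S (m + t) w - H\<bar> \<le> S m w"
proof -
  interpret T: heis_bm M "bm_shift m W" "area_shift m W A" by (rule heis_bm_shift[OF m])
  have m0: "0 \<le> m" by (rule dyads_nonneg[OF m])
  have "H \<le> S m w + S (m + t) w"
    unfolding H_def
  proof (subst T.running_max_le_iff[OF w t], safe)
    fix s assume s: "s \<in> {0..t}"
    have "heis_norm (T.g s w) \<le> heis_norm (g m w) + heis_norm (g (m + s) w)"
      unfolding heis_path_shift[of W A m s w] by (rule heis_norm_le_hmul)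
    also have "\<dots> \<le> S m w + S (m + t) w"
      using s m0 by (intro add_mono norm_le_running_max[OF w]) auto
    finally show "heis_norm (T.g s w) \<le> S m w + S (m + t) w" .
  qed
  moreover have "S (m + t) w \<le> S m w + H"
  proof (subst running_max_le_iff[OF w], safe)
    have H0: "0 \<le> H" unfolding H_def by (rule T.running_max_nonneg[OF w t])
    fix s assume s: "s \<in> {0..m + t}"
    show "heis_norm (g s w) \<le> S m w + H"
    proof (cases "s \<le> m")
      case True
      then show ?thesis using norm_le_running_max[OF w, of s m] s H0 by auto
    next
      case False
      have "heis_norm (g s w) \<le> heis_norm (g m w) + heis_norm (T.g (s - m) w)"
        using heis_norm_hmul_le[of "g m w" "T.g (s - m) w"] heis_path_shift[of W A m "s - m" w] by simp
      also have "\<dots> \<le> S m w + H"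
        unfolding H_def using False s m0 by (intro add_mono norm_le_running_max[OF w] T.norm_le_running_max[OF w]) auto
      finally show ?thesis .
    qed
  qed (use m0 t in simp)
  ultimately show ?thesis by linarith
qed

end

lemma chung_rate_nonneg: "exp 1 \<le> t \<Longrightarrow> 0 \<le> chung_rate t"
proof -
  assume t: "exp 1 \<le> t"
  then have "1 \<le> ln t" by (subst ln_ge_iff) (auto intro: less_le_trans[OF exp_gt_zero])
  moreover have "0 < t" using t by (auto intro: less_le_trans[OF exp_gt_zero])
  ultimately show ?thesis unfolding chung_rate_def by (intro real_sqrt_ge_zero divide_nonneg_pos) auto
qed

text \<open>Numerator and denominator of the rate both grow, so each is estimated at the
  unfavourable end of the interval; this avoids a discussion of monotonicity.\<close>

lemma chung_rate_ge:
  assumes "exp 1 \<le> s" "s \<le> t" "t \<le> u"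
  shows "sqrt (ln (ln s) / u) \<le> chung_rate t"
proof -
  have pos: "0 < s" using assms(1) by (auto intro: less_le_trans[OF exp_gt_zero])
  have "1 \<le> ln s" using assms(1) pos by (subst ln_ge_iff) auto
  moreover have "ln s \<le> ln t" using assms pos by (subst ln_le_cancel_iff) auto
  ultimately have "0 \<le> ln (ln s)" "ln (ln s) \<le> ln (ln t)" by auto
  then show ?thesis unfolding chung_rate_def
    using assms pos by (intro real_sqrt_le_mono frac_le) auto
qed

text \<open>Monotonicity of the running maximum reduces the limit inferior to integer times.\<close>

lemma Liminf_chung_eq_liminf:
  fixes G :: "real \<Rightarrow> real"
  assumes mono: "\<And>s t. 0 \<le> s \<Longrightarrow> s \<le> t \<Longrightarrow> G s \<le> G t" and nonneg: "\<And>t. 0 \<le> t \<Longrightarrow> 0 \<le> G t"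
  shows "Liminf at_top (\<lambda>t. ereal (chung_rate t * G t)) = liminf (\<lambda>k::nat. ereal (chung_rate (real k) * G (real k)))"
    (is "?L = ?l")
proof (rule antisym)
  show "?L \<le> ?l"
    unfolding le_Liminf_iff
  proof safe
    fix y assume "y < ?L"
    then have "eventually (\<lambda>t. y < ereal (chung_rate t * G t)) at_top"
      by (metis le_Liminf_iff order_refl)
    then show "eventually (\<lambda>k::nat. y < ereal (chung_rate (real k) * G (real k))) sequentially"
      by (rule eventually_compose_filterlim[OF _ filterlim_real_sequentially])
  qed
  show "?l \<le> ?L"
    unfolding le_Liminf_iff
  proof safe
    fix y assume y: "y < ?l"
    show "eventually (\<lambda>t. y < ereal (chung_rate t * G t)) at_top"
    proof (cases "y < 0")
      case True
      show ?thesis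
        using eventually_ge_at_top[of "exp 1"]
      proof eventually_elim
        case (elim t)
        have "0 \<le> t" using elim exp_ge_zero[of "1::real"] by linarith
        then have "0 \<le> chung_rate t * G t" using chung_rate_nonneg[OF elim] nonneg by simp
        then have "(0::ereal) \<le> ereal (chung_rate t * G t)" by simp
        then show ?case by (rule less_le_trans[OF True])
      qed
    next
      case False
      obtain z where z: "y < ereal z" "ereal z < ?l" using ereal_dense2[OF y] by blast
      obtain x where x: "y = ereal x" using False z(1) by (cases y) auto
      have xz: "0 \<le> x" "x < z" using False z(1) by (auto simp: x)
      have "eventually (\<lambda>k::nat. ereal z < ereal (chung_rate (real k) * G (real k))) sequentially"
        using z(2) by (metis le_Liminf_iff order_refl)
      \<comment> \<open>For t between k and k + 1 the maximum is at least its value at k, and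
        replacing the denominator by k + 1 costs only this factor, which tends to 1.\<close>
      moreover have "((\<lambda>k::nat. sqrt (real k / (real k + 1)) * z) \<longlongrightarrow> 1 * z) sequentially"
        by (intro tendsto_mult tendsto_const) real_asymp
      then have "eventually (\<lambda>k::nat. x < sqrt (real k / (real k + 1)) * z) sequentially"
        using xz(2) by (intro order_tendstoD(1)) auto
      moreover have "eventually (\<lambda>k::nat. exp 1 \<le> real k) sequentially" by real_asymp
      ultimately have "eventually (\<lambda>k::nat. x < sqrt (real k / (real k + 1)) * (chung_rate (real k) * G (real k)) \<and> exp 1 \<le> real k) sequentially"
      proof eventually_elim
        case (elim k)
        have "sqrt (real k / (real k + 1)) * z \<le> sqrt (real k / (real k + 1)) * (chung_rate (real k) * G (real k))"
          using elim(1) by (intro mult_left_mono) auto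
        then show ?case using elim by linarith
      qed
      then obtain K where K: "\<And>k. k \<ge> K \<Longrightarrow> x < sqrt (real k / (real k + 1)) * (chung_rate (real k) * G (real k))"
          "\<And>k. k \<ge> K \<Longrightarrow> exp 1 \<le> real k"
        unfolding eventually_sequentially by blast
      show ?thesis
        using eventually_ge_at_top[of "real K"]
      proof eventually_elim
        case (elim t)
        define k where "k = nat \<lfloor>t\<rfloor>"
        have t0: "0 \<le> t" using elim by (meson of_nat_0_le_iff order_trans)
        have k: "real k \<le> t" "t \<le> real k + 1" "K \<le> k" using elim t0 unfolding k_def by linarith+
        have e: "exp 1 \<le> real k" by (rule K(2)[OF k(3)])
        have k0: "0 < real k" by (rule less_le_trans[OF exp_gt_zero e])
        have "sqrt (real k / (real k + 1)) * chung_rate (real k) = sqrt (ln (ln (real k)) / (real k + 1))"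
          unfolding chung_rate_def real_sqrt_mult[symmetric] using k0 by simp
        also have "\<dots> \<le> chung_rate t" by (rule chung_rate_ge[OF e k(1,2)])
        finally have "sqrt (real k / (real k + 1)) * chung_rate (real k) * G (real k) \<le> chung_rate t * G t"
          using mono[of "real k" t] nonneg[of "real k"] k chung_rate_nonneg[of t] e
          by (intro mult_mono) auto
        then show ?case using K(1)[OF k(3)] by (simp add: x mult.assoc)
      qed
    qed
  qed
qed

lemma chung_rate_tendsto_0: "(\<lambda>k::nat. chung_rate (real (k + m))) \<longlonglongrightarrow> 0"
proof -
  have "(chung_rate \<longlongrightarrow> 0) at_top" unfolding chung_rate_def by real_asymp
  then have "(\<lambda>k::nat. chung_rate (real k)) \<longlonglongrightarrow> 0" by (rule filterlim_compose[OF _ filterlim_real_sequentially])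
  then show ?thesis by (rule LIMSEQ_ignore_initial_segment)
qed

section \<open>The limit inferior along integer times is almost surely constant\<close>

context heis_bm
begin

definition L :: "'a \<Rightarrow> ereal" where
  "L w = liminf (\<lambda>k::nat. ereal (chung_rate (real k) * S (real k) w))"

text \<open>The two running maxima differ by at most \<open>S m w\<close>, which is fixed while the
  rate tends to 0. The index shift stays in the argument of the rate, so the right-hand side depends
  on the shifted process only.\<close>

lemma L_eq_shift:
  assumes w: "w \<in> space M"
  shows "L w = liminf (\<lambda>k::nat. ereal (chung_rate (real (k + m)) *
     running_max (bm_shift (real m) W True) (bm_shift (real m) W False) (area_shift (real m) W A) (real k) w))"
    (is "_ = liminf (\<lambda>k. ereal (?c k * ?H k))")
proof -
  have "(\<lambda>k. ?c k * (S (real (k + m)) w - ?H k)) \<longlonglongrightarrow> 0"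
  proof (rule Lim_null_comparison)
    show "eventually (\<lambda>k. norm (?c k * (S (real (k + m)) w - ?H k)) \<le> \<bar>?c k\<bar> * S (real m) w) sequentially"
      using running_max_shift[OF of_nat_dyads w, of _ m]
      by (intro always_eventually allI) (auto simp: abs_mult add.commute intro!: mult_left_mono)
    show "(\<lambda>k. \<bar>?c k\<bar> * S (real m) w) \<longlonglongrightarrow> 0"
      using tendsto_mult_left_zero[OF tendsto_rabs_zero[OF chung_rate_tendsto_0[of m]]] .
  qed
  then have lim: "(\<lambda>k. ereal (?c k * (S (real (k + m)) w - ?H k))) \<longlonglongrightarrow> ereal 0" by simp
  have "L w = liminf (\<lambda>k. ereal (?c k * S (real (k + m)) w))"
    unfolding L_def by (rule liminf_shift_k[symmetric])
  also have "\<dots> = liminf (\<lambda>k. ereal (?c k * (S (real (k + m)) w - ?H k)) + ereal (?c k * ?H k))"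
    by (simp add: algebra_simps)
  also have "\<dots> = ereal 0 + liminf (\<lambda>k. ereal (?c k * ?H k))"
    by (rule ereal_liminf_lim_add[OF lim]) simp
  finally show ?thesis by simp
qed

lemma L_event_shift: "{w \<in> space M. L w \<le> x} \<in> sets (bm_sigma M (bm_shift (real m) W) UNIV)"
proof -
  interpret T: heis_bm M "bm_shift (real m) W" "area_shift (real m) W A" by (rule heis_bm_shift) simp
  have "T.S (real k) \<in> borel_measurable (bm_sigma M (bm_shift (real m) W) UNIV)" for k
    by (rule T.running_max_measurable) (auto intro: T.g_bm_sigma)
  then have [measurable]: "(\<lambda>w. ereal (chung_rate (real (k + m)) * T.S (real k) w)) \<in>
      borel_measurable (bm_sigma M (bm_shift (real m) W) UNIV)" for k
    by (intro borel_measurable_ereal borel_measurable_times borel_measurable_const)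
  have "{w \<in> space (bm_sigma M (bm_shift (real m) W) UNIV).
      liminf (\<lambda>k. ereal (chung_rate (real (k + m)) * T.S (real k) w)) \<le> x} \<in> sets (bm_sigma M (bm_shift (real m) W) UNIV)"
    by measurable
  then show ?thesis using L_eq_shift by (simp cong: conj_cong)
qed

lemma L_event: "{w \<in> space M. L w \<le> x} \<in> sets (bm_sigma M W UNIV)"
proof -
  have "sets (bm_sigma M (bm_shift (real 0) W) UNIV) \<subseteq> sets (bm_sigma M W UNIV)"
  proof (rule bm_sigma_subset)
    fix b u assume "u \<in> dyads"
    then have [measurable]: "W b (real 0 + 1 * u) \<in> borel_measurable (bm_sigma M W UNIV)"
      "W b (real 0) \<in> borel_measurable (bm_sigma M W UNIV)" by (auto intro!: W_bm_sigma)
    show "bm_shift (real 0) W b u \<in> borel_measurable (bm_sigma M W UNIV)"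
      unfolding bm_transform_def by measurable
  qed
  then show ?thesis using L_event_shift[of x 0] by blast
qed

lemma L_zero_one: "prob {w \<in> space M. L w \<le> x} = 0 \<or> prob {w \<in> space M. L w \<le> x} = 1"
  by (rule zero_one_law[OF L_event L_event_shift])

text \<open>The distribution function of \<open>L\<close> takes only the values 0 and 1. Its jump
  \<open>c\<close> is the infimum of \<open>X\<close>, which is nonempty by the upper estimate and
  bounded below by \<open>c1\<close>.\<close>

lemma L_constant:
  assumes low: "AE w in M. ereal c1 \<le> L w" and c1: "0 < c1" and up: "0 < prob {w \<in> space M. L w \<le> ereal c2}"
  shows "\<exists>c>0. AE w in M. L w = ereal c"
proof -
  have ev: "{w \<in> space M. L w \<le> x} \<in> sets M" for x using L_event bm_sigma_subset_M by blast
  define X where "X = {x. prob {w \<in> space M. L w \<le> ereal x} = 1}"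
  have c2X: "c2 \<in> X" using up L_zero_one[of "ereal c2"] by (auto simp: X_def)
  have X_ge: "c1 \<le> x" if "x \<in> X" for x
  proof -
    have "AE w in M. w \<in> {w \<in> space M. L w \<le> ereal x}"
      using that prob_eq_1[OF ev] by (simp add: X_def)
    then have "AE w in M. c1 \<le> x" using low
    proof eventually_elim
      case (elim w)
      then have "ereal c1 \<le> L w" "L w \<le> ereal x" by auto
      then have "ereal c1 \<le> ereal x" by (rule order_trans)
      then show ?case by simp
    qed
    then show ?thesis by (simp add: AE_const)
  qed
  define c where "c = Inf X"
  have bdd: "bdd_below X" using X_ge by (auto simp: bdd_below_def)
  have c_ge: "c1 \<le> c" unfolding c_def using c2X X_ge by (intro cInf_greatest) auto
  have "AE w in M. \<forall>n::nat. L w \<le> ereal (c + 1 / real (Suc n))"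
    unfolding AE_all_countable
  proof
    fix n :: nat
    obtain x where x: "x \<in> X" "x < c + 1 / real (Suc n)"
      using cInf_less_iff[of X "c + 1 / real (Suc n)"] c2X bdd unfolding c_def[symmetric] by auto
    have "AE w in M. w \<in> {w \<in> space M. L w \<le> ereal x}"
      using x(1) prob_eq_1[OF ev] by (simp add: X_def)
    then show "AE w in M. L w \<le> ereal (c + 1 / real (Suc n))"
    proof eventually_elim
      case (elim w)
      then have "L w \<le> ereal x" by simp
      also have "\<dots> \<le> ereal (c + 1 / real (Suc n))" using x(2) by simp
      finally show ?case .
    qed
  qed
  moreover have "AE w in M. \<forall>n::nat. \<not> L w \<le> ereal (c - 1 / real (Suc n))"
    unfolding AE_all_countable
  proof
    fix n :: nat
    have "c - 1 / real (Suc n) \<notin> X"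
    proof
      assume "c - 1 / real (Suc n) \<in> X"
      then have "c \<le> c - 1 / real (Suc n)" unfolding c_def by (rule cInf_lower[OF _ bdd])
      then show False by simp
    qed
    then have "prob {w \<in> space M. L w \<le> ereal (c - 1 / real (Suc n))} = 0"
      using L_zero_one by (auto simp: X_def)
    then have "{w \<in> space M. L w \<le> ereal (c - 1 / real (Suc n))} \<in> null_sets M"
      using ev by (simp add: null_sets_def emeasure_eq_measure)
    then show "AE w in M. \<not> L w \<le> ereal (c - 1 / real (Suc n))"
      by (rule AE_I') auto
  qed
  ultimately have "AE w in M. L w = ereal c"
  proof eventually_elim
    case (elim w)
    have le: "L w \<le> ereal c"
    proof (rule LIMSEQ_le_const)
      have "(\<lambda>n::nat. c + 1 / real (Suc n)) \<longlonglongrightarrow> c" by real_asymp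
      then show "(\<lambda>n::nat. ereal (c + 1 / real (Suc n))) \<longlonglongrightarrow> ereal c" by simp
    qed (use elim in auto)
    have "ereal c \<le> L w"
    proof (rule LIMSEQ_le_const2)
      have "(\<lambda>n::nat. c - 1 / real (Suc n)) \<longlonglongrightarrow> c" by real_asymp
      then show "(\<lambda>n::nat. ereal (c - 1 / real (Suc n))) \<longlonglongrightarrow> ereal c" by simp
    qed (use elim in \<open>auto intro: less_imp_le simp: not_le\<close>)
    with le show ?case by (rule antisym)
  qed
  then show ?thesis using c_ge c1 by (intro exI[of _ c]) auto
qed

end

section \<open>The lower bound\<close>

text \<open>Divided by \<open>sqrt d\<close>, an increment is standard normal, so one
  \<open>p\<close> serves every mesh.\<close>

lemma (in planar_bm) small_increments_prob:
  "\<exists>p. 0 < p \<and> p < 1 \<and> (\<forall>d n. 0 < d \<longrightarrow>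
    prob {w \<in> space M. \<forall>i<n. \<bar>grid_inc d True i w\<bar> \<le> sqrt d} \<le> p ^ n)"
proof -
  define p0 where "p0 = measure (density lborel std_normal_density) {-1..1}"
  have inc: "prob {w \<in> space M. \<bar>grid_inc d True i w\<bar> \<le> sqrt d} = p0" if d: "0 < d" for d i
  proof -
    have "distributed M lborel (\<lambda>w. (grid_inc d True i w - 0) / sqrt d) std_normal_density"
      using grid_inc_distributed[OF d, of True i] d
      by (subst normal_standard_normal_convert[symmetric]) auto
    then have D: "distr M lborel (\<lambda>w. grid_inc d True i w / sqrt d) = density lborel std_normal_density"
      by (simp add: distributed_def)
    have "p0 = prob ((\<lambda>w. grid_inc d True i w / sqrt d) -` {-1..1} \<inter> space M)"
      unfolding p0_def D[symmetric] using d by (subst measure_distr) auto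
    also have "(\<lambda>w. grid_inc d True i w / sqrt d) -` {-1..1} \<inter> space M = {w \<in> space M. \<bar>grid_inc d True i w\<bar> \<le> sqrt d}"
      using d by (auto simp: abs_le_iff pos_le_divide_eq pos_divide_le_eq)
    finally show ?thesis by simp
  qed
  \<comment> \<open>The interval from 2 to 4 has positive mass and is disjoint from the interval
    from -1 to 1.\<close>
  have p0: "p0 < 1"
  proof -
    let ?A = "{w \<in> space M. \<bar>grid_inc 1 True 0 w\<bar> \<le> sqrt 1}" and ?B = "{w \<in> space M. \<bar>grid_inc 1 True 0 w - 3\<bar> \<le> 1}"
    have [measurable]: "grid_inc 1 True 0 \<in> borel_measurable M" by (rule grid_inc_measurable) simp
    have "0 < prob ?B" by (rule normal_interval_pos[OF grid_inc_distributed]) auto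
    moreover have "prob ?A + prob ?B = prob (?A \<union> ?B)"
    proof (rule finite_measure_Union[symmetric])
      show "?A \<inter> ?B = {}" by (auto simp: abs_le_iff)
    qed measurable
    moreover have "prob (?A \<union> ?B) \<le> 1" by (rule prob_le_1)
    ultimately show ?thesis using inc[of 1 0] by linarith
  qed
  \<comment> \<open>The maximum guarantees \<open>p > 0\<close>, so that \<open>ln (1 / p)\<close>
    is meaningful and positive later on.\<close>
  define p where "p = max (1/2) p0"
  have "prob {w \<in> space M. \<forall>i<n. \<bar>grid_inc d True i w\<bar> \<le> sqrt d} \<le> p ^ n" if d: "0 < d" for d n
  proof (cases "n = 0")
    case True
    then show ?thesis by simp
  next
    case False
    define X where "X = (\<lambda>(b, i). grid_inc d b i)"
    have "indep_vars (\<lambda>_. borel) X ({True} \<times> {..<n})"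
      unfolding X_def using d by (intro indep_vars_subset[OF grid_inc_indep[of d n]]) auto
    then have "prob (\<Inter>k\<in>{True} \<times> {..<n}. X k -` {- sqrt d..sqrt d} \<inter> space M) =
        (\<Prod>k\<in>{True} \<times> {..<n}. prob (X k -` {- sqrt d..sqrt d} \<inter> space M))"
      using False by (intro indep_varsD) auto
    also have "(\<Inter>k\<in>{True} \<times> {..<n}. X k -` {- sqrt d..sqrt d} \<inter> space M) =
        {w \<in> space M. \<forall>i<n. \<bar>grid_inc d True i w\<bar> \<le> sqrt d}"
    proof -
      have "X (True, i) w \<in> {- sqrt d..sqrt d} \<longleftrightarrow> \<bar>grid_inc d True i w\<bar> \<le> sqrt d" for i w
        by (simp add: X_def abs_le_iff minus_le_iff conj_commute)
      then show ?thesis using False by (auto simp del: atLeastAtMost_iff)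
    qed
    also have "(\<Prod>k\<in>{True} \<times> {..<n}. prob (X k -` {- sqrt d..sqrt d} \<inter> space M)) = (\<Prod>k\<in>{True} \<times> {..<n}. p0)"
    proof (rule prod.cong[OF refl])
      fix k assume "k \<in> {True} \<times> {..<n}"
      then obtain i where k: "k = (True, i)" by auto
      have "X k -` {- sqrt d..sqrt d} \<inter> space M = {w \<in> space M. \<bar>grid_inc d True i w\<bar> \<le> sqrt d}"
        by (auto simp: X_def k abs_le_iff minus_le_iff)
      then show "prob (X k -` {- sqrt d..sqrt d} \<inter> space M) = p0" using inc[OF d] by simp
    qed
    also have "\<dots> = p0 ^ n" by simp
    also have "\<dots> \<le> p ^ n" by (intro power_mono) (auto simp: p_def p0_def)
    finally show ?thesis .
  qed
  moreover have "0 < p" "p < 1" using p0 by (auto simp: p_def)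
  ultimately show ?thesis by blast
qed

context heis_bm
begin

text \<open>The time interval up to \<open>2 ^ n\<close> is cut into about
  \<open>\<beta> * ln n\<close> cells. Unless all first-coordinate increments are small, one of them
  exceeds \<open>sqrt (d n)\<close>, so one of its endpoints has norm at least half of that.\<close>

lemma L_lower_bound: "\<exists>c>0. AE w in M. ereal c \<le> L w"
proof -
  obtain p where p: "0 < p" "p < 1"
      "\<And>d n. 0 < d \<Longrightarrow> prob {w \<in> space M. \<forall>i<n. \<bar>grid_inc d True i w\<bar> \<le> sqrt d} \<le> p ^ n"
    using small_increments_prob by blast
  \<comment> \<open>Chosen so that \<open>p\<close> to the power \<open>\<beta> * ln n\<close> is
    \<open>n\<close> to the power -2, a summable bound.\<close>
  define \<beta> where "\<beta> = 2 / ln (1 / p)"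
  have \<beta>: "0 < \<beta>" using p by (simp add: \<beta>_def)
  \<comment> \<open>The successor keeps the number of cells positive for small \<open>n\<close>,
    where the logarithmic term may vanish.\<close>
  define m where "m n = Suc (nat \<lceil>\<beta> * ln (real n)\<rceil>)" for n :: nat
  define d where "d n = 2 ^ n / real (m n)" for n
  have d: "0 < d n" for n by (simp add: d_def m_def)
  have m_le: "real (m n) \<le> \<beta> * ln (real n) + 2" and m_ge: "\<beta> * ln (real n) \<le> real (m n)" if "1 \<le> n" for n
  proof -
    have "0 \<le> \<beta> * ln (real n)" using that \<beta> by simp
    then show "real (m n) \<le> \<beta> * ln (real n) + 2" "\<beta> * ln (real n) \<le> real (m n)" unfolding m_def by linarith+
  qed
  define B where "B n = {w \<in> space M. \<forall>i<m n. \<bar>grid_inc (d n) True i w\<bar> \<le> sqrt (d n)}" for n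
  have BM: "B n \<in> sets M" for n
  proof -
    have [measurable]: "grid_inc (d n) True i \<in> borel_measurable M" for i using d[of n] by (intro grid_inc_measurable) simp
    show ?thesis unfolding B_def by measurable
  qed
  have "prob (B n) \<le> inverse (real n ^ 2)" if n: "1 \<le> n" for n
  proof -
    have "prob (B n) \<le> p ^ m n" unfolding B_def by (rule p(3)[OF d])
    also have "\<dots> = p powr real (m n)" using p(1) by (simp add: powr_realpow)
    also have "\<dots> \<le> p powr (\<beta> * ln (real n))" using p m_ge[OF n] by (intro powr_mono') auto
    also have "\<dots> = exp (- 2 * ln (real n))"
    proof -
      have "ln p \<noteq> 0" using p by simp
      then show ?thesis using p by (simp add: powr_def \<beta>_def ln_div)
    qed
    also have "\<dots> = inverse (exp (ln (real n)) ^ 2)"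
      by (simp add: exp_minus exp_of_nat_mult[symmetric])
    also have "\<dots> = inverse (real n ^ 2)" using n by simp
    finally show ?thesis .
  qed
  then have "summable (\<lambda>n. prob (B n))"
    by (intro summable_comparison_test'[OF inverse_power_summable[of 2], of 1]) auto
  then have "AE w in M. eventually (\<lambda>n. w \<in> space M - B n) sequentially"
    using BM by (intro borel_cantelli_AE1) (auto simp: emeasure_eq_measure)
  \<comment> \<open>The squared rate times \<open>d n\<close> is bounded below by a quantity tending
    to \<open>1 / (2 * \<beta>)\<close>; half of that limit is kept. The outer factor 1/2 comes from
    passing from an increment to an endpoint.\<close>
  moreover define c where "c = sqrt (1 / (4 * \<beta>)) / 2"
  have "ereal c \<le> L w" if w: "w \<in> space M" and ev: "eventually (\<lambda>n. w \<in> space M - B n) sequentially" for w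
  proof -
    have big: "sqrt (d n) / 2 \<le> S (2 ^ n) w" if nB: "w \<in> space M - B n" for n
    proof -
      obtain i where i: "i < m n" "sqrt (d n) < \<bar>grid_inc (d n) True i w\<bar>" using nB by (auto simp: B_def not_le)
      have W_le: "\<bar>W True (real k * d n) w\<bar> \<le> S (2 ^ n) w" if "k \<le> m n" for k
      proof -
        have "real k * d n \<le> real (m n) * d n" using that d[of n] by (intro mult_right_mono) auto
        also have "\<dots> = 2 ^ n" by (simp add: d_def m_def)
        finally have "heis_norm (g (real k * d n) w) \<le> S (2 ^ n) w"
          using d[of n] by (intro norm_le_running_max[OF w]) auto
        then show ?thesis
          using heis_norm_ge_fst[of "W True (real k * d n) w" "W False (real k * d n) w" "A (real k * d n) w"]
          by (simp add: hyp_BM_def)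
      qed
      have "\<bar>grid_inc (d n) True i w\<bar> \<le> \<bar>W True (real (Suc i) * d n) w\<bar> + \<bar>W True (real i * d n) w\<bar>"
        unfolding grid_inc_def by (rule abs_triangle_ineq4)
      also have "\<dots> \<le> S (2 ^ n) w + S (2 ^ n) w" using i(1) by (intro add_mono W_le) auto
      finally show ?thesis using i(2) by simp
    qed
    have "((\<lambda>n::nat. ln (real n * ln 2) / (2 * (\<beta> * ln (real n) + 2))) \<longlongrightarrow> inverse \<beta> / 2) sequentially"
      using \<beta> by real_asymp
    then have "eventually (\<lambda>n::nat. 1 / (4 * \<beta>) < ln (real n * ln 2) / (2 * (\<beta> * ln (real n) + 2))) sequentially"
      using \<beta> by (intro order_tendstoD(1)) (auto simp: field_simps)
    moreover have "eventually (\<lambda>n::nat. exp 1 \<le> (2::real) ^ n) sequentially" by real_asymp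
    moreover have "eventually (\<lambda>n::nat. 0 < ln (real n * ln 2)) sequentially" by real_asymp
    ultimately have "eventually (\<lambda>n. w \<in> space M - B n \<and> exp 1 \<le> (2::real) ^ n \<and> 1 \<le> n \<and>
        1 / (4 * \<beta>) \<le> ln (real n * ln 2) / (2 * real (m n))) sequentially"
      using ev eventually_ge_at_top[of 1]
    proof eventually_elim
      case (elim n)
      have "ln (real n * ln 2) / (2 * (\<beta> * ln (real n) + 2)) \<le> ln (real n * ln 2) / (2 * real (m n))"
        using m_le[OF elim(5)] elim(3) by (intro divide_left_mono mult_pos_pos) (auto simp: m_def intro: less_le_trans)
      then show ?case using elim by auto
    qed
    then obtain N where N: "\<And>n. n \<ge> N \<Longrightarrow> w \<in> space M - B n" "\<And>n. n \<ge> N \<Longrightarrow> exp 1 \<le> (2::real) ^ n"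
        "\<And>n. n \<ge> N \<Longrightarrow> 1 \<le> n" "\<And>n. n \<ge> N \<Longrightarrow> 1 / (4 * \<beta>) \<le> ln (real n * ln 2) / (2 * real (m n))"
      unfolding eventually_sequentially by blast
    have "eventually (\<lambda>k::nat. ereal c \<le> ereal (chung_rate (real k) * S (real k) w)) sequentially"
      using eventually_ge_at_top[of "2 ^ N"]
    proof eventually_elim
      case (elim k)
      have "1 \<le> k" using elim one_le_power[of "2::nat" N] by linarith
      then obtain n where n: "2 ^ n \<le> k" "k < 2 ^ Suc n" using ex_power_ivl1[of 2 k] by auto
      have "N \<le> n"
      proof (rule ccontr)
        assume "\<not> N \<le> n"
        then have "(2::nat) ^ Suc n \<le> 2 ^ N" by (intro power_increasing) auto
        then show False using n(2) elim by linarith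
      qed
      note Nn = N[OF this]
      have kn: "2 ^ n \<le> real k" "real k \<le> 2 ^ Suc n"
        using n by (metis of_nat_le_iff of_nat_numeral of_nat_power less_imp_le)+
      have "c \<le> sqrt (ln (real n * ln 2) / (2 * real (m n))) / 2"
        unfolding c_def using Nn(4) by (intro divide_right_mono real_sqrt_le_mono) auto
      also have "\<dots> = sqrt (ln (ln (2 ^ n)) / 2 ^ Suc n) * (sqrt (d n) / 2)"
        by (simp add: real_sqrt_mult[symmetric] d_def ln_realpow field_simps)
      also have "\<dots> \<le> chung_rate (real k) * S (real k) w"
      proof (rule mult_mono)
        show "sqrt (ln (ln (2 ^ n)) / 2 ^ Suc n) \<le> chung_rate (real k)" by (rule chung_rate_ge[OF Nn(2) kn])
        show "sqrt (d n) / 2 \<le> S (real k) w"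
          using big[OF Nn(1)] running_max_mono[OF w, of "2 ^ n" "real k"] kn by simp
        show "0 \<le> chung_rate (real k)" using Nn(2) kn by (intro chung_rate_nonneg) linarith
        show "0 \<le> sqrt (d n) / 2" using d[of n] by simp
      qed
      finally show ?case by simp
    qed
    then show ?thesis unfolding L_def by (rule Liminf_bounded)
  qed
  ultimately have "AE w in M. ereal c \<le> L w" by (auto elim!: AE_mp)
  moreover have "0 < c" using \<beta> by (simp add: c_def)
  ultimately show ?thesis by blast
qed

end

section \<open>The upper bound\<close>

text \<open>Decomposing according to the last index at which \<open>D\<close> occurs makes the past event \<open>F\<close> independent of the
  rest, so that no tail estimate for \<open>F\<close> is needed.\<close>

lemma (in prob_space) last_success_prob:
  fixes D F :: "nat \<Rightarrow> 'a set"
  assumes D: "\<And>n. D n \<in> events" and F: "\<And>n. F n \<in> events" and N: "2 \<le> N"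
    and indD: "\<And>n K. N \<le> n \<Longrightarrow> prob (D n \<inter> (\<Union>m\<in>{Suc n..<K}. D m)) = prob (D n) * prob (\<Union>m\<in>{Suc n..<K}. D m)"
    and indF: "\<And>n K. N \<le> n \<Longrightarrow> prob (F n \<inter> (D n - (\<Union>m\<in>{Suc n..<K}. D m))) = prob (F n) * prob (D n - (\<Union>m\<in>{Suc n..<K}. D m))"
    and half: "\<And>n. N \<le> n \<Longrightarrow> 1 / 2 \<le> prob (F n)"
    and div: "\<And>n. N \<le> n \<Longrightarrow> 1 / real n \<le> prob (D n)"
  shows "1 / 2 \<le> prob (\<Inter>i. \<Union>m\<in>{N + i..}. F m \<inter> D m)"
proof -
  define U where "U n K = (\<Union>m\<in>{n..<K}. D m)" for n K
  define Q where "Q n K = (\<Union>m\<in>{n..<K}. F m \<inter> D m)" for n K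
  have UM [measurable]: "U n K \<in> events" and QM [measurable]: "Q n K \<in> events" for n K
    using D F by (auto simp: U_def Q_def)
  note [measurable] = D F
  have split: "{n..<K} = insert n {Suc n..<K}" if "n < K" for n K :: nat using that by auto
  have U_step: "U n K = D n \<union> U (Suc n) K" and Q_step: "Q n K = (F n \<inter> D n) \<union> Q (Suc n) K" if "n < K" for n K
    unfolding U_def Q_def split[OF that] by auto
  \<comment> \<open>Downward induction on \<open>n\<close>: the event
    \<open>D n - U (Suc n) K\<close> says that \<open>n\<close> is the last success before
    \<open>K\<close>, and at least half of its probability survives the intersection with
    \<open>F n\<close>.\<close>
  have half_U: "prob (U n K) / 2 \<le> prob (Q n K)" if "N \<le> n" "n \<le> K" for n K
    using that(2,1)
  proof (induction rule: inc_induct)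
    case base
    show ?case by (simp add: U_def)
  next
    case (step n)
    have "U n K = U (Suc n) K \<union> D n" using U_step[OF step.hyps(2)] by auto
    then have "prob (U n K) = prob (U (Suc n) K) + prob (D n - U (Suc n) K)"
      by (simp add: finite_measure_Union')
    moreover have "prob (U (Suc n) K) / 2 \<le> prob (Q (Suc n) K)" using step by simp
    moreover have "prob (D n - U (Suc n) K) / 2 \<le> prob (F n) * prob (D n - U (Suc n) K)"
      using mult_right_mono[OF half[OF step.prems], of "prob (D n - U (Suc n) K)"] by simp
    moreover have "prob (F n) * prob (D n - U (Suc n) K) = prob (F n \<inter> (D n - U (Suc n) K))"
      unfolding U_def by (rule indF[OF step.prems, symmetric])
    moreover have "prob (Q (Suc n) K \<union> (F n \<inter> (D n - U (Suc n) K))) = prob (Q (Suc n) K) + prob (F n \<inter> (D n - U (Suc n) K))"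
      by (rule finite_measure_Union) (auto simp: Q_def U_def)
    moreover have "prob (Q (Suc n) K \<union> (F n \<inter> (D n - U (Suc n) K))) \<le> prob (Q n K)"
      by (rule finite_measure_mono) (use Q_step[OF step.hyps(2)] in auto)
    ultimately show ?case by argo
  qed
  \<comment> \<open>Independence turns the failure probability into a product of factors at most
    \<open>1 - 1 / i\<close>, which telescopes; \<open>N \<ge> 2\<close> keeps the denominators
    positive.\<close>
  have U_compl: "1 - prob (U n K) \<le> (real n - 1) / (real K - 1)" if "N \<le> n" "n \<le> K" for n K
    using that(2,1)
  proof (induction rule: inc_induct)
    case base
    then show ?case using N by (simp add: U_def)
  next
    case (step n)
    have n: "2 \<le> n" using step.prems N by simp
    have "prob (D n \<union> U (Suc n) K) = prob (D n) + prob (U (Suc n) K) - prob (D n \<inter> U (Suc n) K)"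
      using finite_measure_Union'[of "D n" "U (Suc n) K"] finite_measure_Diff'[of "U (Suc n) K" "D n"] D UM
      by (simp add: Int_commute)
    moreover have "prob (D n \<inter> U (Suc n) K) = prob (D n) * prob (U (Suc n) K)"
      unfolding U_def by (rule indD[OF step.prems])
    ultimately have "1 - prob (U n K) = (1 - prob (D n)) * (1 - prob (U (Suc n) K))"
      unfolding U_step[OF step.hyps(2)] by (simp add: algebra_simps)
    also have "\<dots> \<le> (1 - 1 / real n) * ((real (Suc n) - 1) / (real K - 1))"
      using div[OF step.prems] step n by (intro mult_mono) auto
    also have "\<dots> = (real n - 1) / (real K - 1)"
    proof -
      have "1 - 1 / real n = (real n - 1) / real n" using n by (simp add: field_simps)
      then show ?thesis using n by simp
    qed
    finally show ?case .
  qed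
  have tail: "1 / 2 \<le> prob (\<Union>m\<in>{n..}. F m \<inter> D m)" if "N \<le> n" for n
  proof (rule LIMSEQ_le_const2)
    show "(\<lambda>K::nat. (1 - (real n - 1) / (real K - 1)) / 2) \<longlonglongrightarrow> 1 / 2" by real_asymp
    have "(1 - (real n - 1) / (real K - 1)) / 2 \<le> prob (\<Union>m\<in>{n..}. F m \<inter> D m)" if "n \<le> K" for K
    proof -
      have "(1 - (real n - 1) / (real K - 1)) / 2 \<le> prob (Q n K)"
      proof -
        have "(1 - x) / 2 \<le> y" if "u / 2 \<le> y" "1 - u \<le> x" for x y u :: real using that by simp
        from this[OF half_U[OF \<open>N \<le> n\<close> that] U_compl[OF \<open>N \<le> n\<close> that]] show ?thesis .
      qed
      also have "\<dots> \<le> prob (\<Union>m\<in>{n..}. F m \<inter> D m)"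
        by (rule finite_measure_mono) (auto simp: Q_def)
      finally show ?thesis .
    qed
    then show "\<exists>K0. \<forall>K\<ge>K0. (1 - (real n - 1) / (real K - 1)) / 2 \<le> prob (\<Union>m\<in>{n..}. F m \<inter> D m)" by blast
  qed
  have "(\<lambda>i. prob (\<Union>m\<in>{N + i..}. F m \<inter> D m)) \<longlonglongrightarrow> prob (\<Inter>i. \<Union>m\<in>{N + i..}. F m \<inter> D m)"
  proof (rule finite_Lim_measure_decseq)
    show "decseq (\<lambda>i. \<Union>m\<in>{N + i..}. F m \<inter> D m)"
    proof (rule antimonoI)
      fix i j :: nat assume "i \<le> j"
      then have "{N + j..} \<subseteq> {N + i..}" by auto
      then show "(\<Union>m\<in>{N + j..}. F m \<inter> D m) \<subseteq> (\<Union>m\<in>{N + i..}. F m \<inter> D m)" by (rule UN_mono) simp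
    qed
  qed auto
  then show ?thesis by (rule LIMSEQ_le_const) (use tail in auto)
qed

lemma heis_norm_scaled_path:
  "heis_norm (heis_path (bm_transform (\<lambda>_. 1 / 2 ^ j) s (4 ^ j) W) (area_transform (\<lambda>_. 1 / 2 ^ j) s (4 ^ j) W A) t w) =
    heis_norm (shift_path s W A (4 ^ j * t) w) / 2 ^ j"
  using heis_norm_scale[of "1 / 2 ^ j" "1 / 2 ^ j" "bm_shift s W True (4 ^ j * t) w" "bm_shift s W False (4 ^ j * t) w"
      "area_shift s W A (4 ^ j * t) w"]
  by (simp add: hyp_BM_def bm_transform_def area_transform_def)

lemma heis_norm_scaled_path_le_iff:
  "(\<forall>t\<in>{0..\<tau>}. heis_norm (heis_path (bm_transform (\<lambda>_. 1 / 2 ^ j) s (4 ^ j) W)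
      (area_transform (\<lambda>_. 1 / 2 ^ j) s (4 ^ j) W A) t w) \<le> C) \<longleftrightarrow>
    (\<forall>u\<in>{0..4 ^ j * \<tau>}. heis_norm (shift_path s W A u w) \<le> 2 ^ j * C)" (is "?l = ?r")
proof
  assume l: ?l
  show ?r
  proof
    fix u assume u: "u \<in> {0..4 ^ j * \<tau>}"
    then have "u / 4 ^ j \<in> {0..\<tau>}" by (simp add: field_simps)
    from l[rule_format, OF this] show "heis_norm (shift_path s W A u w) \<le> 2 ^ j * C"
      unfolding heis_norm_scaled_path by (simp add: field_simps)
  qed
next
  assume r: ?r
  show ?l
  proof
    fix t assume "t \<in> {0..\<tau>}"
    then have "4 ^ j * t \<in> {0..4 ^ j * \<tau>}" by simp
    from r[rule_format, OF this] show "heis_norm (heis_path (bm_transform (\<lambda>_. 1 / 2 ^ j) s (4 ^ j) W)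
      (area_transform (\<lambda>_. 1 / 2 ^ j) s (4 ^ j) W A) t w) \<le> C"
      unfolding heis_norm_scaled_path by (simp add: field_simps)
  qed
qed

lemma power2_square_four: "((1::real) / 2 ^ j)\<^sup>2 * 4 ^ j = 1"
  by (simp add: power_divide power_mult_distrib[symmetric] power2_eq_square)

lemma (in planar_bm) bm_sigma_shift_antimono:
  assumes "i \<le> k"
  shows "sets (bm_sigma M (bm_shift (real k) W) UNIV) \<subseteq> sets (bm_sigma M (bm_shift (real i) W) UNIV)"
proof (rule bm_sigma_subset)
  fix b u assume u: "u \<in> dyads"
  let ?V = "bm_shift (real i) W"
  have [measurable]: "?V b (real (k - i) + u) \<in> borel_measurable (bm_sigma M ?V UNIV)"
    "?V b (real (k - i)) \<in> borel_measurable (bm_sigma M ?V UNIV)"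
    using u by (auto intro!: W_bm_sigma)
  have "bm_shift (real k) W b u = (\<lambda>w. ?V b (real (k - i) + u) w - ?V b (real (k - i)) w)"
    using assms by (simp add: bm_transform_def fun_eq_iff of_nat_diff algebra_simps)
  then show "bm_shift (real k) W b u \<in> borel_measurable (bm_sigma M ?V UNIV)" by simp
qed

context heis_bm
begin

lemma scaled_small_ball:
  assumes "\<And>W' A' k. heis_bm M W' A' \<Longrightarrow>
    q ^ k \<le> prob {w \<in> space M. \<forall>t\<in>{0..4 * real k}. heis_norm (heis_path W' A' t w) \<le> R}" and s: "s \<in> dyads"
  shows "q ^ k \<le> prob {w \<in> space M. \<forall>t\<in>{0..4 ^ j * (4 * real k)}.
    heis_norm (shift_path s W A t w) \<le> 2 ^ j * R}"
proof -
  have "heis_bm M (bm_transform (\<lambda>_. 1 / 2 ^ j) s (4 ^ j) W) (area_transform (\<lambda>_. 1 / 2 ^ j) s (4 ^ j) W A)"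
    by (rule heis_bm_transform[OF s power2_square_four])
  from assms(1)[OF this, of k] show ?thesis unfolding heis_norm_scaled_path_le_iff .
qed

text \<open>Brownian scaling of the confinement event. The scaling identity concerns the path
  shifted by 0, which agrees with \<open>g\<close> only where \<open>A 0\<close> vanishes, hence the
  almost sure comparison at the end.\<close>

lemma scaled_norm_bounded_prob:
  "prob {w \<in> space M. \<forall>t\<in>{0..4 ^ j}. heis_norm (g t w) \<le> 2 ^ j * C} =
    prob {w \<in> space M. \<forall>t\<in>{0..1}. heis_norm (g t w) \<le> C}"
proof -
  let ?W = "bm_transform (\<lambda>_. 1 / 2 ^ j) 0 (4 ^ j) W" and ?A = "area_transform (\<lambda>_. 1 / 2 ^ j) 0 (4 ^ j) W A"
  interpret T: heis_bm M ?W ?A by (rule heis_bm_transform[OF _ power2_square_four]) simp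
  interpret Z: heis_bm M "bm_shift 0 W" "area_shift 0 W A" by (rule heis_bm_shift) simp
  have "prob {w \<in> space M. \<forall>t\<in>{0..1}. heis_norm (g t w) \<le> C} = prob (move_event UNIV C)"
    by (simp add: move_event_def)
  also have "\<dots> = prob (T.move_event UNIV C)"
    by (rule move_event_law[OF heis_bm_axioms T.heis_bm_axioms]) simp
  also have "T.move_event UNIV C = {w \<in> space M. \<forall>t\<in>{0..4 ^ j}. heis_norm (Z.g t w) \<le> 2 ^ j * C}"
    using heis_norm_scaled_path_le_iff[of 1 j 0 W A] unfolding T.move_event_def by simp
  also have "prob \<dots> = prob {w \<in> space M. \<forall>t\<in>{0..4 ^ j}. heis_norm (g t w) \<le> 2 ^ j * C}"
  proof (rule finite_measure_eq_AE)
    show "AE w in M. (w \<in> {w \<in> space M. \<forall>t\<in>{0..4 ^ j}. heis_norm (Z.g t w) \<le> 2 ^ j * C}) =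
        (w \<in> {w \<in> space M. \<forall>t\<in>{0..4 ^ j}. heis_norm (g t w) \<le> 2 ^ j * C})"
      using A_zero_AE
    proof (rule AE_mp, intro AE_I2 impI)
      fix w assume w: "w \<in> space M" and A0: "A 0 w = 0"
      have "Z.g t w = g t w" for t
        by (simp add: hyp_BM_def bm_transform_def area_transform_def W_zero[OF w] A0)
      then show "(w \<in> {w \<in> space M. \<forall>t\<in>{0..4 ^ j}. heis_norm (Z.g t w) \<le> 2 ^ j * C}) =
        (w \<in> {w \<in> space M. \<forall>t\<in>{0..4 ^ j}. heis_norm (g t w) \<le> 2 ^ j * C})" by simp
    qed
  qed (auto intro!: norm_g_le_event g_measurable Z.norm_g_le_event Z.g_measurable dyads_nonneg)
  finally show ?thesis by simp
qed

text \<open>On \<open>F n\<close> the past up to \<open>s n\<close> has norm at most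
  \<open>2 ^ (n * n)\<close>, and on \<open>D n\<close> the following increment path stays within
  \<open>R\<close> times that for \<open>k n\<close> blocks. When both occur, the maximum at time
  \<open>e n\<close> is of order \<open>2 ^ (n * n)\<close> although \<open>e n\<close> is larger
  than \<open>4 ^ (n * n)\<close> by a factor of order \<open>ln n\<close>.\<close>

lemma L_upper_bound: "\<exists>c. 0 < prob {w \<in> space M. L w \<le> ereal c}"
proof -
  obtain R q where R: "0 < R" and q: "0 < q" "q < 1"
    and sb: "\<And>W' A' k. heis_bm M W' A' \<Longrightarrow>
      q ^ k \<le> prob {w \<in> space M. \<forall>t\<in>{0..4 * real k}. heis_norm (heis_path W' A' t w) \<le> R}"
    using small_ball_lower_bound[OF heis_bm_axioms] by blast
  \<comment> \<open>Makes \<open>q\<close> to the power \<open>a * ln n\<close> equal to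
    \<open>1 / n\<close>, the borderline of divergence.\<close>
  define a where "a = 1 / ln (1 / q)"
  have a: "0 < a" using q by (simp add: a_def)
  \<comment> \<open>\<open>R + 1\<close> adds the contributions of \<open>D n\<close> and
    \<open>F n\<close>. The ratio of the iterated logarithm to the \<open>4 * k n\<close> time units
    has an upper estimate tending to \<open>1 / (2 * a)\<close>, hence eventually below
    \<open>1 / a\<close>.\<close>
  define c where "c = (R + 1) * sqrt (inverse a)"
  define k where "k n = nat \<lfloor>a * ln (real n)\<rfloor>" for n :: nat
  \<comment> \<open>With a quadratic exponent the past has natural scale
    \<open>2 ^ (n * n - n)\<close>, so the radius in \<open>F n\<close> exceeds it by
    \<open>2 ^ n\<close>. Moreover \<open>s (Suc n) = 4 ^ (n * n + n)\<close> leaves room for the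
    whole stretch of \<open>D n\<close>, and the iterated logarithm is still only about
    \<open>2 * ln n\<close>.\<close>
  define s where "s n = (4::nat) ^ (n * n - n)" for n :: nat
  define e where "e n = s n + 4 ^ (n * n) * (4 * k n)" for n
  define D where "D n = {w \<in> space M. \<forall>t\<in>{0..4 ^ (n * n) * (4 * real (k n))}.
    heis_norm (shift_path (real (s n)) W A t w) \<le> 2 ^ (n * n) * R}" for n
  define F where "F n = {w \<in> space M. \<forall>t\<in>{0..real (s n)}. heis_norm (g t w) \<le> 2 ^ (n * n)}" for n
  have e_real: "real (e n) = real (s n) + 4 ^ (n * n) * (4 * real (k n))" for n by (simp add: e_def)
  have k_le: "real (k n) \<le> a * ln (real n)" and k_ge: "a * ln (real n) - 1 \<le> real (k n)" if "1 \<le> n" for n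
  proof -
    have "0 \<le> a * ln (real n)" using that a by simp
    then show "real (k n) \<le> a * ln (real n)" "a * ln (real n) - 1 \<le> real (k n)" unfolding k_def by linarith+
  qed
  obtain C0 where C0: "\<And>C. C0 \<le> C \<Longrightarrow> 1 - 1 / 2 < prob {w \<in> space M. \<forall>t\<in>{0..1}. heis_norm (g t w) \<le> C}"
    using norm_g_bounded_prob[of "1 / 2"] by auto
  have "((\<lambda>n::nat. ln ((real n * real n + real n) * ln 4) / (4 * (a * ln (real n) - 1))) \<longlongrightarrow> inverse a / 2) sequentially"
    using a by real_asymp
  then have "eventually (\<lambda>n::nat. ln ((real n * real n + real n) * ln 4) / (4 * (a * ln (real n) - 1)) < inverse a) sequentially"
    using a by (intro order_tendstoD(2)) auto
  moreover have "eventually (\<lambda>n::nat. 0 < a * ln (real n) - 1) sequentially" using a by real_asymp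
  moreover have "eventually (\<lambda>n::nat. 1 + 4 * (a * ln (real n)) \<le> 4 ^ n) sequentially" using a by real_asymp
  moreover have "eventually (\<lambda>n::nat. C0 \<le> 2 ^ n) sequentially" by real_asymp
  moreover have "eventually (\<lambda>n::nat. 2 \<le> n) sequentially" by (rule eventually_ge_at_top)
  ultimately have "eventually (\<lambda>n::nat. ln ((real n * real n + real n) * ln 4) / (4 * (a * ln (real n) - 1)) < inverse a \<and>
     0 < a * ln (real n) - 1 \<and> 1 + 4 * (a * ln (real n)) \<le> 4 ^ n \<and> C0 \<le> 2 ^ n \<and> 2 \<le> n) sequentially"
    by eventually_elim simp
  then obtain N where N: "\<And>n. N \<le> n \<Longrightarrow> ln ((real n * real n + real n) * ln 4) / (4 * (a * ln (real n) - 1)) < inverse a"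
      "\<And>n. N \<le> n \<Longrightarrow> 0 < a * ln (real n) - 1" "\<And>n. N \<le> n \<Longrightarrow> 1 + 4 * (a * ln (real n)) \<le> 4 ^ n"
      "\<And>n. N \<le> n \<Longrightarrow> C0 \<le> 2 ^ n" "\<And>n. N \<le> n \<Longrightarrow> 2 \<le> n"
    unfolding eventually_sequentially by blast
  have e_le: "e n \<le> s (Suc n)" if n: "N \<le> n" for n
  proof -
    have "real (1 + 4 * k n) \<le> real (4 ^ n)" using N(3)[OF n] k_le[of n] N(5)[OF n] by simp
    then have "1 + 4 * k n \<le> 4 ^ n" by (simp only: of_nat_le_iff)
    then have "4 ^ (n * n) * (1 + 4 * k n) \<le> 4 ^ (n * n) * 4 ^ n" by (rule mult_left_mono) simp
    moreover have "s n \<le> 4 ^ (n * n)" unfolding s_def by (rule power_increasing) auto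
    moreover have "s (Suc n) = 4 ^ (n * n) * 4 ^ n" unfolding s_def by (simp add: power_add[symmetric])
    ultimately show ?thesis unfolding e_def by (simp add: distrib_left)
  qed
  have s_mono: "s n \<le> s m" if "n \<le> m" for n m
  proof -
    have "n * (n - 1) \<le> m * (m - 1)" using that by (intro mult_le_mono diff_le_mono)
    then have "n * n - n \<le> m * m - m" by (simp add: diff_mult_distrib2)
    then show ?thesis unfolding s_def by (intro power_increasing) auto
  qed
  have D_sigma: "D n \<in> sets (bm_sigma M (bm_shift (real (s n)) W) {..4 ^ (n * n) * (4 * real (k n))})" for n
  proof -
    interpret T: heis_bm M "bm_shift (real (s n)) W" "area_shift (real (s n)) W A" by (rule heis_bm_shift) simp
    show ?thesis unfolding D_def by (rule T.norm_g_le_event) (auto intro: T.g_bm_sigma)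
  qed
  have D_past: "D n \<in> sets (bm_sigma M W {..real (s (Suc n))})" if "N \<le> n" for n
  proof -
    have "D n \<in> sets (bm_sigma M W {..real (e n)})"
      using D_sigma[of n] shift_bm_sigma[of "real (s n)" "4 ^ (n * n) * (4 * real (k n))"] unfolding e_real by auto
    then show ?thesis using bm_sigma_mono[of "{..real (e n)}" "{..real (s (Suc n))}" M W] e_le[OF that] by auto
  qed
  have D_future: "D m \<in> sets (bm_sigma M (bm_shift (real (s n)) W) UNIV)" if "n \<le> m" for n m
    using D_sigma[of m] bm_sigma_mono[of "{..4 ^ (m * m) * (4 * real (k m))}" UNIV M "bm_shift (real (s m)) W"]
      bm_sigma_shift_antimono[OF s_mono[OF that]] by auto
  have F_past: "F n \<in> sets (bm_sigma M W {..real (s n)})" for n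
    unfolding F_def by (rule norm_g_le_event) (auto intro: g_bm_sigma)
  have DM: "D n \<in> events" for n
  proof -
    interpret T: planar_bm M "bm_shift (real (s n)) W" by (rule planar_bm_shift) simp
    show ?thesis using D_sigma T.bm_sigma_subset_M by blast
  qed
  have FM: "F n \<in> events" for n using F_past bm_sigma_subset_M by blast
  have U_future: "(\<Union>m\<in>{Suc n..<K}. D m) \<in> sets (bm_sigma M (bm_shift (real (s l)) W) UNIV)" if "l \<le> Suc n" for n K l
    using that by (intro sets.finite_UN D_future) auto
  have "1 / 2 \<le> prob (\<Inter>i. \<Union>m\<in>{N + i..}. F m \<inter> D m)"
  proof (rule last_success_prob[OF DM FM])
    show "2 \<le> N" by (rule N(5)) simp
  next
    fix n K assume n: "N \<le> n"
    \<comment> \<open>\<open>D n\<close> is decided by time \<open>e n\<close>, which is at most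
      \<open>s (Suc n)\<close>, while all later \<open>D m\<close> depend only on increments after
      \<open>s (Suc n)\<close>. For \<open>F n\<close> the splitting time is
      \<open>s n\<close>.\<close>
    show "prob (D n \<inter> (\<Union>m\<in>{Suc n..<K}. D m)) = prob (D n) * prob (\<Union>m\<in>{Suc n..<K}. D m)"
      by (rule past_future_indep[OF of_nat_dyads D_past[OF n] U_future]) simp
    show "prob (F n \<inter> (D n - (\<Union>m\<in>{Suc n..<K}. D m))) = prob (F n) * prob (D n - (\<Union>m\<in>{Suc n..<K}. D m))"
      by (rule past_future_indep[OF of_nat_dyads F_past]) (intro sets.Diff D_future U_future; simp)
  next
    fix n assume n: "N \<le> n"
    have "2 ^ (n * n) = 2 ^ (n * n - n) * (2::real) ^ n" by (simp flip: power_add)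
    then have "F n = {w \<in> space M. \<forall>t\<in>{0..4 ^ (n * n - n)}. heis_norm (g t w) \<le> 2 ^ (n * n - n) * 2 ^ n}"
      by (simp add: F_def s_def)
    then show "1 / 2 \<le> prob (F n)"
      using C0[OF N(4)[OF n]] by (simp add: scaled_norm_bounded_prob)
  next
    fix n assume n: "N \<le> n"
    have n1: "1 \<le> n" using N(5)[OF n] by simp
    have "1 / real n = exp (- ln (real n))" using n1 by (simp add: exp_minus inverse_eq_divide)
    also have "- ln (real n) = a * ln (real n) * ln q" using q by (simp add: a_def ln_div)
    also have "exp \<dots> = q powr (a * ln (real n))" using q by (simp add: powr_def)
    also have "\<dots> \<le> q powr real (k n)" using q k_le[OF n1] by (intro powr_mono') auto
    also have "\<dots> = q ^ k n" using q by (simp add: powr_realpow)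
    also have "\<dots> \<le> prob (D n)" unfolding D_def by (rule scaled_small_ball[OF sb of_nat_dyads])
    finally show "1 / real n \<le> prob (D n)" .
  qed
  also have "\<dots> \<le> prob {w \<in> space M. L w \<le> ereal c}"
  proof (rule finite_measure_mono)
    show "{w \<in> space M. L w \<le> ereal c} \<in> events"
      using L_event bm_sigma_subset_M by blast
    show "(\<Inter>i. \<Union>m\<in>{N + i..}. F m \<inter> D m) \<subseteq> {w \<in> space M. L w \<le> ereal c}"
    proof
      fix w assume w_in: "w \<in> (\<Inter>i. \<Union>m\<in>{N + i..}. F m \<inter> D m)"
      then have w: "w \<in> space M" by (auto simp: F_def)
      have bound: "chung_rate (real (e n)) * S (real (e n)) w \<le> c"
        if n: "N \<le> n" and FD: "w \<in> F n \<inter> D n" for n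
      proof -
        have n2: "2 \<le> n" by (rule N(5)[OF n])
        have S_le: "S (real (e n)) w \<le> 2 ^ (n * n) * (R + 1)"
        proof (subst running_max_le_iff[OF w], simp, safe)
          fix t assume t: "t \<in> {0..real (e n)}"
          show "heis_norm (g t w) \<le> 2 ^ (n * n) * (R + 1)"
          proof (cases "t \<le> real (s n)")
            case True
            then have "heis_norm (g t w) \<le> 2 ^ (n * n) * 1" using FD t by (auto simp: F_def)
            also have "\<dots> \<le> 2 ^ (n * n) * (R + 1)" using R by (intro mult_left_mono) auto
            finally show ?thesis .
          next
            case False
            let ?h = "shift_path (real (s n)) W A (t - real (s n)) w"
            have "heis_norm (g t w) \<le> heis_norm (g (real (s n)) w) + heis_norm ?h"
              using heis_norm_hmul_le[of "g (real (s n)) w" ?h] heis_path_shift[of W A "real (s n)" "t - real (s n)" w] by simp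
            also have "heis_norm (g (real (s n)) w) \<le> 2 ^ (n * n)" using FD by (auto simp: F_def)
            also have "heis_norm ?h \<le> 2 ^ (n * n) * R"
              using FD t False unfolding D_def e_real by auto
            finally show ?thesis by (simp add: algebra_simps)
          qed
        qed
        have kpos: "0 < a * ln (real n) - 1" by (rule N(2)[OF n])
        have k_low: "a * ln (real n) - 1 \<le> real (k n)" using n2 by (intro k_ge) simp
        have s1: "1 \<le> s n" by (simp add: s_def)
        have e_low: "4 ^ (n * n) * (4 * (a * ln (real n) - 1)) \<le> real (e n)"
        proof -
          have "4 ^ (n * n) * (4 * (a * ln (real n) - 1)) \<le> 4 ^ (n * n) * (4 * real (k n))"
            using k_low by (intro mult_left_mono) auto
          also have "\<dots> \<le> real (e n)" by (simp add: e_real)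
          finally show ?thesis .
        qed
        have e_up: "real (e n) \<le> 4 ^ (n * n + n)"
        proof -
          have "s (Suc n) = 4 ^ (n * n + n)" unfolding s_def by simp
          then show ?thesis using e_le[OF n] by (metis of_nat_le_iff of_nat_numeral of_nat_power)
        qed
        have e_pos: "1 < real (e n)"
        proof -
          have "1 < s n" unfolding s_def using n2 by (intro one_less_power) auto
          then have "1 < e n" unfolding e_def by linarith
          then show ?thesis by simp
        qed
        have "ln (real (e n)) \<le> ln (4 ^ (n * n + n))" using e_up e_pos by (subst ln_le_cancel_iff) auto
        also have "\<dots> = (real n * real n + real n) * ln 4" by (subst ln_realpow) auto
        finally have "ln (ln (real (e n))) \<le> ln ((real n * real n + real n) * ln 4)"
          using e_pos by (subst ln_le_cancel_iff) (auto intro: less_le_trans[of _ "ln (real (e n))"])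
        moreover have nonneg: "0 \<le> ln ((real n * real n + real n) * ln 4)"
        proof (rule ln_ge_zero)
          have "1 * 1 \<le> (real n * real n + real n) * ln 4"
          proof (rule mult_mono)
            show "1 \<le> real n * real n + real n" using n2 by (simp add: add_increasing)
            show "1 \<le> ln (4::real)" using exp_le by (subst ln_ge_iff) auto
          qed (use n2 in auto)
          then show "1 \<le> (real n * real n + real n) * ln 4" by simp
        qed
        ultimately have "ln (ln (real (e n))) / real (e n) \<le>
            ln ((real n * real n + real n) * ln 4) / (4 ^ (n * n) * (4 * (a * ln (real n) - 1)))"
          using e_low kpos by (intro frac_le) auto
        also have "\<dots> = ln ((real n * real n + real n) * ln 4) / (4 * (a * ln (real n) - 1)) / 4 ^ (n * n)"
          by simp
        also have "\<dots> \<le> inverse a / 4 ^ (n * n)" using N(1)[OF n] by (intro divide_right_mono) auto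
        finally have "chung_rate (real (e n)) \<le> sqrt (inverse a / 4 ^ (n * n))"
          unfolding chung_rate_def by (rule real_sqrt_le_mono)
        also have "\<dots> = sqrt (inverse a) / 2 ^ (n * n)"
        proof -
          have "(4::real) ^ (n * n) = (2 ^ (n * n))\<^sup>2" by (simp add: power2_eq_square power_mult_distrib[symmetric])
          then show ?thesis by (simp add: real_sqrt_divide)
        qed
        finally have "chung_rate (real (e n)) * S (real (e n)) w \<le> (sqrt (inverse a) / 2 ^ (n * n)) * (2 ^ (n * n) * (R + 1))"
          using S_le running_max_nonneg[OF w, of "real (e n)"] a by (intro mult_mono) auto
        then show ?thesis by (simp add: c_def mult.commute)
      qed
      have "L w \<le> ereal c"
      proof (rule ccontr)
        assume "\<not> L w \<le> ereal c"
        then have "ereal c < L w" by simp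
        then have "eventually (\<lambda>k::nat. ereal c < ereal (chung_rate (real k) * S (real k) w)) sequentially"
          unfolding L_def by (metis le_Liminf_iff order_refl)
        then obtain K where K: "\<And>k. K \<le> k \<Longrightarrow> c < chung_rate (real k) * S (real k) w"
          unfolding eventually_sequentially by auto
        \<comment> \<open>A success index beyond \<open>N + K\<close> has \<open>e m\<close> at
          least \<open>K\<close>, because \<open>e m\<close> grows faster than \<open>m\<close>; the
          bound at time \<open>e m\<close> then contradicts the choice of \<open>K\<close>.\<close>
        obtain m where m: "N + K \<le> m" "w \<in> F m \<inter> D m" using w_in by auto
        have m2: "2 \<le> m" using m(1) by (intro N(5)) simp
        have "m < 2 ^ m" by (rule less_exp)
        also have "(2::nat) ^ m \<le> 2 ^ (m * m - m)"
        proof (rule power_increasing)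
          have "2 * m \<le> m * m" using m2 by (rule mult_le_mono1)
          then show "m \<le> m * m - m" by linarith
        qed simp
        also have "\<dots> \<le> s m" unfolding s_def by (rule power_mono) auto
        also have "\<dots> \<le> e m" by (simp add: e_def)
        finally have "K \<le> e m" using m(1) by simp
        from K[OF this] bound[OF _ m(2)] m(1) show False by simp
      qed
      then show "w \<in> {w \<in> space M. L w \<le> ereal c}" using w by simp
    qed
  qed
  finally have "0 < prob {w \<in> space M. L w \<le> ereal c}"
    by (rule less_le_trans[rotated]) simp
  then show ?thesis by blast
qed

end

theorem theorem3p1:
  fixes M :: "'a measure" and W1 W2 A :: "real \<Rightarrow> 'a \<Rightarrow> real"
  assumes "std_BM2 M W1 W2"
    and "is_levy_area M W1 W2 A"
  shows "\<exists>c::real. 0 < c \<and>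
           (AE \<omega> in M. Liminf at_top (\<lambda>t. ereal (chung_rate t * running_max W1 W2 A t \<omega>)) = ereal c)"
proof -
  interpret heis_bm M "\<lambda>b. if b then W1 else W2" A by (rule levy_area_imp_heis_bm[OF assms])
  obtain c1 where c1: "0 < c1" "AE \<omega> in M. ereal c1 \<le> L \<omega>" using L_lower_bound by blast
  obtain c2 where c2: "0 < prob {\<omega> \<in> space M. L \<omega> \<le> ereal c2}" using L_upper_bound by blast
  obtain c where c: "0 < c" "AE \<omega> in M. L \<omega> = ereal c" using L_constant[OF c1(2,1) c2] by blast
  have "Liminf at_top (\<lambda>t. ereal (chung_rate t * running_max W1 W2 A t \<omega>)) = L \<omega>" if "\<omega> \<in> space M" for \<omega>
    using running_max_mono[OF that] running_max_nonneg[OF that] unfolding L_def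
    by (subst Liminf_chung_eq_liminf) auto
  then have "AE \<omega> in M. Liminf at_top (\<lambda>t. ereal (chung_rate t * running_max W1 W2 A t \<omega>)) = ereal c"
    using c(2) by (auto elim!: AE_mp)
  then show ?thesis using c(1) by blast
qed

end
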